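(* Let $k_1,k_2,k_3,k_4\in\mathbb{Z}$ and let $a_1,a_2,a_3,a_4>0$ be such that $a_i=|k_i|$ for $i=1,\ldots,4$. Let $$I=(0,\tfrac{\pi}{4})\cup(\tfrac{\pi}{4},\tfrac{\pi}{2})\cup(\tfrac{\pi}{2},\tfrac{3\pi}{4})\cup(\tfrac{3\pi}{4},\pi),$$ and let $(V^5,g)$ be the Riemannian manifold $V^5=\mathbb{S}^1\times\mathbb{S}^1\times\mathbb{S}^1\times\mathbb{S}^1\times I$ with the metric $$g=a_1^2\sin^2 s\,d\theta_1^2+a_2^2\sin^2(s+\tfrac{\pi}{4})\,d\theta_2^2+a_3^2\cos^2 s\,d\theta_3^2+a_4^2\cos^2(s+\tfrac{\pi}{4})\,d\theta_4^2+h^2(s)\,ds^2,$$ where $$h(s)=\sqrt{a_1^2\cos^2 s+a_2^2\cos^2(s+\tfrac{\pi}{4})+a_3^2\sin^2 s+a_4^2\sin^2(s+\tfrac{\pi}{4})}.$$ Then there exist (smooth) functions $\alpha:I\to(0,4\pi)$ satisfying $$\lim_{s\to 0^+}\alpha(s)=0,\quad \lim_{s\to\frac{\pi}{4}^-}\alpha(s)=\pi,\quad \lim_{s\to\frac{\pi}{4}^+}\alpha(s)=\pi,\quad \lim_{s\to\frac{\pi}{2}^-}\alpha(s)=2\pi,$$ $$\lim_{s\to\frac{\pi}{2}^+}\alpha(s)=2\pi,\quad \lim_{s\to\frac{3\pi}{4}^-}\alpha(s)=3\pi,\quad \lim_{s\to\frac{3\pi}{4}^+}\alpha(s)=3\pi,\quad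 \lim_{s\to\pi^-}\alpha(s)=4\pi,$$ such that the map $\varphi:(V^5,g)\to\mathbb{S}^2\subset\mathbb{R}^2\times\mathbb{R}$ given by $$\varphi(\theta_1,\theta_2,\theta_3,\theta_4,s)=\big[\sin\alpha(s)\,e^{i(k_1\theta_1+k_2\theta_2+k_3\theta_3+k_4\theta_4)},\ \cos\alpha(s)\big]$$ is a harmonic morphism; consequently $\varphi$ admits a continuous extension to the whole of the real algebraic variety ${V^{\ast}}^5\subset\mathbb{C}^4$.
   Context: $\mathbb{S}^2$ is the Euclidean unit sphere in $\mathbb{R}^2\times\mathbb{R}\cong\mathbb{C}\times\mathbb{R}$ with its standard metric. For $a_1,a_2,a_3,a_4>0$, ${V^{\ast}}^5={V^{\ast}}^5(a_1,a_2,a_3,a_4)$ is the real algebraic variety of points $[z_1,z_2,z_3,z_4]\in\mathbb{C}^4$ satisfying $$\frac{|z_1|^2}{a_1^2}+\frac{|z_3|^2}{a_3^2}=1,\qquad \frac{|z_2|^2}{a_2^2}+\frac{|z_4|^2}{a_4^2}=1,$$ $$\left[\frac{|z_3|^2}{a_3^2}-\frac{|z_1|^2}{a_1^2}\right]^2+\left[\frac{|z_4|^2}{a_4^2}-\frac{|z_2|^2}{a_2^2}\right]^2=1.$$ It is parametrised by $$[a_1\sin s\,e^{i\theta_1},\ a_2\sin(s+\tfrac{\pi}{4})\,e^{i\theta_2},\ a_3\cos s\,e^{i\theta_3},\ a_4\cos(s+\tfrac{\pi}{4})\,e^{i\theta_4}]$$ with $0\le\theta_1,\theta_2,\theta_3,\theta_4<2\pi$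 and $s\in[0,\pi]$ (the locus $s=\pi$ coincides with the locus $s=0$). The manifold $V^5$ is identified, through this parametrisation, with the part of ${V^{\ast}}^5$ where $s\in I$, i.e. away from the singular loci $s=0,\pi/4,\pi/2,3\pi/4$; the $\theta_i$ are angular coordinates on the circle factors $\mathbb{S}^1$, $s$ is the coordinate on $I$, and $g$ is the metric induced from the Euclidean structure of $\mathbb{C}^4=\mathbb{R}^8$. Continuous extension to ${V^{\ast}}^5$ refers to the subspace topology from $\mathbb{C}^4$. A smooth map $\varphi:(M,g)\to(N,h)$ between Riemannian manifolds is harmonic if it is a critical point of the energy functional $E(\varphi)=\frac12\int_M|d\varphi|^2\,dv_g$ (equivalently, its tension field vanishes). It is a harmonic morphism if it is harmonic and horizontally weakly conformal, i.e. at each $x\in M$ either $d\varphi_x=0$, or $d\varphi_x$ restricted to $(\ker d\varphi_x)^\perp$ is surjective onto $T_{\varphi(x)}N$ and there is a number $\Lambda(x)>0$ with $\Lambda(x)\,g(X,Y)=h(d\varphi_x(X),d\varphi_x(Y))$ for all $X,Y\in(\ker d\varphi_x)^\perp$. *)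

theory Defs
  imports "HOL-Analysis.Analysis"
begin

text \<open>Smooth (that is, C-infinity) maps on an open set \<open>S\<close>.\<close>

primrec Ck_on :: "nat \<Rightarrow> 'a set \<Rightarrow> ('a::euclidean_space \<Rightarrow> 'b::euclidean_space) \<Rightarrow> bool" where
  "Ck_on 0 S f \<longleftrightarrow> continuous_on S f"
| "Ck_on (Suc k) S f \<longleftrightarrow>
     (\<forall>x\<in>S. f differentiable (at x)) \<and>
     (\<forall>v. Ck_on k S (\<lambda>x. frechet_derivative f (at x) v))"

definition smooth_on :: "'a set \<Rightarrow> ('a::euclidean_space \<Rightarrow> 'b::euclidean_space) \<Rightarrow> bool" where
  "smooth_on S f \<longleftrightarrow> (\<forall>k. Ck_on k S f)"

text \<open>The tangent space of a submanifold \<open>N\<close> of a Euclidean space: velocities of smooth curves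
  in \<open>N\<close>. Targets carry the metric induced by the ambient inner product.\<close>

definition tangent_space :: "'b::euclidean_space set \<Rightarrow> 'b \<Rightarrow> 'b set" where
  "tangent_space N y = {v. \<exists>\<epsilon>>0. \<exists>\<gamma>. smooth_on {-\<epsilon><..<\<epsilon>} \<gamma> \<and> \<gamma> ` {-\<epsilon><..<\<epsilon>} \<subseteq> N \<and>
      \<gamma> 0 = y \<and> (\<gamma> has_vector_derivative v) (at 0)}"

text \<open>
  A Riemannian manifold \<open>M\<close> of dimension \<open>CARD('n)\<close> presented by coordinates: \<open>chart_map\<close> is a
  local diffeomorphism from the open set \<open>coords\<close> onto \<open>M\<close>, not necessarily injective (angles),
  \<open>fund\<close> is a Borel subset of \<open>coords\<close> mapped bijectively onto \<open>M\<close>, and \<open>metric p\<close> is the matrix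
  of the metric at \<open>chart_map p\<close> with respect to the coordinate vector fields. A map on \<open>M\<close> is
  smooth iff its composition with \<open>chart_map\<close> is, and the tangent space of \<open>M\<close> at \<open>chart_map p\<close>
  is identified with \<open>real ^ 'n\<close> through the differential of \<open>chart_map\<close> at \<open>p\<close>.
\<close>

record ('n, 'a) riem_mfd =
  coords :: "(real ^ 'n) set"
  chart_map :: "real ^ 'n \<Rightarrow> 'a"
  fund :: "(real ^ 'n) set"
  metric :: "real ^ 'n \<Rightarrow> real ^ 'n ^ 'n"

definition points :: "('n::finite, 'a) riem_mfd \<Rightarrow> 'a set" where
  "points M = chart_map M ` coords M"

definition metric_form :: "('n::finite, 'a) riem_mfd \<Rightarrow> real ^ 'n \<Rightarrow> real ^ 'n \<Rightarrow> real ^ 'n \<Rightarrow> real" where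
  "metric_form M p X Y = X \<bullet> (metric M p *v Y)"

definition diff_at ::
  "('n::finite, 'a) riem_mfd \<Rightarrow> ('a \<Rightarrow> 'b::euclidean_space) \<Rightarrow> real ^ 'n \<Rightarrow> real ^ 'n \<Rightarrow> 'b" where
  "diff_at M f p = frechet_derivative (f \<circ> chart_map M) (at p)"

text \<open>The squared norm \<open>|df|\<^sup>2\<close> is the trace of the pulled back metric with respect to the metric
  of \<open>M\<close>, in coordinates \<open>g\<^sup>i\<^sup>j \<langle>\<partial>\<^sub>i f, \<partial>\<^sub>j f\<rangle>\<close>; the volume element is \<open>sqrt (det g)\<close>.\<close>

definition norm_diff_sq :: "('n::finite, 'a) riem_mfd \<Rightarrow> ('a \<Rightarrow> 'b::euclidean_space) \<Rightarrow> real ^ 'n \<Rightarrow> real" where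
  "norm_diff_sq M f p = (\<Sum>i\<in>UNIV. \<Sum>j\<in>UNIV. matrix_inv (metric M p) $ i $ j *
      (diff_at M f p (axis i 1) \<bullet> diff_at M f p (axis j 1)))"

definition energy :: "('n::finite, 'a) riem_mfd \<Rightarrow> 'a set \<Rightarrow> ('a \<Rightarrow> 'b::euclidean_space) \<Rightarrow> real" where
  "energy M K f = 1 / 2 *
     (LINT p:{p \<in> fund M. chart_map M p \<in> K}|lborel. norm_diff_sq M f p * sqrt (det (metric M p)))"

definition smooth_map ::
  "('n::finite, 'a) riem_mfd \<Rightarrow> 'b::euclidean_space set \<Rightarrow> ('a \<Rightarrow> 'b) \<Rightarrow> bool" where
  "smooth_map M N f \<longleftrightarrow> smooth_on (coords M) (f \<circ> chart_map M) \<and> f ` points M \<subseteq> N"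

text \<open>Since \<open>M\<close> need not be compact, being critical for the energy means, as usual, with respect to
  smooth variations through maps into \<open>N\<close> that are fixed outside a compact set \<open>K\<close>, the energy
  being taken over \<open>K\<close>.\<close>

definition compact_variation ::
  "('n::finite, 'a::topological_space) riem_mfd \<Rightarrow> 'b::euclidean_space set \<Rightarrow> ('a \<Rightarrow> 'b) \<Rightarrow>
    'a set \<Rightarrow> real \<Rightarrow> (real \<Rightarrow> 'a \<Rightarrow> 'b) \<Rightarrow> bool" where
  "compact_variation M N f K \<epsilon> F \<longleftrightarrow>
     compact K \<and> K \<subseteq> points M \<and> \<epsilon> > 0 \<and>
     smooth_on ({-\<epsilon><..<\<epsilon>} \<times> coords M) (\<lambda>(t, p). F t (chart_map M p)) \<and>
     (\<forall>t\<in>{-\<epsilon><..<\<epsilon>}. \<forall>x\<in>points M. F t x \<in> N) \<and>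
     (\<forall>x\<in>points M. F 0 x = f x) \<and>
     (\<forall>t\<in>{-\<epsilon><..<\<epsilon>}. \<forall>x\<in>points M - K. F t x = f x)"

definition harmonic_map ::
  "('n::finite, 'a::topological_space) riem_mfd \<Rightarrow> 'b::euclidean_space set \<Rightarrow> ('a \<Rightarrow> 'b) \<Rightarrow> bool" where
  "harmonic_map M N f \<longleftrightarrow> smooth_map M N f \<and>
     (\<forall>K \<epsilon> F. compact_variation M N f K \<epsilon> F \<longrightarrow>
        ((\<lambda>t. energy M K (F t)) has_real_derivative 0) (at 0))"

definition horizontal_space ::
  "('n::finite, 'a) riem_mfd \<Rightarrow> ('a \<Rightarrow> 'b::euclidean_space) \<Rightarrow> real ^ 'n \<Rightarrow> (real ^ 'n) set" where
  "horizontal_space M f p = {X. \<forall>Y. diff_at M f p Y = 0 \<longrightarrow> metric_form M p X Y = 0}"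

definition horizontally_weakly_conformal ::
  "('n::finite, 'a) riem_mfd \<Rightarrow> 'b::euclidean_space set \<Rightarrow> ('a \<Rightarrow> 'b) \<Rightarrow> bool" where
  "horizontally_weakly_conformal M N f \<longleftrightarrow> (\<forall>p\<in>coords M.
     (\<forall>X. diff_at M f p X = 0) \<or>
     (diff_at M f p ` horizontal_space M f p = tangent_space N (f (chart_map M p)) \<and>
      (\<exists>\<Lambda>>0. \<forall>X\<in>horizontal_space M f p. \<forall>Y\<in>horizontal_space M f p.
         \<Lambda> * metric_form M p X Y = diff_at M f p X \<bullet> diff_at M f p Y)))"

definition harmonic_morphism ::
  "('n::finite, 'a::topological_space) riem_mfd \<Rightarrow> 'b::euclidean_space set \<Rightarrow> ('a \<Rightarrow> 'b) \<Rightarrow> bool" where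
  "harmonic_morphism M N f \<longleftrightarrow> harmonic_map M N f \<and> horizontally_weakly_conformal M N f"

definition I_dom :: "real set" where
  "I_dom = {0<..<pi/4} \<union> {pi/4<..<pi/2} \<union> {pi/2<..<3*pi/4} \<union> {3*pi/4<..<pi}"

definition h_fun :: "real \<Rightarrow> real \<Rightarrow> real \<Rightarrow> real \<Rightarrow> real \<Rightarrow> real" where
  "h_fun a1 a2 a3 a4 s =
     sqrt (a1\<^sup>2 * (cos s)\<^sup>2 + a2\<^sup>2 * (cos (s + pi/4))\<^sup>2 + a3\<^sup>2 * (sin s)\<^sup>2 + a4\<^sup>2 * (sin (s + pi/4))\<^sup>2)"

text \<open>The coordinates are \<open>p = (\<theta>\<^sub>1, \<theta>\<^sub>2, \<theta>\<^sub>3, \<theta>\<^sub>4, s)\<close>; the points of \<open>V5\<close> are the pairs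
  \<open>(w, s)\<close> with \<open>w\<close> in the product of four unit circles and \<open>s \<in> I_dom\<close>.\<close>

definition V5 :: "real \<Rightarrow> real \<Rightarrow> real \<Rightarrow> real \<Rightarrow> (5, (complex ^ 4) \<times> real) riem_mfd" where
  "V5 a1 a2 a3 a4 = \<lparr>
     coords = {p. p $ 5 \<in> I_dom},
     chart_map = (\<lambda>p. (vector [cis (p $ 1), cis (p $ 2), cis (p $ 3), cis (p $ 4)], p $ 5)),
     fund = {p. (\<forall>i\<in>{1, 2, 3, 4}. 0 \<le> p $ i \<and> p $ i < 2 * pi) \<and> p $ 5 \<in> I_dom},
     metric = (\<lambda>p. let s = p $ 5 in \<chi> i j. if i = j
        then vector [a1\<^sup>2 * (sin s)\<^sup>2, a2\<^sup>2 * (sin (s + pi/4))\<^sup>2,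
                     a3\<^sup>2 * (cos s)\<^sup>2, a4\<^sup>2 * (cos (s + pi/4))\<^sup>2,
                     (h_fun a1 a2 a3 a4 s)\<^sup>2] $ i
        else 0) \<rparr>"

definition Vstar :: "real \<Rightarrow> real \<Rightarrow> real \<Rightarrow> real \<Rightarrow> (complex ^ 4) set" where
  "Vstar a1 a2 a3 a4 = {z.
     (cmod (z $ 1))\<^sup>2 / a1\<^sup>2 + (cmod (z $ 3))\<^sup>2 / a3\<^sup>2 = 1 \<and>
     (cmod (z $ 2))\<^sup>2 / a2\<^sup>2 + (cmod (z $ 4))\<^sup>2 / a4\<^sup>2 = 1 \<and>
     ((cmod (z $ 3))\<^sup>2 / a3\<^sup>2 - (cmod (z $ 1))\<^sup>2 / a1\<^sup>2)\<^sup>2 +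
     ((cmod (z $ 4))\<^sup>2 / a4\<^sup>2 - (cmod (z $ 2))\<^sup>2 / a2\<^sup>2)\<^sup>2 = 1}"

text \<open>The parametrisation identifying \<open>V5\<close> with the regular part of \<open>Vstar\<close>.\<close>

definition V5_embed :: "real \<Rightarrow> real \<Rightarrow> real \<Rightarrow> real \<Rightarrow> (complex ^ 4) \<times> real \<Rightarrow> complex ^ 4" where
  "V5_embed a1 a2 a3 a4 = (\<lambda>(w, s). vector
     [of_real (a1 * sin s) * w $ 1, of_real (a2 * sin (s + pi/4)) * w $ 2,
      of_real (a3 * cos s) * w $ 3, of_real (a4 * cos (s + pi/4)) * w $ 4])"

definition S2 :: "(complex \<times> real) set" where
  "S2 = sphere 0 1"

end

theory Submission
  imports Defs
begin

text \<open>
  Let \<open>h\<^sup>2\<close> be the coefficient of \<open>ds\<^sup>2\<close>. Since \<open>a\<^sub>i = |k\<^sub>i|\<close>, the horizontal conformality of \<open>\<phi>\<close> and its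
  harmonic map equation both reduce to the single first order equation
  \<open>\<alpha>' = 4 h sin \<alpha> / sin 4s\<close>. Between two consecutive multiples of \<open>\<pi>/4\<close> it is solved by
  \<open>\<alpha> = j \<pi> + 2 arctan (exp G)\<close> with \<open>G' = 4 h / |sin 4s|\<close>, and \<open>G\<close> runs from \<open>-\<infinity>\<close> to \<open>\<infinity>\<close>
  because \<open>h \<ge> 1\<close>.

  For a variation \<open>f + u\<^sub>t\<close> of \<open>f\<close>, the part of the energy that is linear in \<open>u\<^sub>t\<close> is integrated by
  parts at fixed \<open>t\<close>. The harmonic map equation turns it into a multiple of \<open>\<langle>f, u\<^sub>t\<rangle> = - |u\<^sub>t|\<^sup>2 / 2\<close>, so
  that the energy differs from its value at \<open>t = 0\<close> by \<open>O(t\<^sup>2)\<close>.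

  The map extends continuously because \<open>(\<theta>, s) \<mapsto> z\<close> is a quotient map from the compact box
  \<open>[0, 2\<pi>]\<^sup>4 \<times> [0, \<pi>]\<close>, and the map in coordinates is continuous on the box and constant on the fibres.
\<close>

section \<open>Functions of class \<open>C\<^sup>k\<close>\<close>

text \<open>The number 4 and \<open>sin (4 * s)\<close> come from the phase: since a_i = |k_i|, the
  sum of the k_i^2 / g_ii collapses, by doubling the angle twice, to 16 / (sin 4s)^2, and
  conformality asks for (\<alpha>' / h)^2 = (sin \<alpha>)^2 times this sum. The square root is
  chosen so that sin \<alpha> and sin 4s change sign together; then \<alpha> increases on all four
  components and the pieces fit at pi, 2 pi, 3 pi. With this choice sqrt (det g) \<alpha>' / h^2 is
  a locally constant multiple of sin \<alpha>, so one differentiation of the first order equation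
  gives the second order one. The obstacle to harmonicity is the domain of the energy: K is an
  arbitrary compact set without usable boundary. The difference of two energy densities vanishes off
  K, so K can be traded for four coordinate boxes, one in each component. There the boundary terms
  cancel by periodicity in the angles and because the variation is trivial near both ends in s. At
  fixed t only Lipschitz bounds in t for the map and its first space derivatives are then required,
  and the derivative of the energy exists as a consequence of the estimate.\<close>

lemma Ck_on_cong:
  assumes "open S" "\<And>x. x \<in> S \<Longrightarrow> f x = g x" "Ck_on k S f"
  shows "Ck_on k S g"
  using assms(2,3)
proof (induction k arbitrary: f g)
  case 0
  then show ?case by (simp cong: continuous_on_cong)
next
  case (Suc k)
  have der: "(g has_derivative frechet_derivative f (at x)) (at x)" if "x \<in> S" for x
    using has_derivative_transform_within_open[OF _ assms(1) that Suc.prems(1)] Suc.prems that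
    by (auto simp: frechet_derivative_works)
  then have "frechet_derivative g (at x) = frechet_derivative f (at x)" if "x \<in> S" for x
    using frechet_derivative_at that by metis
  then show ?case
    using Suc.IH[of "\<lambda>x. frechet_derivative f (at x) v" "\<lambda>x. frechet_derivative g (at x) v" for v]
      Suc.prems(2) der by (auto simp: differentiable_def)
qed

text \<open>\<open>frechet_derivative\<close> is a choice operator; this rule lets an explicit
  derivative formula stand in for it, and most closure properties below go through it.\<close>

lemma Ck_on_SucI:
  assumes "open S" "\<And>x. x \<in> S \<Longrightarrow> (f has_derivative f' x) (at x)" "\<And>v. Ck_on k S (\<lambda>x. f' x v)"
  shows "Ck_on (Suc k) S f"
proof -
  have "frechet_derivative f (at x) = f' x" if "x \<in> S" for x
    using frechet_derivative_at assms(2) that by metis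
  then have "Ck_on k S (\<lambda>x. frechet_derivative f (at x) v)" for v
    using Ck_on_cong[OF assms(1) _ assms(3)[of v]] by simp
  with assms(2) show ?thesis by (auto simp: differentiable_def)
qed

lemma Ck_on_SucD: "Ck_on (Suc k) S f \<Longrightarrow> Ck_on k S f"
proof (induction k arbitrary: f)
  case 0
  then show ?case
    by (auto intro!: continuous_at_imp_continuous_on differentiable_imp_continuous_within)
next
  case (Suc k)
  have "\<forall>x\<in>S. f differentiable (at x)" "\<And>v. Ck_on (Suc k) S (\<lambda>x. frechet_derivative f (at x) v)"
    using Suc.prems by simp_all
  with Suc.IH show ?case by simp
qed

lemma Ck_on_has_derivative:
  "Ck_on (Suc k) S f \<Longrightarrow> x \<in> S \<Longrightarrow> (f has_derivative frechet_derivative f (at x)) (at x)"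
  by (simp add: frechet_derivative_works)

lemma Ck_on_const: "Ck_on k S (\<lambda>x. c)"
  by (induction k arbitrary: c) (auto simp: frechet_derivative_const)

lemma Ck_on_add:
  assumes "open S" "Ck_on k S f" "Ck_on k S g"
  shows "Ck_on k S (\<lambda>x. f x + g x)"
  using assms(2,3)
proof (induction k arbitrary: f g)
  case 0
  then show ?case by (simp add: continuous_on_add)
next
  case (Suc k)
  show ?case
  proof (rule Ck_on_SucI[OF assms(1)])
    show "((\<lambda>x. f x + g x) has_derivative
        (\<lambda>v. frechet_derivative f (at x) v + frechet_derivative g (at x) v)) (at x)" if "x \<in> S" for x
      using Suc.prems that by (intro has_derivative_add) (auto intro: Ck_on_has_derivative)
  qed (use Suc in auto)
qed

text \<open>Each term of the product rule pairs one factor with the derivative of the other, so the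
  induction runs over all \<open>f\<close> and \<open>g\<close>, and the undifferentiated factor is
  first lowered by one order.\<close>

lemma Ck_on_bilinear:
  assumes "open S" "bounded_bilinear B" "Ck_on k S f" "Ck_on k S g"
  shows "Ck_on k S (\<lambda>x. B (f x) (g x))"
  using assms(3,4)
proof (induction k arbitrary: f g)
  case 0
  then show ?case using bounded_bilinear.continuous_on[OF assms(2)] by auto
next
  case (Suc k)
  show ?case
  proof (rule Ck_on_SucI[OF assms(1)])
    show "((\<lambda>x. B (f x) (g x)) has_derivative
        (\<lambda>v. B (f x) (frechet_derivative g (at x) v) + B (frechet_derivative f (at x) v) (g x))) (at x)"
      if "x \<in> S" for x
      using Suc.prems that
      by (intro bounded_bilinear.FDERIV[OF assms(2)]) (auto intro: Ck_on_has_derivative)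
    show "Ck_on k S (\<lambda>x. B (f x) (frechet_derivative g (at x) v) + B (frechet_derivative f (at x) v) (g x))" for v
      using Suc.prems Suc.prems[THEN Ck_on_SucD] by (intro Ck_on_add assms(1) Suc.IH) simp_all
  qed
qed

lemma Ck_on_linear_comp:
  assumes "open S" "bounded_linear L" "Ck_on k S f"
  shows "Ck_on k S (\<lambda>x. L (f x))"
  using assms(3)
proof (induction k arbitrary: f)
  case 0
  then show ?case using bounded_linear.continuous_on[OF assms(2)] by auto
next
  case (Suc k)
  show ?case
  proof (rule Ck_on_SucI[OF assms(1)])
    show "((\<lambda>x. L (f x)) has_derivative (\<lambda>v. L (frechet_derivative f (at x) v))) (at x)"
      if "x \<in> S" for x
      using Suc.prems that
      by (intro bounded_linear.has_derivative[OF assms(2)]) (auto intro: Ck_on_has_derivative)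
  qed (use Suc in auto)
qed

lemma Ck_on_comp_linear:
  assumes "open S" "bounded_linear L" "L ` S \<subseteq> T" "Ck_on k T f"
  shows "Ck_on k S (\<lambda>x. f (L x))"
  using assms(4)
proof (induction k arbitrary: f)
  case 0
  then show ?case
    using continuous_on_compose2[OF _ linear_continuous_on[OF assms(2)] assms(3)] by auto
next
  case (Suc k)
  show ?case
  proof (rule Ck_on_SucI[OF assms(1)])
    show "((\<lambda>x. f (L x)) has_derivative (\<lambda>v. frechet_derivative f (at (L x)) (L v))) (at x)"
      if "x \<in> S" for x
      using Suc.prems that assms(3)
      by (intro has_derivative_compose[OF bounded_linear_imp_has_derivative[OF assms(2)]])
        (auto intro!: Ck_on_has_derivative)
  qed (use Suc in auto)
qed

lemma Ck_on_real_SucI: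
  fixes f :: "real \<Rightarrow> 'a::euclidean_space"
  assumes "open S" "\<And>x. x \<in> S \<Longrightarrow> (f has_vector_derivative f' x) (at x)" "Ck_on k S f'"
  shows "Ck_on (Suc k) S f"
proof (rule Ck_on_SucI[OF assms(1)])
  show "(f has_derivative (\<lambda>v. v *\<^sub>R f' x)) (at x)" if "x \<in> S" for x
    using assms(2)[OF that] by (simp add: has_vector_derivative_def)
  show "Ck_on k S (\<lambda>x. v *\<^sub>R f' x)" for v
    by (rule Ck_on_linear_comp[OF assms(1) bounded_linear_scaleR_right assms(3)])
qed

lemma Ck_on_mult:
  fixes f g :: "'a::euclidean_space \<Rightarrow> real"
  shows "open S \<Longrightarrow> Ck_on k S f \<Longrightarrow> Ck_on k S g \<Longrightarrow> Ck_on k S (\<lambda>x. f x * g x)"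
  by (rule Ck_on_bilinear[OF _ bounded_bilinear_mult])

lemma Ck_on_minus: "open S \<Longrightarrow> Ck_on k S f \<Longrightarrow> Ck_on k S (\<lambda>x. - f x)"
  by (rule Ck_on_linear_comp[OF _ bounded_linear_minus[OF bounded_linear_ident]])

lemma Ck_on_real_SucE:
  fixes f :: "real \<Rightarrow> real"
  assumes "Ck_on (Suc k) S f"
  obtains f' where "\<And>x. x \<in> S \<Longrightarrow> (f has_real_derivative f' x) (at x)" "Ck_on k S f'"
proof
  show "(f has_real_derivative frechet_derivative f (at x) 1) (at x)" if "x \<in> S" for x
  proof -
    have *: "(f has_derivative frechet_derivative f (at x)) (at x)"
      using assms that by (rule Ck_on_has_derivative)
    have "frechet_derivative f (at x) = (\<lambda>v. frechet_derivative f (at x) 1 * v)"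
    proof
      fix v
      show "frechet_derivative f (at x) v = frechet_derivative f (at x) 1 * v"
        using linear_scale[OF has_derivative_linear[OF *], of v 1] by (simp only: real_scaleR_def mult_1_left mult_1_right mult.commute)
    qed
    with * show ?thesis unfolding has_field_derivative_def by metis
  qed
  show "Ck_on k S (\<lambda>x. frechet_derivative f (at x) 1)"
    using assms by simp
qed

text \<open>Both functions are treated at once since their derivatives refer to each other.\<close>

lemma Ck_on_sin_cos:
  fixes f :: "real \<Rightarrow> real"
  assumes "open S" "Ck_on k S f"
  shows "Ck_on k S (\<lambda>x. sin (f x)) \<and> Ck_on k S (\<lambda>x. cos (f x))"
  using assms(2)
proof (induction k)
  case 0
  then show ?case by (auto intro: continuous_intros)
next
  case (Suc k)
  obtain f' where f': "\<And>x. x \<in> S \<Longrightarrow> (f has_real_derivative f' x) (at x)" "Ck_on k S f'"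
    using Ck_on_real_SucE[OF Suc.prems] by blast
  have IH: "Ck_on k S (\<lambda>x. sin (f x))" "Ck_on k S (\<lambda>x. cos (f x))"
    using Suc.IH Ck_on_SucD[OF Suc.prems] by auto
  have "Ck_on (Suc k) S (\<lambda>x. sin (f x))"
    by (rule Ck_on_real_SucI[OF assms(1), where f' = "\<lambda>x. cos (f x) * f' x"])
      (use f'(1) in \<open>auto intro!: derivative_eq_intros Ck_on_mult assms(1) IH f'(2)
         simp: has_real_derivative_iff_has_vector_derivative[symmetric]\<close>)
  moreover have "Ck_on (Suc k) S (\<lambda>x. cos (f x))"
    by (rule Ck_on_real_SucI[OF assms(1), where f' = "\<lambda>x. - (sin (f x) * f' x)"])
      (use f'(1) in \<open>auto intro!: derivative_eq_intros Ck_on_mult Ck_on_minus assms(1) IH f'(2)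
         simp: has_real_derivative_iff_has_vector_derivative[symmetric]\<close>)
  ultimately show ?case ..
qed

lemma Ck_on_id: "open S \<Longrightarrow> Ck_on k S (\<lambda>x. x)"
  by (induction k) (auto intro!: Ck_on_const simp: frechet_derivative_ident)

text \<open>The derivative of 1/f is built from f' and 1/f itself, so class k of 1/f already
  controls the derivative and gains one order.\<close>

lemma Ck_on_inverse:
  fixes f :: "real \<Rightarrow> real"
  assumes "open S" "Ck_on k S f" "\<And>x. x \<in> S \<Longrightarrow> f x \<noteq> 0"
  shows "Ck_on k S (\<lambda>x. inverse (f x))"
  using assms(2)
proof (induction k)
  case 0
  then show ?case using assms(3) by (auto intro: continuous_intros)
next
  case (Suc k)
  obtain f' where f': "\<And>x. x \<in> S \<Longrightarrow> (f has_real_derivative f' x) (at x)" "Ck_on k S f'"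
    using Ck_on_real_SucE[OF Suc.prems] by blast
  have "Ck_on k S (\<lambda>x. inverse (f x))"
    using Suc Ck_on_SucD by auto
  then show ?case
    by (intro Ck_on_real_SucI[OF assms(1), where f' = "\<lambda>x. - (inverse (f x) * (f' x * inverse (f x)))"])
      (use assms f' in \<open>auto intro!: derivative_eq_intros Ck_on_mult Ck_on_minus
         simp: has_real_derivative_iff_has_vector_derivative[symmetric]\<close>)
qed

lemma Ck_on_sqrt:
  fixes f :: "real \<Rightarrow> real"
  assumes "open S" "Ck_on k S f" "\<And>x. x \<in> S \<Longrightarrow> f x > 0"
  shows "Ck_on k S (\<lambda>x. sqrt (f x))"
  using assms(2)
proof (induction k)
  case 0
  then show ?case by (auto intro: continuous_intros)
next
  case (Suc k)
  obtain f' where f': "\<And>x. x \<in> S \<Longrightarrow> (f has_real_derivative f' x) (at x)" "Ck_on k S f'"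
    using Ck_on_real_SucE[OF Suc.prems] by blast
  have "Ck_on k S (\<lambda>x. inverse (sqrt (f x)))"
    using Suc Ck_on_SucD assms(3) by (intro Ck_on_inverse[OF assms(1)]) (auto simp: less_le)
  then have c: "Ck_on k S (\<lambda>x. f' x * (inverse (sqrt (f x)) * (1/2)))"
    by (intro Ck_on_mult Ck_on_const assms(1) f')
  have "((\<lambda>x. sqrt (f x)) has_real_derivative f' x * (inverse (sqrt (f x)) * (1/2))) (at x)" if "x \<in> S" for x
    using DERIV_chain'[OF f'(1)[OF that] DERIV_real_sqrt[OF assms(3)[OF that]]]
    by (simp add: mult.commute)
  then show ?case
    by (intro Ck_on_real_SucI[OF assms(1) _ c]) (auto simp: has_real_derivative_iff_has_vector_derivative[symmetric])
qed

section \<open>Integration by parts on boxes\<close>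

text \<open>Both \<open>x\<close> and \<open>y\<close> are measured from the lower face along
  \<open>i\<close>. The upper corner already carries \<open>b \<bullet> i\<close>, which is why the
  side length is subtracted from \<open>y\<close>.\<close>

lemma mem_cbox_along:
  fixes p :: "'a::euclidean_space"
  assumes "i \<in> Basis"
  shows "p \<in> cbox (a + x *\<^sub>R i) (b + (y - (b \<bullet> i - a \<bullet> i)) *\<^sub>R i) \<longleftrightarrow>
    (\<forall>j\<in>Basis - {i}. a \<bullet> j \<le> p \<bullet> j \<and> p \<bullet> j \<le> b \<bullet> j) \<and> a \<bullet> i + x \<le> p \<bullet> i \<and> p \<bullet> i \<le> a \<bullet> i + y"
proof -
  have "i \<bullet> j = (if i = j then 1 else 0)" if "j \<in> Basis" for j
    using assms that by (auto simp: inner_Basis)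
  then have "p \<in> cbox (a + x *\<^sub>R i) (b + (y - (b \<bullet> i - a \<bullet> i)) *\<^sub>R i) \<longleftrightarrow>
    (\<forall>j\<in>Basis. if j = i then a \<bullet> i + x \<le> p \<bullet> i \<and> p \<bullet> i \<le> a \<bullet> i + y
      else a \<bullet> j \<le> p \<bullet> j \<and> p \<bullet> j \<le> b \<bullet> j)"
    by (auto simp: mem_box inner_add_left)
  then show ?thesis using assms by (auto split: if_splits)
qed

text \<open>The integral of \<open>g\<close> over the translate of the box by \<open>t *\<^sub>R i\<close> does not depend on small
  \<open>t \<ge> 0\<close>, because the slab that is lost is the translate by a period of the slab that is gained.
  Differentiating under the integral sign at \<open>t = 0\<close> gives the claim.\<close>

lemma integral_periodic_partial_derivative:
  fixes g g' :: "'a::euclidean_space \<Rightarrow> real"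
  assumes i: "i \<in> Basis" and ab: "a \<bullet> i < b \<bullet> i" and \<delta>: "\<delta> > 0"
    and der: "\<And>p. p \<in> cbox a (b + \<delta> *\<^sub>R i) \<Longrightarrow> ((\<lambda>t. g (p + t *\<^sub>R i)) has_real_derivative g' p) (at 0)"
    and cont: "continuous_on (cbox a (b + \<delta> *\<^sub>R i)) g" "continuous_on (cbox a (b + \<delta> *\<^sub>R i)) g'"
    and per: "\<And>p. p \<in> cbox a b \<Longrightarrow> p \<bullet> i \<le> a \<bullet> i + \<delta> \<Longrightarrow> g (p + (b \<bullet> i - a \<bullet> i) *\<^sub>R i) = g p"
  shows "integral (cbox a b) g' = 0"
proof -
  define L where "L = b \<bullet> i - a \<bullet> i"
  \<comment> \<open>A shift of at most \<delta> stays in the enlarged box, and one of at most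
    \<open>L\<close> loses only a slab that lies in the original box.\<close>
  define e where "e = min \<delta> L"
  have e: "0 < e" "e \<le> \<delta>" "e \<le> L" using \<delta> ab by (auto simp: e_def L_def)
  define Bx where "Bx x y = cbox (a + x *\<^sub>R i) (b + (y - L) *\<^sub>R i)" for x y
  have mem: "p \<in> Bx x y \<longleftrightarrow> (\<forall>j\<in>Basis - {i}. a \<bullet> j \<le> p \<bullet> j \<and> p \<bullet> j \<le> b \<bullet> j) \<and>
      a \<bullet> i + x \<le> p \<bullet> i \<and> p \<bullet> i \<le> a \<bullet> i + y" for p x y
    unfolding Bx_def L_def by (rule mem_cbox_along[OF i])
  have B0: "Bx 0 L = cbox a b" and B\<delta>: "Bx 0 (L + \<delta>) = cbox a (b + \<delta> *\<^sub>R i)"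
    by (simp_all add: Bx_def)
  have big: "p + t *\<^sub>R i \<in> cbox a (b + \<delta> *\<^sub>R i)" if "p \<in> cbox a b" "t \<in> {0..e}" for p t
    using that e i mem[of p 0 L] mem[of "p + t *\<^sub>R i" 0 "L + \<delta>"] unfolding B0 B\<delta>
    by (auto simp: inner_add_left inner_not_same_Basis)
  have Bx_sub: "Bx x y \<subseteq> cbox a (b + \<delta> *\<^sub>R i)" if "0 \<le> x" "y \<le> L + \<delta>" for x y
    using that unfolding B\<delta>[symmetric] by (auto simp: mem)
  have int: "g integrable_on Bx x y" if "0 \<le> x" "y \<le> L + \<delta>" for x y
    using continuous_on_subset[OF cont(1) Bx_sub[OF that]] unfolding Bx_def
    by (rule integrable_continuous)
  have split: "integral (Bx x z) g = integral (Bx x y) g + integral (Bx y z) g"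
    if "0 \<le> x" "x \<le> y" "y \<le> z" "z \<le> L + \<delta>" for x y z
  proof -
    have "Bx x z \<inter> {p. p \<bullet> i \<le> a \<bullet> i + y} = Bx x y" "Bx x z \<inter> {p. p \<bullet> i \<ge> a \<bullet> i + y} = Bx y z"
      using that by (auto simp: mem)
    then show ?thesis
      using integral_split[OF _ i, of g "a + x *\<^sub>R i" "b + (z - L) *\<^sub>R i" "a \<bullet> i + y"] int[of x z] that
      unfolding Bx_def by simp
  qed
  have shift: "integral (Bx x y) (\<lambda>p. g (p + t *\<^sub>R i)) = integral (Bx (x + t) (y + t)) g" for x y t
    using integral_shift_cbox_plus[of "a + x *\<^sub>R i" "b + (y - L) *\<^sub>R i" g "t *\<^sub>R i"]
    by (simp add: Bx_def o_def algebra_simps)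
  have const: "integral (cbox a b) (\<lambda>p. g (p + t *\<^sub>R i)) = integral (cbox a b) g"
    if t: "t \<in> {0..e}" for t
  proof -
    have "integral (Bx 0 t) g = integral (Bx 0 t) (\<lambda>p. g (p + L *\<^sub>R i))"
    proof (rule Henstock_Kurzweil_Integration.integral_cong)
      fix p assume p: "p \<in> Bx 0 t"
      have "p \<in> cbox a b"
        using p t e unfolding B0[symmetric] by (auto simp: mem)
      moreover have "p \<bullet> i \<le> a \<bullet> i + \<delta>"
        using p t e by (auto simp: mem)
      ultimately show "g p = g (p + L *\<^sub>R i)"
        using per unfolding L_def by simp
    qed
    also have "\<dots> = integral (Bx L (L + t)) g"
      using shift[of 0 t L] by (simp add: add.commute)
    finally have "integral (Bx 0 t) g = integral (Bx L (L + t)) g" .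
    then have "integral (Bx t (L + t)) g = integral (Bx 0 L) g"
      using split[of t L "L + t"] split[of 0 t L] t e by simp
    then show ?thesis
      using shift[of 0 L t] B0 by simp
  qed
  \<comment> \<open>The derivative is one-sided because the box is enlarged in the positive
    direction only.\<close>
  have "((\<lambda>t. integral (cbox a b) (\<lambda>p. g (p + t *\<^sub>R i))) has_field_derivative
      integral (cbox a b) (\<lambda>p. g' (p + 0 *\<^sub>R i))) (at 0 within {0..e})"
  proof (rule leibniz_rule_field_derivative[where fx = "\<lambda>t p. g' (p + t *\<^sub>R i)"])
    fix t p assume t: "t \<in> {0..e}" and p: "p \<in> cbox a b"
    have "((\<lambda>s. g ((p + t *\<^sub>R i) + s *\<^sub>R i)) has_real_derivative g' (p + t *\<^sub>R i)) (at (t - t))"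
      using der[OF big[OF p t]] by simp
    then have "((\<lambda>s. g (p + s *\<^sub>R i)) has_real_derivative g' (p + t *\<^sub>R i)) (at t)"
      using DERIV_shift[of "\<lambda>s. g (p + t *\<^sub>R i + s *\<^sub>R i)" "g' (p + t *\<^sub>R i)" t "-t"]
      by (simp add: algebra_simps)
    then show "((\<lambda>s. g (p + s *\<^sub>R i)) has_field_derivative g' (p + t *\<^sub>R i)) (at t within {0..e})"
      by (rule has_field_derivative_at_within)
  next
    fix t assume t: "t \<in> {0..e}"
    have "continuous_on (cbox a b) (\<lambda>p. g (p + t *\<^sub>R i))"
      by (rule continuous_on_compose2[OF cont(1)]) (use big t in \<open>auto intro!: continuous_intros\<close>)
    then show "(\<lambda>p. g (p + t *\<^sub>R i)) integrable_on cbox a b"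
      by (rule integrable_continuous)
  next
    show "continuous_on ({0..e} \<times> cbox a b) (\<lambda>(t, p). g' (p + t *\<^sub>R i))"
      unfolding split_beta
      by (rule continuous_on_compose2[OF cont(2)]) (use big in \<open>auto intro!: continuous_intros\<close>)
  qed (use e in auto)
  moreover have "((\<lambda>t. integral (cbox a b) (\<lambda>p. g (p + t *\<^sub>R i))) has_field_derivative 0) (at 0 within {0..e})"
    by (rule has_field_derivative_transform_within[where f = "\<lambda>t. integral (cbox a b) g" and d = 1])
      (use const e in auto)
  ultimately show ?thesis
    using e vector_derivative_unique_within_closed_interval[of 0 e 0]
    by (simp add: has_real_derivative_iff_has_vector_derivative)
qed

text \<open>The difference quotient is at most C |t|, so a quadratic estimate yields both the
  existence and the value of the derivative.\<close>

lemma has_real_derivative_zero_quadratic: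
  fixes f :: "real \<Rightarrow> real"
  assumes "e > 0" "\<And>t. \<bar>t\<bar> \<le> e \<Longrightarrow> \<bar>f t - f 0\<bar> \<le> C * t\<^sup>2"
  shows "(f has_real_derivative 0) (at 0)"
proof -
  have "((\<lambda>t. (f t - f 0) / t) \<longlongrightarrow> 0) (at 0)"
  proof (rule Lim_null_comparison[where g = "\<lambda>t. C * \<bar>t\<bar>"])
    have "eventually (\<lambda>t. \<bar>t\<bar> < e) (at 0)"
      using assms(1) by (auto simp: eventually_at dist_norm)
    then show "eventually (\<lambda>t. norm ((f t - f 0) / t) \<le> C * \<bar>t\<bar>) (at 0)"
    proof eventually_elim
      case (elim t)
      then show ?case
        using assms(2)[of t] by (cases "t = 0") (auto simp: divide_le_eq power2_eq_square abs_mult algebra_simps)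
    qed
    show "((\<lambda>t. C * \<bar>t\<bar>) \<longlongrightarrow> 0) (at 0)"
      by (auto intro!: tendsto_eq_intros)
  qed
  then show ?thesis by (simp add: has_field_derivative_iff)
qed

text \<open>A continuous map from a compact set to a Hausdorff space is closed onto its image: the
  preimage of a closed set under \<open>F\<close> is the \<open>q\<close>-image of a compact
  set.\<close>

lemma continuous_on_compact_image_factor:
  fixes q :: "'a::topological_space \<Rightarrow> 'b::t2_space" and f :: "'a \<Rightarrow> 'c::topological_space"
  assumes "compact K" "continuous_on K q" "continuous_on K f" "\<And>x. x \<in> K \<Longrightarrow> F (q x) = f x"
  shows "continuous_on (q ` K) F"
proof (rule continuous_on_closed_vimage[THEN iffD2, rule_format])
  show "closed (q ` K)"
    using assms compact_imp_closed compact_continuous_image by blast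
next
  fix C :: "'c set" assume "closed C"
  have "compact (K \<inter> f -` C)"
    using continuous_closedin_preimage[OF assms(3) \<open>closed C\<close>] assms(1)
    by (metis closedin_compact)
  then have "closed (q ` (K \<inter> f -` C))"
    using assms(2) by (meson compact_imp_closed compact_continuous_image continuous_on_subset inf_le1)
  moreover have "F -` C \<inter> q ` K = q ` (K \<inter> f -` C)"
    using assms(4) by auto
  ultimately show "closed (F -` C \<inter> q ` K)" by simp
qed

lemma compact_subset_open_interval:
  fixes S :: "real set"
  assumes "compact S" "S \<subseteq> {l<..<r}" "l < r"
  obtains l' r' where "l < l'" "l' < r'" "r' < r" "S \<subseteq> {l'..r'}"
proof (cases "S = {}")
  case True
  then show ?thesis
    using that[of "(2*l+r)/3" "(l+2*r)/3"] assms(3) by simp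
next
  case False
  obtain x y where "x \<in> S" "\<forall>s\<in>S. x \<le> s" "y \<in> S" "\<forall>s\<in>S. s \<le> y"
    using compact_attains_inf[OF assms(1) False] compact_attains_sup[OF assms(1) False] by metis
  \<comment> \<open>Midpoints between the extrema of \<open>S\<close> and the ends keep l' < r' even
    when \<open>S\<close> is a single point.\<close>
  then show ?thesis
    using that[of "(l + x)/2" "(y + r)/2"] assms(2) by (force simp: field_simps)
qed

section \<open>The profile\<close>

lemma filterlim_ln_tan_double:
  "filterlim (\<lambda>x. ln (tan (2 * x))) at_bot (at_right (0::real))"
  "filterlim (\<lambda>x. ln (tan (2 * x))) at_top (at_left (pi/4))"
proof -
  have "((\<lambda>x. tan (2 * x)) \<longlongrightarrow> 0) (at_right (0::real))"
    by (auto intro!: tendsto_eq_intros)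
  moreover have "eventually (\<lambda>x. tan (2 * x) > 0) (at_right (0::real))"
    unfolding eventually_at_right_field
    by (rule exI[of _ "pi/4"]) (auto intro!: tan_gt_zero)
  ultimately have "filterlim (\<lambda>x. tan (2 * x)) (at_right 0) (at_right (0::real))"
    by (auto simp: filterlim_at elim: eventually_mono)
  then show "filterlim (\<lambda>x. ln (tan (2 * x))) at_bot (at_right (0::real))"
    by (rule filterlim_compose[OF ln_at_0])
  have "((\<lambda>x. 2 * x) \<longlongrightarrow> pi/2) (at_left (pi/4))"
    by (auto intro!: tendsto_eq_intros)
  moreover have "eventually (\<lambda>x. 2 * x < pi/2) (at_left (pi/4))"
    unfolding eventually_at_left_field by (rule exI[of _ 0]) auto
  ultimately have "filterlim (\<lambda>x. 2 * x) (at_left (pi/2)) (at_left (pi/4))"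
    by (auto simp: filterlim_at elim: eventually_mono)
  then have "filterlim (\<lambda>x. tan (2 * x)) at_top (at_left (pi/4))"
    by (rule filterlim_compose[OF filterlim_tan_at_left])
  then show "filterlim (\<lambda>x. ln (tan (2 * x))) at_top (at_left (pi/4))"
    by (rule filterlim_compose[OF ln_at_top])
qed

text \<open>An antiderivative of \<open>4 h / sin 4x\<close> is compared with the antiderivative \<open>ln (tan 2x)\<close> of
  \<open>4 / sin 4x\<close>.\<close>

lemma antiderivative_over_sin:
  fixes h :: "real \<Rightarrow> real"
  assumes "continuous_on UNIV h" "m > 0" "\<And>x. m \<le> h x"
  obtains G where "\<And>x. x \<in> {0<..<pi/4} \<Longrightarrow> (G has_real_derivative 4 * h x / sin (4 * x)) (at x)"
    "filterlim G at_bot (at_right 0)" "filterlim G at_top (at_left (pi/4))"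
proof -
  have sinpos: "sin (4 * x) > 0" if "x \<in> {0<..<pi/4}" for x
    using that by (auto intro!: sin_gt_zero)
  have "\<exists>F. \<forall>x :: real. ereal 0 < x \<longrightarrow> x < ereal (pi/4) \<longrightarrow>
      (F has_vector_derivative 4 * h x / sin (4 * x)) (at x)"
  proof (rule einterval_antiderivative)
    fix x :: real assume "ereal 0 < x" "x < ereal (pi/4)"
    then show "isCont (\<lambda>x. 4 * h x / sin (4 * x)) x"
      using sinpos[of x] assms(1) by (auto simp: continuous_on_eq_continuous_at intro!: continuous_intros)
  qed auto
  then obtain G where G: "\<And>x. x \<in> {0<..<pi/4} \<Longrightarrow> (G has_real_derivative 4 * h x / sin (4 * x)) (at x)"
    by (auto simp: has_real_derivative_iff_has_vector_derivative)
  define P where "P x = ln (tan (2 * x))" for x :: real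
  have P: "(P has_real_derivative 4 / sin (4 * x)) (at x)" if "x \<in> {0<..<pi/4}" for x
  proof -
    have pos: "sin (2 * x) > 0" "cos (2 * x) > 0" "tan (2 * x) > 0"
      using that by (auto intro!: sin_gt_zero cos_gt_zero tan_gt_zero)
    have "sin (4 * x) = 2 * sin (2 * x) * cos (2 * x)"
      using sin_double[of "2 * x"] by simp
    then have "inverse ((cos (2 * x))\<^sup>2) * 2 / tan (2 * x) = 4 / sin (4 * x)"
      using pos by (simp add: tan_def divide_simps power2_eq_square)
    moreover have "(P has_real_derivative inverse ((cos (2 * x))\<^sup>2) * 2 / tan (2 * x)) (at x)"
      unfolding P_def using pos by (auto intro!: derivative_eq_intros)
    ultimately show ?thesis by simp
  qed
  \<comment> \<open>The difference has derivative 4 (h - m) / sin 4x, which is nonnegative.\<close>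
  have mono: "G x - m * P x \<le> G y - m * P y" if "x \<in> {0<..<pi/4}" "y \<in> {0<..<pi/4}" "x \<le> y" for x y
  proof (rule DERIV_nonneg_imp_nondecreasing[OF that(3)])
    fix z assume "x \<le> z" "z \<le> y"
    then have z: "z \<in> {0<..<pi/4}" using that by auto
    show "\<exists>d. ((\<lambda>x. G x - m * P x) has_real_derivative d) (at z) \<and> 0 \<le> d"
      using sinpos[OF z] assms(3)[of z] DERIV_diff[OF G[OF z] DERIV_cmult[OF P[OF z], of m]]
      by (intro exI[of _ "4 * h z / sin (4 * z) - m * (4 / sin (4 * z))"]) (simp add: divide_right_mono)
  qed
  \<comment> \<open>At pi/8 the comparison function vanishes, so \<open>G (pi/8) + m * P x\<close>
    touches \<open>G\<close> there, bounding it from below on the right and from above on the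
    left.\<close>
  have P0: "P (pi/8) = 0" using tan_45 by (simp add: P_def)
  show thesis
  proof (rule that[OF G])
    have "filterlim (\<lambda>x. G (pi/8) + m * P x) at_top (at_left (pi/4))"
      unfolding P_def using filterlim_ln_tan_double(2) assms(2)
      by (intro filterlim_tendsto_add_at_top[OF tendsto_const] filterlim_tendsto_pos_mult_at_top[OF tendsto_const])
    moreover have "eventually (\<lambda>x. G (pi/8) + m * P x \<le> G x) (at_left (pi/4))"
    proof -
      have "G (pi/8) + m * P x \<le> G x" if "pi/8 < x" "x < pi/4" for x
        using mono[of "pi/8" x] that P0 by simp
      then show ?thesis
        unfolding eventually_at_left_field by (intro exI[of _ "pi/8"]) simp
    qed
    ultimately show "filterlim G at_top (at_left (pi/4))"
      by (rule filterlim_at_top_mono)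
    have "filterlim (\<lambda>x. G (pi/8) + m * P x) at_bot (at_right 0)"
      unfolding P_def using filterlim_ln_tan_double(1) assms(2)
      by (intro filterlim_tendsto_add_at_bot_iff[OF tendsto_const, THEN iffD2]
          filterlim_tendsto_pos_mult_at_bot[OF tendsto_const])
    moreover have "eventually (\<lambda>x. G x \<le> G (pi/8) + m * P x) (at_right 0)"
    proof -
      have "G x \<le> G (pi/8) + m * P x" if "0 < x" "x < pi/8" for x
        using mono[of x "pi/8"] that P0 by simp
      then show ?thesis
        unfolding eventually_at_right_field by (intro exI[of _ "pi/8"]) simp
    qed
    ultimately show "filterlim G at_bot (at_right 0)"
      unfolding filterlim_uminus_at_bot
      by (rule filterlim_at_top_mono[OF _ eventually_mono]) simp
  qed
qed

text \<open>With y = exp G the right side is also the derivative of 2 arctan (exp G) with respect to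
  G. Hence b = 2 arctan (exp G) solves b' = G' sin b, the separated form of the profile
  equation.\<close>

lemma sin_double_arctan: "sin (2 * arctan y) = 2 * y / (1 + y\<^sup>2)"
proof -
  have "sqrt (1 + y\<^sup>2) * sqrt (1 + y\<^sup>2) = 1 + y\<^sup>2" by simp
  then show ?thesis
    by (simp add: sin_double sin_arctan cos_arctan del: real_sqrt_mult_self)
qed

text \<open>Outside the segment the solution is frozen at its limits 0 and pi, so that translates
  can later be added; continuity at the two joints is the divergence of \<open>G\<close>.\<close>

lemma profile_segment:
  fixes h :: "real \<Rightarrow> real"
  assumes "continuous_on UNIV h" "m > 0" "\<And>x. m \<le> h x"
  obtains \<beta> where "continuous_on UNIV \<beta>" "\<And>x. x \<le> 0 \<Longrightarrow> \<beta> x = 0" "\<And>x. pi/4 \<le> x \<Longrightarrow> \<beta> x = pi"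
    "\<And>x. x \<in> {0<..<pi/4} \<Longrightarrow> \<beta> x \<in> {0<..<pi} \<and>
       (\<beta> has_real_derivative 4 * h x * sin (\<beta> x) / sin (4 * x)) (at x)"
proof -
  from antiderivative_over_sin[OF assms] obtain G where
    G: "\<And>x. x \<in> {0<..<pi/4} \<Longrightarrow> (G has_real_derivative 4 * h x / sin (4 * x)) (at x)"
    and lim0: "filterlim G at_bot (at_right 0)" and lim1: "filterlim G at_top (at_left (pi/4))"
    by blast
  define b where "b x = 2 * arctan (exp (G x))" for x
  define \<beta> where "\<beta> x = (if x \<le> 0 then 0 else if pi/4 \<le> x then pi else b x)" for x
  have b_der: "(b has_real_derivative 4 * h x * sin (b x) / sin (4 * x)) (at x)"
    if x: "x \<in> {0<..<pi/4}" for x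
  proof -
    have "sin (b x) = 2 * exp (G x) / (1 + (exp (G x))\<^sup>2)"
      unfolding b_def by (rule sin_double_arctan)
    then show ?thesis
      unfolding b_def using G[OF x]
      by (auto intro!: derivative_eq_intros simp: field_simps)
  qed
  have \<beta>_der: "(\<beta> has_real_derivative 4 * h x * sin (\<beta> x) / sin (4 * x)) (at x)"
    if x: "x \<in> {0<..<pi/4}" for x
  proof (rule has_field_derivative_transform_within_open[of b _ _ "{0<..<pi/4}"])
    show "(b has_real_derivative 4 * h x * sin (\<beta> x) / sin (4 * x)) (at x)"
      using b_der[OF x] x by (simp add: \<beta>_def)
  qed (use x in \<open>auto simp: \<beta>_def\<close>)
  have b0: "(b \<longlongrightarrow> 0) (at_right 0)"
  proof -
    have "((\<lambda>x. exp (G x)) \<longlongrightarrow> 0) (at_right 0)"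
      by (rule filterlim_compose[OF exp_at_bot lim0])
    from tendsto_mult_left[OF tendsto_arctan[OF this], of 2] show ?thesis
      unfolding b_def by simp
  qed
  have b1: "(b \<longlongrightarrow> pi) (at_left (pi/4))"
  proof -
    have "((\<lambda>x. arctan (exp (G x))) \<longlongrightarrow> pi/2) (at_left (pi/4))"
      by (intro filterlim_compose[OF tendsto_arctan_at_top] filterlim_compose[OF exp_at_top lim1])
    from tendsto_mult_left[OF this, of 2] show ?thesis
      unfolding b_def by simp
  qed
  have tr: "(\<beta> \<longlongrightarrow> l) F" if "(g \<longlongrightarrow> l) F" "eventually (\<lambda>x. \<beta> x = g x) F" for l F g
    using that by (simp cong: tendsto_cong)
  have "isCont \<beta> x" for x
  proof -
    consider "x < 0" | "x = 0" | "x \<in> {0<..<pi/4}" | "x = pi/4" | "pi/4 < x" by fastforce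
    then show ?thesis
    proof cases
      case 1
      have "eventually (\<lambda>y. \<beta> y = 0) (nhds x)"
        using eventually_nhds_in_open[of "{..<0}" x] 1 by (auto simp: \<beta>_def elim: eventually_mono)
      then show ?thesis by (simp add: isCont_cong)
    next
      case 2
      have "(\<beta> \<longlongrightarrow> 0) (at_left 0)"
        by (rule tr[OF tendsto_const]) (auto simp: eventually_at_left_field \<beta>_def intro: exI[of _ "-1"])
      moreover have "(\<beta> \<longlongrightarrow> 0) (at_right 0)"
        by (rule tr[OF b0]) (auto simp: eventually_at_right_field \<beta>_def intro!: exI[of _ "pi/4"])
      ultimately show ?thesis
        using 2 by (simp add: isCont_def filterlim_at_split \<beta>_def)
    next
      case 3
      then show ?thesis using \<beta>_der DERIV_isCont by blast
    next
      case 4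
      have "(\<beta> \<longlongrightarrow> pi) (at_right (pi/4))"
        by (rule tr[OF tendsto_const]) (auto simp: eventually_at_right_field \<beta>_def intro: exI[of _ "pi"])
      moreover have "(\<beta> \<longlongrightarrow> pi) (at_left (pi/4))"
        by (rule tr[OF b1]) (auto simp: eventually_at_left_field \<beta>_def intro!: exI[of _ 0])
      moreover have "\<beta> (pi/4) = pi" by (simp add: \<beta>_def not_le)
      ultimately show ?thesis
        unfolding 4 by (simp add: isCont_def filterlim_at_split)
    next
      case 5
      have "eventually (\<lambda>y. \<beta> y = pi) (nhds x)"
        using eventually_nhds_in_open[of "{pi/4<..}" x] 5
        by (auto simp: \<beta>_def elim!: eventually_mono) (use pi_gt_zero in linarith)
      then show ?thesis by (simp add: isCont_cong)
    qed
  qed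
  then have "continuous_on UNIV \<beta>"
    by (simp add: continuous_on_eq_continuous_at)
  moreover have "\<beta> x = 0" if "x \<le> 0" for x
    using that by (simp add: \<beta>_def)
  moreover have "\<beta> x = pi" if "pi/4 \<le> x" for x
    using that pi_gt_zero unfolding \<beta>_def by (smt (verit) divide_pos_pos)
  moreover have "\<beta> x \<in> {0<..<pi}" if "x \<in> {0<..<pi/4}" for x
    using that arctan_ubound[of "exp (G x)"] by (auto simp: \<beta>_def b_def)
  ultimately show thesis
    using \<beta>_der by (intro that) blast+
qed

text \<open>On segment \<open>j\<close> the earlier pieces contribute pi each and the later ones 0.
  As \<open>h\<close> need not have period pi/4, every piece is solved with its own translate of
  \<open>h\<close>. Moving to segment \<open>j\<close> multiplies sin 4s and sin \<alpha> by the
  same sign (-1)^j, so the equation is preserved.\<close>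

lemma profile_exists:
  fixes h :: "real \<Rightarrow> real"
  assumes "continuous_on UNIV h" "m > 0" "\<And>x. m \<le> h x"
  obtains \<alpha> where "continuous_on UNIV \<alpha>" "\<And>j. j \<le> n \<Longrightarrow> \<alpha> (real j * pi/4) = real j * pi"
    "\<And>j s. j < n \<Longrightarrow> s \<in> {real j * pi/4<..<real (Suc j) * pi/4} \<Longrightarrow>
       \<alpha> s \<in> {real j * pi<..<real (Suc j) * pi} \<and>
       (\<alpha> has_real_derivative 4 * h s * sin (\<alpha> s) / sin (4 * s)) (at s)"
proof -
  have "\<exists>\<beta>. continuous_on UNIV \<beta> \<and> (\<forall>x\<le>0. \<beta> x = 0) \<and> (\<forall>x\<ge>pi/4. \<beta> x = pi) \<and>
    (\<forall>x\<in>{0<..<pi/4}. \<beta> x \<in> {0<..<pi} \<and>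
       (\<beta> has_real_derivative 4 * h (x + real j * pi/4) * sin (\<beta> x) / sin (4 * x)) (at x))" for j :: nat
  proof -
    have "continuous_on UNIV (\<lambda>x. h (x + real j * pi/4))"
      by (rule continuous_on_compose2[OF assms(1)]) (auto intro!: continuous_intros)
    from profile_segment[OF this assms(2)] assms(3) show ?thesis by metis
  qed
  then obtain \<beta> where \<beta>: "\<And>j. continuous_on UNIV (\<beta> j)" "\<And>j x. x \<le> 0 \<Longrightarrow> \<beta> j x = 0"
    "\<And>j x. pi/4 \<le> x \<Longrightarrow> \<beta> j x = pi"
    "\<And>j x. x \<in> {0<..<pi/4} \<Longrightarrow> \<beta> j x \<in> {0<..<pi}"
    "\<And>j x. x \<in> {0<..<pi/4} \<Longrightarrow>
       (\<beta> j has_real_derivative 4 * h (x + real j * pi/4) * sin (\<beta> j x) / sin (4 * x)) (at x)"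
    by metis
  define \<alpha> where "\<alpha> s = (\<Sum>i<n. \<beta> i (s - real i * pi/4))" for s
  have \<alpha>_eq: "\<alpha> s = real j * pi + \<beta> j (s - real j * pi/4)"
    if "j < n" "s \<in> {real j * pi/4..real (Suc j) * pi/4}" for j s
  proof -
    have "\<beta> i (s - real i * pi/4) = (if i < j then pi else if i = j then \<beta> j (s - real j * pi/4) else 0)"
      if "i < n" for i
    proof -
      consider "i < j" | "i = j" | "j < i" by linarith
      then show ?thesis
      proof cases
        case 1
        then have "real (Suc i) * pi \<le> real j * pi" by (intro mult_right_mono) auto
        then show ?thesis
          using 1 \<open>s \<in> _\<close> by (auto intro!: \<beta>(3) simp: field_simps)
      next
        case 3
        then have "real (Suc j) * pi \<le> real i * pi" by (intro mult_right_mono) auto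
        then show ?thesis
          using 3 \<open>s \<in> _\<close> by (auto intro!: \<beta>(2) simp: field_simps)
      qed simp
    qed
    then have "\<alpha> s = (\<Sum>i<n. if i < j then pi else if i = j then \<beta> j (s - real j * pi/4) else 0)"
      unfolding \<alpha>_def by (intro sum.cong) auto
    also have "\<dots> = (\<Sum>i\<in>{..<j} \<union> {j}. if i < j then pi else if i = j then \<beta> j (s - real j * pi/4) else 0)"
      using that by (intro sum.mono_neutral_right) auto
    also have "\<dots> = real j * pi + \<beta> j (s - real j * pi/4)"
      by (subst sum.union_disjoint) auto
    finally show ?thesis .
  qed
  show thesis
  proof (rule that)
    have "continuous_on UNIV (\<lambda>s. \<beta> i (s - real i * pi/4))" for i
      by (rule continuous_on_compose2[OF \<beta>(1)]) (auto intro!: continuous_intros)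
    then show "continuous_on UNIV \<alpha>"
      unfolding \<alpha>_def by (intro continuous_intros) auto
    show "\<alpha> (real j * pi/4) = real j * pi" if "j \<le> n" for j
    \<comment> \<open>\<open>\<alpha>_eq\<close> covers indices below \<open>n\<close>; at the last
      endpoint all pieces have reached pi.\<close>
    proof (cases "j = n")
      case True
      then have "\<beta> i (real j * pi/4 - real i * pi/4) = pi" if "i < n" for i
      proof -
        have "real (Suc i) * pi \<le> real j * pi" using True that by (intro mult_right_mono) auto
        then show ?thesis by (auto intro!: \<beta>(3) simp: field_simps)
      qed
      then show ?thesis using True by (simp add: \<alpha>_def)
    next
      case False
      then show ?thesis using that \<alpha>_eq[of j "real j * pi/4"] \<beta>(2) by (simp add: field_simps)
    qed
  next
    fix j s assume j: "j < n" and s: "s \<in> {real j * pi/4<..<real (Suc j) * pi/4}"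
    define x where "x = s - real j * pi/4"
    have x: "x \<in> {0<..<pi/4}" using s by (auto simp: x_def field_simps)
    have \<alpha>s: "\<alpha> s = real j * pi + \<beta> j x"
      using \<alpha>_eq[OF j, of s] s by (simp add: x_def)
    have "sin (4 * s) = sin (4 * x + real j * pi)" by (simp add: x_def)
    then have "sin (4 * s) = (-1) ^ j * sin (4 * x)" "sin (\<alpha> s) = (-1) ^ j * sin (\<beta> j x)"
      unfolding \<alpha>s by (simp_all add: sin_add)
    then have quot: "sin (\<alpha> s) / sin (4 * s) = sin (\<beta> j x) / sin (4 * x)"
      by simp
    have "((\<lambda>s. \<beta> j (s - real j * pi/4)) has_real_derivative
        4 * h s * sin (\<beta> j x) / sin (4 * x)) (at s)"
    proof -
      have "((\<lambda>s. s - real j * pi/4) has_real_derivative 1) (at s)"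
        by (auto intro!: derivative_eq_intros)
      from DERIV_chain'[OF this \<beta>(5)[OF x, of j, unfolded x_def]] show ?thesis
        by (simp add: x_def)
    qed
    then have "((\<lambda>s. real j * pi + \<beta> j (s - real j * pi/4)) has_real_derivative
        4 * h s * (sin (\<alpha> s) / sin (4 * s))) (at s)"
      unfolding quot by (auto intro!: derivative_eq_intros)
    then have "(\<alpha> has_real_derivative 4 * h s * (sin (\<alpha> s) / sin (4 * s))) (at s)"
      by (rule has_field_derivative_transform_within_open[of _ _ _ "{real j * pi/4<..<real (Suc j) * pi/4}"])
        (use s in \<open>auto simp: \<alpha>_eq[OF j]\<close>)
    then show "\<alpha> s \<in> {real j * pi<..<real (Suc j) * pi} \<and>
       (\<alpha> has_real_derivative 4 * h s * sin (\<alpha> s) / sin (4 * s)) (at s)"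
      using \<beta>(4)[OF x, of j] by (auto simp: \<alpha>s algebra_simps)
  qed
qed

section \<open>The metric\<close>

text \<open>\<open>matrix_inv\<close> is defined by choice; uniqueness of a two-sided inverse pins
  its value down.\<close>

lemma matrix_inv_eqI:
  fixes A B :: "real ^ 'n ^ 'n"
  assumes "A ** B = mat 1" "B ** A = mat 1"
  shows "matrix_inv A = B"
proof -
  have "A ** matrix_inv A = mat 1 \<and> matrix_inv A ** A = mat 1"
    unfolding matrix_inv_def by (rule someI[of _ B]) (simp add: assms)
  then have "matrix_inv A = matrix_inv A ** (A ** B)" "matrix_inv A ** A = mat 1"
    by (simp_all add: assms)
  then show ?thesis by (simp add: matrix_mul_assoc)
qed

lemma matrix_inv_diagonal:
  fixes d :: "real ^ 'n"
  assumes "\<And>i. d $ i \<noteq> 0"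
  shows "matrix_inv (\<chi> i j. if i = j then d $ i else 0) = (\<chi> i j. if i = j then inverse (d $ i) else 0)"
proof -
  let ?D = "(\<chi> i j. if i = j then d $ i else 0) :: real^'n^'n"
  let ?E = "(\<chi> i j. if i = j then inverse (d $ i) else 0) :: real^'n^'n"
  have prod: "(\<chi> i j. if i = j then x i else 0) ** (\<chi> i j. if i = j then y i else 0) = (mat 1 :: real ^ 'n ^ 'n)"
    if "\<And>i. x i * y i = 1" for x y :: "'n \<Rightarrow> real"
  proof -
    have "(\<Sum>k\<in>UNIV. (if i = k then x i else 0) * (if k = j then y k else 0)) =
        (\<Sum>k\<in>UNIV. if k = i then (if i = j then 1 else 0) else 0)" for i j
      by (rule sum.cong) (simp_all add: that)
    then show ?thesis
      by (simp add: matrix_matrix_mult_def mat_def vec_eq_iff)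
  qed
  have "?D ** ?E = mat 1" "?E ** ?D = mat 1"
    using prod[of "\<lambda>i. d $ i" "\<lambda>i. inverse (d $ i)"] prod[of "\<lambda>i. inverse (d $ i)" "\<lambda>i. d $ i"] assms by simp_all
  then show ?thesis by (rule matrix_inv_eqI)
qed

section \<open>Enumeration of five-element and four-element index types\<close>

lemma exhaust_5:
  fixes x :: 5
  shows "x = 1 \<or> x = 2 \<or> x = 3 \<or> x = 4 \<or> x = 5"
proof (induct x)
  case (of_int z)
  \<comment> \<open>The representatives run from 0 to 4, and in this type 5 equals 0.\<close>
  then have "z = 0 \<or> z = 1 \<or> z = 2 \<or> z = 3 \<or> z = 4" by fastforce
  then show ?case by auto
qed

lemma UNIV_5: "UNIV = {1, 2, 3, 4, 5 :: 5}"
  using exhaust_5 by auto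

lemma vector_4_nth [simp]:
  "(vector [a, b, c, d] :: 'a::zero ^ 4) $ 1 = a" "(vector [a, b, c, d] :: 'a ^ 4) $ 2 = b"
  "(vector [a, b, c, d] :: 'a ^ 4) $ 3 = c" "(vector [a, b, c, d] :: 'a ^ 4) $ 4 = d"
  by (simp_all add: vector_def)

lemma vector_5_nth [simp]:
  "(vector [a, b, c, d, e] :: 'a::zero ^ 5) $ 1 = a" "(vector [a, b, c, d, e] :: 'a ^ 5) $ 2 = b"
  "(vector [a, b, c, d, e] :: 'a ^ 5) $ 3 = c" "(vector [a, b, c, d, e] :: 'a ^ 5) $ 4 = d"
  "(vector [a, b, c, d, e] :: 'a ^ 5) $ 5 = e"
  by (simp_all add: vector_def)

lemma sum_5: "sum f (UNIV :: 5 set) = f 1 + f 2 + f 3 + f 4 + f 5"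
  unfolding UNIV_5 by (simp add: ac_simps)

lemma prod_5: "prod f (UNIV :: 5 set) = f 1 * f 2 * f 3 * f 4 * f 5"
  unfolding UNIV_5 by (simp add: ac_simps)

lemma forall_5: "(\<forall>i::5. P i) \<longleftrightarrow> P 1 \<and> P 2 \<and> P 3 \<and> P 4 \<and> P 5"
proof -
  have "(\<forall>i::5. P i) \<longleftrightarrow> (\<forall>i\<in>UNIV. P i)" by simp
  then show ?thesis unfolding UNIV_5 by simp
qed

section \<open>The four components of the interval and bounds on the coefficients\<close>

lemma open_I_dom: "open I_dom"
  by (simp add: I_dom_def open_Un)

lemma I_dom_eq: "I_dom = (\<Union>j<4::nat. {real j * pi/4<..<real (Suc j) * pi/4})"
proof -
  have "{..<4::nat} = {0, 1, 2, 3}" by auto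
  then show ?thesis by (simp add: I_dom_def Un_assoc)
qed

text \<open>The four factors are, up to the a_i, the square roots of the angular metric
  coefficients. The formula therefore gives det g in closed form, and shows that none of them
  vanishes where sin 4s does not.\<close>

lemma sin_4: "sin (4 * s) = 8 * (sin s * sin (s + pi/4) * cos s * cos (s + pi/4))" for s :: real
proof -
  have "sin (4 * s) = 2 * sin (2 * s) * cos (2 * s)"
    using sin_double[of "2 * s"] by simp
  also have "cos (2 * s) = sin (2 * (s + pi/4))"
    by (simp add: distrib_left sin_add)
  finally have "sin (4 * s) = 2 * (2 * sin s * cos s) * (2 * sin (s + pi/4) * cos (s + pi/4))"
    unfolding sin_double .
  then show ?thesis by (simp add: mult_ac)
qed

lemma sin_4_neq_0:
  assumes "s \<in> I_dom"
  shows "sin (4 * s) \<noteq> 0"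
proof -
  obtain j where j: "s \<in> {real j * pi/4<..<real (Suc j) * pi/4}" using assms I_dom_eq by blast
  define x where "x = 4 * s - real j * pi"
  have "sin x > 0"
    using j by (intro sin_gt_zero) (auto simp: x_def algebra_simps)
  moreover have "sin (4 * s) = sin (x + real j * pi)" by (simp add: x_def)
  then have "sin (4 * s) = (-1) ^ j * sin x" by (simp add: sin_add)
  ultimately show ?thesis by simp
qed

lemma h_fun_ge_1:
  assumes "a1 \<ge> 1" "a3 \<ge> 1"
  shows "h_fun a1 a2 a3 a4 s \<ge> 1"
proof -
  have "1 \<le> a1\<^sup>2" "1 \<le> a3\<^sup>2" using assms by (simp_all add: one_le_power)
  from this[THEN mult_right_mono[OF _ zero_le_power2]]
  have "(cos s)\<^sup>2 \<le> a1\<^sup>2 * (cos s)\<^sup>2" "(sin s)\<^sup>2 \<le> a3\<^sup>2 * (sin s)\<^sup>2"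
    by (metis mult_1)+
  moreover have "0 \<le> a2\<^sup>2 * (cos (s + pi/4))\<^sup>2" "0 \<le> a4\<^sup>2 * (sin (s + pi/4))\<^sup>2" by simp_all
  ultimately have "1 \<le> a1\<^sup>2 * (cos s)\<^sup>2 + a2\<^sup>2 * (cos (s + pi/4))\<^sup>2 + a3\<^sup>2 * (sin s)\<^sup>2 + a4\<^sup>2 * (sin (s + pi/4))\<^sup>2"
    using sin_cos_squared_add[of s] by linarith
  then show ?thesis unfolding h_fun_def by simp
qed

lemma isCont_h_fun: "isCont (h_fun a1 a2 a3 a4) s"
  unfolding h_fun_def by (intro continuous_intros)

text \<open>Only the behaviour of the profile on \<open>I_dom\<close> is recorded, which is what the
  harmonic morphism property depends on; the values at the multiples of pi/4 enter in the continuous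
  extension alone.\<close>

locale torus_profile =
  fixes k1 k2 k3 k4 :: int and a1 a2 a3 a4 :: real and \<alpha> :: "real \<Rightarrow> real"
  assumes a_pos: "a1 > 0" "a2 > 0" "a3 > 0" "a4 > 0"
    and a_eq: "a1 = \<bar>of_int k1\<bar>" "a2 = \<bar>of_int k2\<bar>" "a3 = \<bar>of_int k3\<bar>" "a4 = \<bar>of_int k4\<bar>"
    and \<alpha>_ode: "\<And>s. s \<in> I_dom \<Longrightarrow>
      (\<alpha> has_real_derivative 4 * h_fun a1 a2 a3 a4 s * sin (\<alpha> s) / sin (4 * s)) (at s)"
    and sin_\<alpha>: "\<And>s. s \<in> I_dom \<Longrightarrow> sin (\<alpha> s) \<noteq> 0"
begin

section \<open>Volume density, energy weights and the equation of the profile\<close>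

abbreviation "h \<equiv> h_fun a1 a2 a3 a4"
abbreviation "M \<equiv> V5 a1 a2 a3 a4"
abbreviation "\<Omega> \<equiv> {p :: real ^ 5. p $ 5 \<in> I_dom}"

definition \<alpha>' :: "real \<Rightarrow> real" where
  "\<alpha>' s = 4 * h s * sin (\<alpha> s) / sin (4 * s)"

definition \<kappa> :: "real ^ 5" where
  "\<kappa> = vector [of_int k1, of_int k2, of_int k3, of_int k4, 0]"

definition g :: "real \<Rightarrow> real ^ 5" where
  "g s = vector [a1\<^sup>2 * (sin s)\<^sup>2, a2\<^sup>2 * (sin (s + pi/4))\<^sup>2,
                 a3\<^sup>2 * (cos s)\<^sup>2, a4\<^sup>2 * (cos (s + pi/4))\<^sup>2, (h s)\<^sup>2]"

text \<open>The Riemannian density sqrt (det g), by the factorization of sin 4s; the absolute value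
  is there because this sine changes sign between components.\<close>

definition vol :: "real \<Rightarrow> real" where
  "vol s = a1 * a2 * a3 * a4 / 8 * \<bar>sin (4 * s)\<bar> * h s"

text \<open>\<open>c i\<close> is the weight \<open>g\<^sup>i\<^sup>i sqrt (det g)\<close> of \<open>|\<partial>\<^sub>i F|\<^sup>2\<close> in the energy.\<close>

definition c :: "5 \<Rightarrow> real \<Rightarrow> real" where
  "c i s = vol s / g s $ i"

text \<open>On \<open>I_dom\<close> this is the squared norm, in the metric g, of the differential
  of the phase k . \<theta>.\<close>

definition Q :: "real \<Rightarrow> real" where
  "Q s = 16 / (sin (4 * s))\<^sup>2"

lemma k_neq_0: "k1 \<noteq> 0" "k2 \<noteq> 0" "k3 \<noteq> 0" "k4 \<noteq> 0"
  using a_pos a_eq by auto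

lemma k_sq: "(of_int k1)\<^sup>2 = a1\<^sup>2" "(of_int k2)\<^sup>2 = a2\<^sup>2" "(of_int k3)\<^sup>2 = a3\<^sup>2" "(of_int k4)\<^sup>2 = a4\<^sup>2"
  by (simp_all add: a_eq)

lemma h_ge_1: "h s \<ge> 1"
  using k_neq_0 by (intro h_fun_ge_1) (auto simp: a_eq)

lemma h_pos: "h s > 0" "h s \<noteq> 0"
  using h_ge_1[of s] by linarith+

lemma trig_neq_0:
  assumes "s \<in> I_dom"
  shows "sin s \<noteq> 0" "sin (s + pi/4) \<noteq> 0" "cos s \<noteq> 0" "cos (s + pi/4) \<noteq> 0"
  using sin_4_neq_0[OF assms] by (auto simp: sin_4)

lemma g_pos: "s \<in> I_dom \<Longrightarrow> g s $ i > 0"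
  using exhaust_5[of i] trig_neq_0 a_pos h_pos by (auto simp: g_def)

lemma \<kappa>_neq_0: "i \<noteq> 5 \<Longrightarrow> \<kappa> $ i \<noteq> 0"
  using exhaust_5[of i] k_neq_0 by (auto simp: \<kappa>_def)

lemma \<kappa>_5 [simp]: "\<kappa> $ 5 = 0"
  by (simp add: \<kappa>_def)

lemma vol_pos: "s \<in> I_dom \<Longrightarrow> vol s > 0"
  using a_pos h_pos sin_4_neq_0 by (simp add: vol_def)

lemma sqrt_prod_g: "sqrt (\<Prod>i\<in>UNIV. g s $ i) = vol s"
proof -
  have "(\<Prod>i\<in>UNIV. g s $ i) = (vol s)\<^sup>2"
    by (simp add: prod_5 g_def vol_def sin_4 power_mult_distrib power_divide)
  moreover have "vol s \<ge> 0" using a_pos h_pos[of s] by (simp add: vol_def)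
  ultimately show ?thesis by simp
qed

text \<open>Because \<open>a\<^sub>i = |k\<^sub>i|\<close>, the angular part of the energy density does not depend on the \<open>a\<^sub>i\<close>.\<close>

lemma sum_\<kappa>_sq:
  assumes "s \<in> I_dom"
  shows "(\<Sum>i\<in>UNIV. (\<kappa> $ i)\<^sup>2 / g s $ i) = Q s"
proof -
  \<comment> \<open>Used at s, at s + pi/4 and, once sin (2s + pi/2) has become cos 2s, a third time
    at 2s.\<close>
  have 1: "1 / (sin s)\<^sup>2 + 1 / (cos s)\<^sup>2 = 4 / (sin (2 * s))\<^sup>2" if "sin s \<noteq> 0" "cos s \<noteq> 0" for s :: real
  proof -
    have "1 / (sin s)\<^sup>2 + 1 / (cos s)\<^sup>2 = ((sin s)\<^sup>2 + (cos s)\<^sup>2) / ((sin s)\<^sup>2 * (cos s)\<^sup>2)"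
      using that by (simp add: field_simps)
    then show ?thesis by (simp add: sin_double power_mult_distrib)
  qed
  note nz = trig_neq_0[OF assms]
  have "(\<Sum>i\<in>UNIV. (\<kappa> $ i)\<^sup>2 / g s $ i) =
      (1 / (sin s)\<^sup>2 + 1 / (cos s)\<^sup>2) + (1 / (sin (s + pi/4))\<^sup>2 + 1 / (cos (s + pi/4))\<^sup>2)"
    using a_pos by (simp add: sum_5 g_def \<kappa>_def k_sq)
  also have "\<dots> = 4 / (sin (2 * s))\<^sup>2 + 4 / (sin (2 * (s + pi/4)))\<^sup>2"
    using nz by (simp add: 1)
  also have "\<dots> = 4 / (sin (2 * s))\<^sup>2 + 4 / (cos (2 * s))\<^sup>2"
    by (simp add: distrib_left sin_add)
  also have "\<dots> = 4 * (1 / (sin (2 * s))\<^sup>2 + 1 / (cos (2 * s))\<^sup>2)" by simp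
  also have "\<dots> = 16 / (sin (2 * (2 * s)))\<^sup>2"
    using sin_4_neq_0[OF assms] sin_double[of "2 * s"] by (subst 1) auto
  finally show ?thesis by (simp add: Q_def)
qed

text \<open>The equation \<open>\<alpha>' = 4 h sin \<alpha> / sin 4s\<close> makes the map horizontally conformal.\<close>

lemma \<alpha>'_sq: "s \<in> I_dom \<Longrightarrow> (\<alpha>' s)\<^sup>2 = (sin (\<alpha> s))\<^sup>2 * Q s * (h s)\<^sup>2"
  by (simp add: \<alpha>'_def Q_def power_mult_distrib power_divide)

lemma \<alpha>'_neq_0: "s \<in> I_dom \<Longrightarrow> \<alpha>' s \<noteq> 0"
  using sin_4_neq_0 sin_\<alpha> h_pos[of s] by (simp add: \<alpha>'_def)

lemma \<alpha>_der: "s \<in> I_dom \<Longrightarrow> (\<alpha> has_real_derivative \<alpha>' s) (at s)"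
  using \<alpha>_ode by (simp add: \<alpha>'_def)

text \<open>This is the Euler-Lagrange equation of the energy for maps of the given form. The function
  \<open>c 5 * \<alpha>'\<close> is the multiple \<open>sgn (sin 4s) a\<^sub>1 a\<^sub>2 a\<^sub>3 a\<^sub>4 / 2\<close> of \<open>sin \<alpha>\<close>.\<close>

lemma profile_equation:
  assumes "s \<in> I_dom"
  shows "((\<lambda>s. c 5 s * \<alpha>' s) has_real_derivative vol s * Q s * sin (\<alpha> s) * cos (\<alpha> s)) (at s)"
proof -
  define A where "A = a1 * a2 * a3 * a4"
  \<comment> \<open>The sign is frozen at its value at s; on the neighbourhood \<open>U\<close> the
    absolute value in \<open>vol\<close> is then a smooth expression.\<close>
  define \<sigma> where "\<sigma> = sgn (sin (4 * s))"
  define U where "U = I_dom \<inter> {t. \<sigma> * sin (4 * t) > 0}"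
  have U: "open U"
    unfolding U_def by (intro open_Int open_I_dom open_Collect_less continuous_intros)
  have \<sigma>: "\<sigma> = 1 \<or> \<sigma> = -1"
    using sin_4_neq_0[OF assms] by (simp add: \<sigma>_def sgn_if)
  have "\<sigma> * sin (4 * s) > 0"
    using sin_4_neq_0[OF assms] by (simp add: \<sigma>_def sgn_if)
  then have sU: "s \<in> U"
    using assms by (simp add: U_def)
  have abs: "\<bar>sin (4 * t)\<bar> = \<sigma> * sin (4 * t)" if "t \<in> U" for t
    using that \<sigma> by (auto simp: U_def)
  have "((\<lambda>s. A / 2 * \<sigma> * sin (\<alpha> s)) has_real_derivative A / 2 * \<sigma> * (cos (\<alpha> s) * \<alpha>' s)) (at s)"
    using \<alpha>_der[OF assms] by (auto intro!: derivative_eq_intros)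
  then have "((\<lambda>s. c 5 s * \<alpha>' s) has_real_derivative A / 2 * \<sigma> * (cos (\<alpha> s) * \<alpha>' s)) (at s)"
  proof (rule has_field_derivative_transform_within_open[OF _ U sU])
    fix t assume t: "t \<in> U"
    then have "sin (4 * t) \<noteq> 0" using sin_4_neq_0 by (auto simp: U_def)
    then show "A / 2 * \<sigma> * sin (\<alpha> t) = c 5 t * \<alpha>' t"
      using h_pos[of t] unfolding c_def vol_def abs[OF t] \<alpha>'_def g_def A_def
      by (simp add: field_simps power2_eq_square)
  qed
  moreover have "A / 2 * \<sigma> * (cos (\<alpha> s) * \<alpha>' s) = vol s * Q s * sin (\<alpha> s) * cos (\<alpha> s)"
    using sin_4_neq_0[OF assms]
    unfolding c_def vol_def abs[OF sU] \<alpha>'_def A_def Q_def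
    by (simp add: field_simps power2_eq_square)
  ultimately show ?thesis by metis
qed

section \<open>The map, its moving frame and its second derivatives\<close>

text \<open>The map in the coordinates \<open>p\<close> is \<open>f\<close>; the vectors \<open>T p\<close> and \<open>N p\<close> are an orthonormal basis of the
  tangent plane of the sphere at \<open>f p\<close>.\<close>

definition f :: "real ^ 5 \<Rightarrow> complex \<times> real" where
  "f p = (sin (\<alpha> (p $ 5)) *\<^sub>R cis (\<kappa> \<bullet> p), cos (\<alpha> (p $ 5)))"

definition T :: "real ^ 5 \<Rightarrow> complex \<times> real" where
  "T p = (\<i> * cis (\<kappa> \<bullet> p), 0)"

definition N :: "real ^ 5 \<Rightarrow> complex \<times> real" where
  "N p = (cos (\<alpha> (p $ 5)) *\<^sub>R cis (\<kappa> \<bullet> p), - sin (\<alpha> (p $ 5)))"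

text \<open>The direction in which \<open>T\<close> turns: the derivative of \<open>T\<close> along
  \<theta>_i is \<open>- \<kappa> $ i\<close> times this vector.\<close>

definition C :: "real ^ 5 \<Rightarrow> complex \<times> real" where
  "C p = (cis (\<kappa> \<bullet> p), 0)"

lemma frame_inner [simp]:
  "T p \<bullet> T p = 1" "N p \<bullet> N p = 1" "f p \<bullet> f p = 1"
  "T p \<bullet> N p = 0" "N p \<bullet> T p = 0" "f p \<bullet> T p = 0" "T p \<bullet> f p = 0" "f p \<bullet> N p = 0" "N p \<bullet> f p = 0"
proof -
  have unit: "cos x * cos x + sin x * sin x = 1" "sin x * sin x + cos x * cos x = 1" for x :: real
    by (simp_all flip: power2_eq_square)
  note defs = T_def N_def f_def inner_prod_def inner_complex_def
  show "T p \<bullet> T p = 1" "T p \<bullet> N p = 0" "N p \<bullet> T p = 0" "f p \<bullet> T p = 0" "T p \<bullet> f p = 0"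
    by (simp_all add: defs unit)
  have "x\<^sup>2 * (cos y)\<^sup>2 + x\<^sup>2 * (sin y)\<^sup>2 = x\<^sup>2" for x y :: real
    by (simp flip: distrib_left)
  then show "N p \<bullet> N p = 1" "f p \<bullet> f p = 1"
    by (simp_all add: defs flip: power2_eq_square) (simp_all add: power_mult_distrib)
  show "f p \<bullet> N p = 0" "N p \<bullet> f p = 0"
    by (simp_all add: defs) (use unit(1)[of "\<kappa> \<bullet> p"] in algebra)+
qed

lemma C_eq: "C p = cos (\<alpha> (p $ 5)) *\<^sub>R N p + sin (\<alpha> (p $ 5)) *\<^sub>R f p"
proof -
  have "cos x *\<^sub>R cos x *\<^sub>R z + sin x *\<^sub>R sin x *\<^sub>R z = z" for x and z :: complex
    by (simp flip: scaleR_left_distrib power2_eq_square)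
  then show ?thesis by (simp add: C_def N_def f_def)
qed

lemma norm_f: "norm (f p) = 1"
  by (simp add: norm_eq_sqrt_inner)

lemma cis_has_vector_derivative:
  assumes "(x has_real_derivative x') (at t)"
  shows "((\<lambda>t. cis (x t)) has_vector_derivative x' *\<^sub>R (\<i> * cis (x t))) (at t)"
  using has_derivative_cis[OF assms[unfolded has_field_derivative_def]]
  by (simp add: has_vector_derivative_def mult.commute)

lemma \<alpha>_nth_has_derivative:
  assumes "p $ 5 \<in> I_dom"
  shows "((\<lambda>p. \<alpha> (p $ 5)) has_derivative (\<lambda>v. \<alpha>' (p $ 5) * v $ 5)) (at p)"
  using has_derivative_compose[OF bounded_linear_imp_has_derivative[OF bounded_linear_vec_nth]
      \<alpha>_der[OF assms, unfolded has_field_derivative_def]] .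

lemma f_has_derivative:
  assumes "p $ 5 \<in> I_dom"
  shows "(f has_derivative (\<lambda>v. (sin (\<alpha> (p $ 5)) * (\<kappa> \<bullet> v)) *\<^sub>R T p + (\<alpha>' (p $ 5) * v $ 5) *\<^sub>R N p)) (at p)"
proof -
  note a = \<alpha>_nth_has_derivative[OF assms]
  have k: "((\<lambda>p. \<kappa> \<bullet> p) has_derivative (\<lambda>v. \<kappa> \<bullet> v)) (at p)"
    by (rule bounded_linear_imp_has_derivative[OF bounded_linear_inner_right])
  have "((\<lambda>p. (sin (\<alpha> (p $ 5)) *\<^sub>R cis (\<kappa> \<bullet> p), cos (\<alpha> (p $ 5)))) has_derivative
    (\<lambda>v. (sin (\<alpha> (p $ 5)) *\<^sub>R ((\<kappa> \<bullet> v) *\<^sub>R (\<i> * cis (\<kappa> \<bullet> p))) +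
          ((\<alpha>' (p $ 5) * v $ 5) * cos (\<alpha> (p $ 5))) *\<^sub>R cis (\<kappa> \<bullet> p),
          (\<alpha>' (p $ 5) * v $ 5) * - sin (\<alpha> (p $ 5))))) (at p)"
    by (intro has_derivative_Pair has_derivative_scaleR has_derivative_cis k
        has_derivative_sin[OF a] has_derivative_cos[OF a])
  then show ?thesis
    unfolding f_def[abs_def] T_def N_def by (simp add: mult.commute mult.left_commute)
qed

text \<open>\<open>Df i\<close> is \<open>\<partial>\<^sub>i f\<close>, and \<open>R i\<close> below is \<open>\<partial>\<^sub>i (c\<^sub>i \<partial>\<^sub>i f)\<close>, so \<open>sum_R\<close> is the harmonic map equation.\<close>

definition Df :: "5 \<Rightarrow> real ^ 5 \<Rightarrow> complex \<times> real" where
  "Df i p = (sin (\<alpha> (p $ 5)) * \<kappa> $ i) *\<^sub>R T p + (if i = 5 then \<alpha>' (p $ 5) else 0) *\<^sub>R N p"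

lemma axis_nth_5 [simp]: "axis i (1::real) $ 5 = (if i = 5 then 1 else 0)" for i :: 5
  by (auto simp: axis_def)

lemma frechet_f:
  assumes "p $ 5 \<in> I_dom"
  shows "frechet_derivative f (at p) (axis i 1) = Df i p"
  unfolding frechet_derivative_at[OF f_has_derivative[OF assms], symmetric]
  by (simp add: Df_def inner_axis)

definition R :: "5 \<Rightarrow> real ^ 5 \<Rightarrow> complex \<times> real" where
  "R i p = (if i = 5 then (vol (p $ 5) * Q (p $ 5) * sin (\<alpha> (p $ 5)) * cos (\<alpha> (p $ 5))) *\<^sub>R N p
      - (c 5 (p $ 5) * (\<alpha>' (p $ 5))\<^sup>2) *\<^sub>R f p
    else - (c i (p $ 5) * sin (\<alpha> (p $ 5)) * (\<kappa> $ i)\<^sup>2) *\<^sub>R C p)"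

text \<open>The Lagrange multiplier of the constraint |f| = 1, equal to |df|^2 sqrt (det g). The
  factor 2 reflects conformality: the phase and the s-direction carry the same energy.\<close>

definition \<mu> :: "real \<Rightarrow> real" where
  "\<mu> s = 2 * vol s * Q s * (sin (\<alpha> s))\<^sup>2"

text \<open>The angular terms add up to a multiple of \<open>C\<close>. Its
  \<open>N\<close>-component cancels the one supplied by the profile equation, and its
  \<open>f\<close>-component equals the radial one, which doubles.\<close>

lemma sum_R:
  assumes "p $ 5 \<in> I_dom"
  shows "(\<Sum>i\<in>UNIV. R i p) = - \<mu> (p $ 5) *\<^sub>R f p"
proof -
  let ?s = "p $ 5"
  have "(\<Sum>i\<in>UNIV. c i ?s * (\<kappa> $ i)\<^sup>2) = vol ?s * Q ?s"
    unfolding sum_\<kappa>_sq[OF assms, symmetric] by (simp add: c_def sum_distrib_left)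
  then have ang: "c 1 ?s * (\<kappa> $ 1)\<^sup>2 + c 2 ?s * (\<kappa> $ 2)\<^sup>2 + c 3 ?s * (\<kappa> $ 3)\<^sup>2 + c 4 ?s * (\<kappa> $ 4)\<^sup>2 = vol ?s * Q ?s"
    by (simp add: sum_5)
  have rad: "c 5 ?s * (\<alpha>' ?s)\<^sup>2 = vol ?s * Q ?s * (sin (\<alpha> ?s))\<^sup>2"
    unfolding \<alpha>'_sq[OF assms] using h_pos(2) by (simp add: c_def g_def)
  have "R 1 p + R 2 p + R 3 p + R 4 p = - (sin (\<alpha> ?s) * (c 1 ?s * (\<kappa> $ 1)\<^sup>2 + c 2 ?s * (\<kappa> $ 2)\<^sup>2 +
      c 3 ?s * (\<kappa> $ 3)\<^sup>2 + c 4 ?s * (\<kappa> $ 4)\<^sup>2)) *\<^sub>R C p"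
    by (simp add: R_def algebra_simps)
  also have "\<dots> = - (vol ?s * Q ?s * sin (\<alpha> ?s) * cos (\<alpha> ?s)) *\<^sub>R N p - (vol ?s * Q ?s * (sin (\<alpha> ?s))\<^sup>2) *\<^sub>R f p"
    unfolding ang C_eq by (simp add: scaleR_right_distrib power2_eq_square mult_ac)
  finally have ang_sum: "R 1 p + R 2 p + R 3 p + R 4 p = \<dots>" .
  define X where "X = vol ?s * Q ?s * (sin (\<alpha> ?s))\<^sup>2"
  have "- \<mu> ?s = - X + - X"
    by (simp add: \<mu>_def X_def)
  then show ?thesis
    unfolding sum_5 ang_sum by (simp only: scaleR_left_distrib) (simp add: R_def rad X_def)
qed

text \<open>Along s the product \<open>c 5 * \<alpha>'\<close> is differentiated as a whole by
  \<open>profile_equation\<close>, and \<open>N\<close> turns towards - \<open>f\<close>. Along an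
  angle all coefficients are constant and only \<open>T\<close> turns.\<close>

lemma D_cDf:
  assumes "p $ 5 \<in> I_dom"
  shows "((\<lambda>t. c i ((p + t *\<^sub>R axis i 1) $ 5) *\<^sub>R Df i (p + t *\<^sub>R axis i 1)) has_vector_derivative R i p) (at 0)"
proof (cases "i = 5")
  case True
  let ?s = "p $ 5"
  have s: "((\<lambda>t. ?s + t) has_real_derivative 1) (at 0)" by (auto intro!: derivative_eq_intros)
  have P: "((\<lambda>t. c 5 (?s + t) * \<alpha>' (?s + t)) has_real_derivative
      vol ?s * Q ?s * sin (\<alpha> ?s) * cos (\<alpha> ?s)) (at 0)"
    using DERIV_chain'[OF s, of "\<lambda>s. c 5 s * \<alpha>' s"] profile_equation[OF assms] by simp
  have al: "((\<lambda>t. \<alpha> (?s + t)) has_real_derivative \<alpha>' ?s) (at 0)"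
    using DERIV_chain'[OF s, of \<alpha>] \<alpha>_der[OF assms] by simp
  have "((\<lambda>t. (cos (\<alpha> (?s + t)) *\<^sub>R cis (\<kappa> \<bullet> p), - sin (\<alpha> (?s + t)))) has_vector_derivative
      ((- sin (\<alpha> ?s) * \<alpha>' ?s) *\<^sub>R cis (\<kappa> \<bullet> p), - (cos (\<alpha> ?s) * \<alpha>' ?s))) (at 0)"
    using al by (auto intro!: derivative_eq_intros has_vector_derivative_Pair
        simp flip: has_real_derivative_iff_has_vector_derivative)
  then have Nd: "((\<lambda>t. N (p + t *\<^sub>R axis 5 1)) has_vector_derivative (- \<alpha>' ?s) *\<^sub>R f p) (at 0)"
    by (simp add: N_def f_def inner_add_right inner_axis mult.commute)
  have "((\<lambda>t. (c 5 (?s + t) * \<alpha>' (?s + t)) *\<^sub>R N (p + t *\<^sub>R axis 5 1)) has_vector_derivative R 5 p) (at 0)"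
    using has_vector_derivative_scaleR[OF P Nd]
    by (simp add: R_def power2_eq_square algebra_simps)
  then show ?thesis
    using True by (simp add: Df_def)
next
  case False
  let ?s = "p $ 5"
  have "((\<lambda>t. \<kappa> \<bullet> p + t * \<kappa> $ i) has_real_derivative \<kappa> $ i) (at 0)"
    by (auto intro!: derivative_eq_intros)
  from cis_has_vector_derivative[OF this]
  have "((\<lambda>t. cis (\<kappa> \<bullet> p + t * \<kappa> $ i)) has_vector_derivative \<kappa> $ i *\<^sub>R (\<i> * cis (\<kappa> \<bullet> p))) (at 0)" by simp
  then have "((\<lambda>t. (\<i> * cis (\<kappa> \<bullet> p + t * \<kappa> $ i), 0::real)) has_vector_derivative
      (\<i> * (\<kappa> $ i *\<^sub>R (\<i> * cis (\<kappa> \<bullet> p))), 0)) (at 0)"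
    by (intro has_vector_derivative_Pair has_vector_derivative_mult_right has_vector_derivative_const)
  then have "((\<lambda>t. T (p + t *\<^sub>R axis i 1)) has_vector_derivative (- \<kappa> $ i) *\<^sub>R C p) (at 0)"
    by (simp add: T_def C_def inner_add_right inner_axis mult.assoc[symmetric])
  from bounded_linear.has_vector_derivative[OF bounded_linear_scaleR_right this, of "c i ?s * (sin (\<alpha> ?s) * \<kappa> $ i)"]
  show ?thesis
    using False by (simp add: Df_def R_def power2_eq_square mult_ac)
qed

end

section \<open>Harmonicity\<close>

text \<open>The angles run over closed intervals, so the box exceeds the fundamental domain by faces
  of measure zero, and is compact.\<close>

definition angle_box :: "real \<Rightarrow> real \<Rightarrow> (real ^ 5) set" where
  "angle_box l r = cbox (vector [0, 0, 0, 0, l]) (vector [2*pi, 2*pi, 2*pi, 2*pi, r])"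

lemma mem_angle_box:
  "p \<in> angle_box l r \<longleftrightarrow> (\<forall>i. i \<noteq> 5 \<longrightarrow> 0 \<le> p $ i \<and> p $ i \<le> 2 * pi) \<and> l \<le> p $ 5 \<and> p $ 5 \<le> r"
  by (simp add: angle_box_def mem_box_cart forall_5 conj_ac)

context torus_profile
begin

section \<open>Continuity and periodicity of the integrands\<close>

lemma isCont_g: "isCont (\<lambda>s. g s $ i) s"
  using exhaust_5[of i]
  by (elim disjE; simp add: g_def; intro continuous_intros isCont_h_fun)

lemma isCont_profile:
  assumes "s \<in> I_dom"
  shows "isCont \<alpha> s" "isCont \<alpha>' s" "isCont vol s" "isCont Q s" "isCont (c i) s" "isCont \<mu> s"
proof -
  show \<alpha>: "isCont \<alpha> s" using \<alpha>_der[OF assms] by (rule DERIV_isCont)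
  note [continuous_intros] = isCont_h_fun
  have nz: "sin (4 * s) \<noteq> 0" using sin_4_neq_0[OF assms] .
  show "isCont \<alpha>' s" "isCont vol s" "isCont Q s"
    using nz \<alpha> unfolding \<alpha>'_def[abs_def] vol_def[abs_def] Q_def[abs_def]
    by (auto intro!: continuous_intros)
  note [continuous_intros] = this isCont_g
  show "isCont (c i) s" "isCont \<mu> s"
    using g_pos[OF assms, of i] \<alpha> unfolding c_def[abs_def] \<mu>_def[abs_def]
    by (auto intro!: continuous_intros)
qed

lemma continuous_on_profile_nth:
  assumes "\<And>s. s \<in> I_dom \<Longrightarrow> isCont F s"
  shows "continuous_on \<Omega> (\<lambda>p. F (p $ 5))"
  by (rule continuous_on_compose2[of I_dom F])
    (auto intro!: continuous_at_imp_continuous_on assms continuous_intros)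

lemma continuous_on_coefficients:
  "continuous_on \<Omega> (\<lambda>p. \<alpha> (p $ 5))" "continuous_on \<Omega> (\<lambda>p. \<alpha>' (p $ 5))"
  "continuous_on \<Omega> (\<lambda>p. vol (p $ 5))" "continuous_on \<Omega> (\<lambda>p. Q (p $ 5))"
  "continuous_on \<Omega> (\<lambda>p. c i (p $ 5))" "continuous_on \<Omega> (\<lambda>p. \<mu> (p $ 5))"
  "continuous_on \<Omega> (\<lambda>p. cis (\<kappa> \<bullet> p))"
  by (rule continuous_on_profile_nth, erule isCont_profile)+ (intro continuous_intros)

lemma continuous_on_frame:
  "continuous_on \<Omega> f" "continuous_on \<Omega> T" "continuous_on \<Omega> N" "continuous_on \<Omega> C"
  "continuous_on \<Omega> (Df i)" "continuous_on \<Omega> (R i)"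
proof -
  note coeff = continuous_on_coefficients
  show frame: "continuous_on \<Omega> f" "continuous_on \<Omega> T" "continuous_on \<Omega> N" "continuous_on \<Omega> C"
    unfolding f_def[abs_def] T_def[abs_def] N_def[abs_def] C_def[abs_def]
    by ((rule coeff | rule continuous_intros)+)
  show "continuous_on \<Omega> (Df i)" "continuous_on \<Omega> (R i)"
    unfolding Df_def[abs_def] R_def[abs_def]
    by (cases "i = 5"; simp only: if_True if_False refl; (rule coeff frame | rule continuous_intros)+)+
qed

text \<open>The k_i are integers, so a full turn of one angle changes the phase by a multiple of 2
  pi.\<close>

lemma frame_periodic:
  assumes "i \<noteq> 5"
  shows "T (p + (2 * pi) *\<^sub>R axis i 1) = T p" "N (p + (2 * pi) *\<^sub>R axis i 1) = N p"
    "Df j (p + (2 * pi) *\<^sub>R axis i 1) = Df j p" "f (p + (2 * pi) *\<^sub>R axis i 1) = f p"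
proof -
  have "\<exists>k. \<kappa> $ i = of_int k"
    using exhaust_5[of i] assms by (auto simp: \<kappa>_def)
  then obtain k where "\<kappa> $ i = of_int k" by blast
  then have "cis (\<kappa> \<bullet> (p + (2 * pi) *\<^sub>R axis i 1)) = cis (\<kappa> \<bullet> p)"
    by (simp add: inner_add_right inner_axis cis_mult[symmetric] cis_multiple_2pi)
  then show "T (p + (2 * pi) *\<^sub>R axis i 1) = T p" "N (p + (2 * pi) *\<^sub>R axis i 1) = N p"
    "Df j (p + (2 * pi) *\<^sub>R axis i 1) = Df j p" "f (p + (2 * pi) *\<^sub>R axis i 1) = f p"
    using assms by (auto simp: T_def N_def Df_def f_def)
qed

text \<open>The first variation vanishes: integrating \<open>\<Sum>\<^sub>i \<partial>\<^sub>i (c\<^sub>i \<langle>\<partial>\<^sub>i f, u\<rangle>)\<close> over the box turns the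
  part of the energy difference that is linear in \<open>u\<close> into \<open>2 \<integral> \<mu> \<langle>f, u\<rangle>\<close>, and
  \<open>2 \<langle>f, u\<rangle> = - |u|\<^sup>2\<close> because \<open>f\<close> and \<open>f + u\<close> are unit vectors.\<close>

lemma energy_difference:
  fixes u :: "real ^ 5 \<Rightarrow> complex \<times> real"
  assumes lr: "l < r" and \<delta>: "\<delta> > 0" and sub: "{l..r + \<delta>} \<subseteq> I_dom"
    and der: "\<And>p. p \<in> \<Omega> \<Longrightarrow> (u has_derivative u' p) (at p)"
    and cont: "\<And>i. continuous_on \<Omega> (\<lambda>p. u' p (axis i 1))"
    and per: "\<And>p i. p \<in> \<Omega> \<Longrightarrow> i \<noteq> 5 \<Longrightarrow> u (p + (2 * pi) *\<^sub>R axis i 1) = u p"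
    and zero: "\<And>p. p $ 5 \<in> {l..l + \<delta>} \<union> {r..r + \<delta>} \<Longrightarrow> u p = 0"
    and unit: "\<And>p. p \<in> \<Omega> \<Longrightarrow> norm (f p + u p) = 1"
  shows "integral (angle_box l r)
      (\<lambda>p. \<Sum>i\<in>UNIV. c i (p $ 5) * ((norm (Df i p + u' p (axis i 1)))\<^sup>2 - (norm (Df i p))\<^sup>2)) =
    integral (angle_box l r)
      (\<lambda>p. (\<Sum>i\<in>UNIV. c i (p $ 5) * (norm (u' p (axis i 1)))\<^sup>2) - \<mu> (p $ 5) * (norm (u p))\<^sup>2)"
proof -
  note basic = continuous_on_coefficients continuous_on_frame cont
  define G where "G i p = (c i (p $ 5) *\<^sub>R Df i p) \<bullet> u p" for i p
  define G' where "G' i p = R i p \<bullet> u p + (c i (p $ 5) *\<^sub>R Df i p) \<bullet> u' p (axis i 1)" for i p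
  have cont_u: "continuous_on \<Omega> u"
    using der by (meson continuous_at_imp_continuous_on has_derivative_continuous)
  have cont_G: "continuous_on \<Omega> (G i)" "continuous_on \<Omega> (G' i)" for i
    unfolding G_def G'_def by ((rule basic cont_u | rule continuous_intros)+)
  have box: "angle_box l r \<subseteq> \<Omega>"
    using sub \<delta> by (auto simp: mem_angle_box)
  have int_G': "integral (angle_box l r) (G' i) = 0" for i
  proof -
    \<comment> \<open>In an angular direction any enlargement stays in \<Omega>; along s only the
      margin \<delta> is available.\<close>
    define d where "d = (if i = 5 then \<delta> else 1)"
    let ?a = "vector [0, 0, 0, 0, l] :: real ^ 5" and ?b = "vector [2*pi, 2*pi, 2*pi, 2*pi, r] :: real ^ 5"
    have big: "cbox ?a (?b + d *\<^sub>R axis i 1) \<subseteq> \<Omega>"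
    proof
      fix p assume "p \<in> cbox ?a (?b + d *\<^sub>R axis i 1)"
      then have "?a $ 5 \<le> p $ 5 \<and> p $ 5 \<le> (?b + d *\<^sub>R axis i 1) $ 5"
        unfolding mem_box_cart by blast
      then show "p \<in> \<Omega>" using sub \<delta> by (auto simp: d_def split: if_splits)
    qed
    have "integral (cbox ?a ?b) (G' i) = 0"
    proof (rule integral_periodic_partial_derivative)
      show "axis i 1 \<in> (Basis :: (real ^ 5) set)" by (simp add: axis_in_Basis_iff)
      show "?a \<bullet> axis i 1 < ?b \<bullet> axis i 1"
        using exhaust_5[of i] lr by (auto simp: inner_axis)
      show "d > 0" using \<delta> by (simp add: d_def)
      show "continuous_on (cbox ?a (?b + d *\<^sub>R axis i 1)) (G i)" "continuous_on (cbox ?a (?b + d *\<^sub>R axis i 1)) (G' i)"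
        using cont_G big by (auto intro: continuous_on_subset)
    next
      fix p assume "p \<in> cbox ?a (?b + d *\<^sub>R axis i 1)"
      then have p: "p \<in> \<Omega>" using big by blast
      then have p5: "p $ 5 \<in> I_dom" by simp
      have line: "((\<lambda>t. p + t *\<^sub>R axis i 1) has_derivative (\<lambda>t. t *\<^sub>R axis i 1)) (at 0)"
        by (auto intro!: derivative_eq_intros)
      have "(u has_derivative u' p) (at (p + 0 *\<^sub>R axis i 1))" using der[OF p] by simp
      from has_derivative_compose[OF line this]
      have "((\<lambda>t. u (p + t *\<^sub>R axis i 1)) has_vector_derivative u' p (axis i 1)) (at 0)"
        using linear_scale[OF has_derivative_linear[OF der[OF p]]]
        by (simp add: has_vector_derivative_def)
      from bounded_bilinear.has_vector_derivative[OF bounded_bilinear_inner D_cDf[OF p5, of i] this]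
      show "((\<lambda>t. G i (p + t *\<^sub>R axis i 1)) has_real_derivative G' i p) (at 0)"
        by (simp add: G_def G'_def has_real_derivative_iff_has_vector_derivative add.commute)
    next
      fix p assume p: "p \<in> cbox ?a ?b" and le: "p \<bullet> axis i 1 \<le> ?a \<bullet> axis i 1 + d"
      have p\<Omega>: "p \<in> \<Omega>" using p box by (auto simp: angle_box_def)
      show "G i (p + (?b \<bullet> axis i 1 - ?a \<bullet> axis i 1) *\<^sub>R axis i 1) = G i p"
      proof (cases "i = 5")
        case True
        \<comment> \<open>Along s there is no periodicity: the two values agree because
          \<open>u\<close> vanishes at both points.\<close>
        then have "p $ 5 \<in> {l..l + \<delta>}" "(p + (r - l) *\<^sub>R axis 5 1) $ 5 \<in> {r..r + \<delta>}"
          using le p by (auto simp: mem_box_cart forall_5 inner_axis d_def)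
        then show ?thesis
          using True zero[of p] zero[of "p + (r - l) *\<^sub>R axis 5 1"] by (simp add: G_def inner_axis)
      next
        case False
        then have "?b \<bullet> axis i 1 - ?a \<bullet> axis i 1 = 2 * pi"
          using exhaust_5[of i] by (auto simp: inner_axis)
        then show ?thesis
          using False frame_periodic(3)[OF False] per[OF p\<Omega> False] by (simp add: G_def)
      qed
    qed
    then show ?thesis by (simp add: angle_box_def)
  qed
  have integrable: "F integrable_on angle_box l r" if "continuous_on \<Omega> F" for F :: "real ^ 5 \<Rightarrow> real"
    using continuous_on_subset[OF that box] unfolding angle_box_def by (rule integrable_continuous)
  define E where "E p = (\<Sum>i\<in>UNIV. c i (p $ 5) * (norm (u' p (axis i 1)))\<^sup>2) - \<mu> (p $ 5) * (norm (u p))\<^sup>2" for p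
  have cont_E: "continuous_on \<Omega> E"
    unfolding E_def by ((rule basic cont_u | rule continuous_intros)+)
  have pointwise: "(\<Sum>i\<in>UNIV. c i (p $ 5) * ((norm (Df i p + u' p (axis i 1)))\<^sup>2 - (norm (Df i p))\<^sup>2)) =
      E p + (\<Sum>i\<in>UNIV. 2 * G' i p)" if p: "p \<in> angle_box l r" for p
  proof -
    have p\<Omega>: "p \<in> \<Omega>" using p box by blast
    have fu: "2 * (f p \<bullet> u p) = - (norm (u p))\<^sup>2"
      using unit[OF p\<Omega>] norm_f[of p] unfolding power2_norm_eq_inner norm_eq_1
      by (simp add: inner_add_left inner_add_right inner_commute)
    have "(\<Sum>i\<in>UNIV. 2 * (R i p \<bullet> u p)) = 2 * ((\<Sum>i\<in>UNIV. R i p) \<bullet> u p)"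
      by (simp add: inner_sum_left sum_distrib_left)
    also have "\<dots> = - \<mu> (p $ 5) * (2 * (f p \<bullet> u p))"
      using sum_R[of p] p\<Omega> by simp
    finally have R: "(\<Sum>i\<in>UNIV. 2 * (R i p \<bullet> u p)) = \<mu> (p $ 5) * (norm (u p))\<^sup>2"
      unfolding fu by simp
    \<comment> \<open>The cross term of the expanded square is a total derivative minus the term in
      which the derivative has moved to \<open>f\<close>.\<close>
    have "c i (p $ 5) * ((norm (Df i p + u' p (axis i 1)))\<^sup>2 - (norm (Df i p))\<^sup>2) =
        c i (p $ 5) * (norm (u' p (axis i 1)))\<^sup>2 + (2 * G' i p - 2 * (R i p \<bullet> u p))" for i
      unfolding G'_def power2_norm_eq_inner
      by (simp add: inner_add_left inner_add_right inner_commute algebra_simps)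
    then show ?thesis
      unfolding E_def R[symmetric] by (simp add: sum.distrib sum_subtractf)
  qed
  have "integral (angle_box l r)
      (\<lambda>p. \<Sum>i\<in>UNIV. c i (p $ 5) * ((norm (Df i p + u' p (axis i 1)))\<^sup>2 - (norm (Df i p))\<^sup>2)) =
    integral (angle_box l r) (\<lambda>p. E p + (\<Sum>i\<in>UNIV. 2 * G' i p))"
    by (rule Henstock_Kurzweil_Integration.integral_cong) (rule pointwise)
  also have "\<dots> = integral (angle_box l r) E + integral (angle_box l r) (\<lambda>p. \<Sum>i\<in>UNIV. 2 * G' i p)"
    by (intro integral_add integrable cont_E continuous_intros cont_G)
  also have "integral (angle_box l r) (\<lambda>p. \<Sum>i\<in>UNIV. 2 * G' i p) =
      (\<Sum>i\<in>UNIV. integral (angle_box l r) (\<lambda>p. 2 * G' i p))"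
    by (intro integral_sum integrable continuous_intros cont_G) simp
  also have "\<dots> = 0"
    by (simp add: int_G')
  finally show ?thesis
    unfolding E_def by simp
qed

end

section \<open>The chart, the fundamental domain and dependence on time\<close>

lemma chart_map_V5:
  "chart_map (V5 a1 a2 a3 a4) p = (vector [cis (p $ 1), cis (p $ 2), cis (p $ 3), cis (p $ 4)], p $ 5)"
  by (simp add: V5_def)

lemma coords_V5: "coords (V5 a1 a2 a3 a4) = {p. p $ 5 \<in> I_dom}"
  by (simp add: V5_def)

lemma open_\<Omega>: "open {p :: real ^ 5. p $ 5 \<in> I_dom}"
  using open_vimage[OF open_I_dom, of "\<lambda>p :: real ^ 5. p $ 5"]
  by (simp add: vimage_def continuous_on_component continuous_on_id)

lemma continuous_on_chart_map: "continuous_on A (chart_map (V5 a1 a2 a3 a4))"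
proof -
  have eq: "(vector [w1, w2, w3, w4] :: complex ^ 4) = axis 1 w1 + axis 2 w2 + axis 3 w3 + axis 4 w4" for w1 w2 w3 w4
    by (simp add: vec_eq_iff forall_4 axis_def)
  have ax: "continuous_on A (\<lambda>x. axis i (F x))" if "continuous_on A F" for F :: "real ^ 5 \<Rightarrow> complex" and i :: 4
  proof -
    have "continuous_on A (\<lambda>x. if j = i then F x else 0)" for j
      using that by (cases "j = i") auto
    then show ?thesis unfolding axis_def by (rule continuous_on_vec_lambda)
  qed
  show ?thesis
    unfolding chart_map_V5[abs_def] eq by (intro continuous_intros ax)
qed

lemma fund_V5_borel: "fund (V5 a1 a2 a3 a4) \<in> sets borel"
proof -
  have "fund (V5 a1 a2 a3 a4) = (\<Inter>i\<in>{1, 2, 3, 4}. {p. 0 \<le> p $ i} \<inter> {p. p $ i < 2 * pi}) \<inter> {p. p $ 5 \<in> I_dom}"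
    by (auto simp: V5_def)
  moreover have "{p :: real ^ 5. 0 \<le> p $ i} \<in> sets borel" "{p :: real ^ 5. p $ i < 2 * pi} \<in> sets borel" for i
    by (auto intro!: borel_closed closed_Collect_le borel_open open_Collect_less continuous_intros)
  ultimately show ?thesis
    using borel_open[OF open_\<Omega>] by (simp add: sets.Int)
qed

text \<open>The mean value inequality in t. Halving \<epsilon> makes the time interval compact, so
  the time derivative is bounded on its product with \<open>B\<close>.\<close>

lemma Ck_on_lipschitz_in_time:
  fixes H :: "real \<times> 'a::euclidean_space \<Rightarrow> 'b::euclidean_space"
  assumes H: "Ck_on (Suc 0) ({-\<epsilon><..<\<epsilon>} \<times> U) H" and B: "compact B" "B \<subseteq> U" and \<epsilon>: "\<epsilon> > 0"
  obtains L where "L \<ge> 0" "\<And>t p. \<bar>t\<bar> \<le> \<epsilon>/2 \<Longrightarrow> p \<in> B \<Longrightarrow> norm (H (t, p) - H (0, p)) \<le> L * \<bar>t\<bar>"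
proof -
  let ?J = "{-\<epsilon>/2..\<epsilon>/2}"
  define V where "V x = frechet_derivative H (at x) (1, 0)" for x
  have JB: "?J \<times> B \<subseteq> {-\<epsilon><..<\<epsilon>} \<times> U" using B \<epsilon> by auto
  have "\<forall>v. continuous_on ({-\<epsilon><..<\<epsilon>} \<times> U) (\<lambda>x. frechet_derivative H (at x) v)"
    using H unfolding Ck_on.simps by blast
  then have "continuous_on (?J \<times> B) V"
    unfolding V_def using continuous_on_subset[OF _ JB] by blast
  then have "bounded (V ` (?J \<times> B))"
    using B by (intro compact_imp_bounded compact_continuous_image compact_Times) auto
  then obtain L where L: "L > 0" "\<And>x. x \<in> ?J \<times> B \<Longrightarrow> norm (V x) \<le> L"
    unfolding bounded_pos by auto
  show thesis
  proof
    show "L \<ge> 0" using L by simp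
    fix t p assume t: "\<bar>t\<bar> \<le> \<epsilon>/2" and p: "p \<in> B"
    have der: "((\<lambda>s. H (s, p)) has_derivative (\<lambda>v. v *\<^sub>R V (s, p))) (at s within ?J)" if s: "s \<in> ?J" for s
    proof -
      have "(s, p) \<in> {-\<epsilon><..<\<epsilon>} \<times> U" using B s p \<epsilon> by auto
      then have Hd: "(H has_derivative frechet_derivative H (at (s, p))) (at (s, p))"
        using H by (intro Ck_on_has_derivative)
      have "((\<lambda>s. (s, p)) has_derivative (\<lambda>v. (v, 0))) (at s within ?J)"
        by (auto intro!: derivative_eq_intros)
      from has_derivative_compose[OF this Hd]
      have "((\<lambda>s. H (s, p)) has_derivative (\<lambda>v. frechet_derivative H (at (s, p)) (v, 0))) (at s within ?J)" .
      moreover have "frechet_derivative H (at (s, p)) (v, 0) = v *\<^sub>R V (s, p)" for v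
        using linear_scale[OF has_derivative_linear[OF Hd], of v "(1, 0)"] by (simp add: V_def)
      ultimately show ?thesis by simp
    qed
    have "norm (H (t, p) - H (0, p)) \<le> L * norm (t - 0)"
    proof (rule differentiable_bound[OF _ der])
      show "onorm (\<lambda>v. v *\<^sub>R V (s, p)) \<le> L" if "s \<in> ?J" for s
        using L(2)[of "(s, p)"] L(1) that p
        by (intro onorm_bound) (auto simp: mult.commute[of L] intro!: mult_left_mono)
    qed (use t \<epsilon> in auto)
    then show "norm (H (t, p) - H (0, p)) \<le> L * \<bar>t\<bar>" by simp
  qed
qed

context torus_profile
begin

text \<open>Integer powers of the circle coordinates express the phase without choosing angles, so
  this is a function on the manifold itself.\<close>

definition \<phi> :: "(complex ^ 4) \<times> real \<Rightarrow> complex \<times> real" where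
  "\<phi> = (\<lambda>(w, s). (sin (\<alpha> s) *\<^sub>R (w $ 1 powi k1 * w $ 2 powi k2 * w $ 3 powi k3 * w $ 4 powi k4), cos (\<alpha> s)))"

lemma \<phi>_chart: "\<phi> (chart_map M p) = f p"
  by (simp add: chart_map_V5 \<phi>_def f_def \<kappa>_def inner_vec_def sum_5 cis_power_int cis_mult add.assoc)

lemma \<phi>_comp_chart: "\<phi> \<circ> chart_map M = f"
  by (auto simp: \<phi>_chart)

lemma metric_M: "metric M p = (\<chi> i j. if i = j then g (p $ 5) $ i else 0)"
  unfolding g_def by (simp add: V5_def Let_def)

text \<open>The inverse metric is diagonal with entries 1 / g_ii; multiplied by the density, these
  are the weights \<open>c i\<close>.\<close>

lemma norm_diff_sq_M:
  assumes "p \<in> \<Omega>"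
  shows "norm_diff_sq M F p * sqrt (det (metric M p)) =
    (\<Sum>i\<in>UNIV. c i (p $ 5) * (norm (frechet_derivative (F \<circ> chart_map M) (at p) (axis i 1)))\<^sup>2)"
proof -
  let ?s = "p $ 5" and ?d = "\<lambda>i. frechet_derivative (F \<circ> chart_map M) (at p) (axis i 1)"
  have inv: "matrix_inv (metric M p) = (\<chi> i j. if i = j then inverse (g ?s $ i) else 0)"
    unfolding metric_M using g_pos[of ?s] assms by (intro matrix_inv_diagonal) (auto simp: less_le)
  have det: "det (metric M p) = (\<Prod>i\<in>UNIV. g ?s $ i)"
    unfolding metric_M by (subst det_diagonal) auto
  have "norm_diff_sq M F p = (\<Sum>i\<in>UNIV. \<Sum>j\<in>UNIV. if j = i then inverse (g ?s $ i) * (?d i \<bullet> ?d j) else 0)"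
    unfolding norm_diff_sq_def diff_at_def inv by (intro sum.cong refl) auto
  also have "\<dots> = (\<Sum>i\<in>UNIV. inverse (g ?s $ i) * (norm (?d i))\<^sup>2)"
    by (simp add: power2_norm_eq_inner)
  finally show ?thesis
    unfolding det sqrt_prod_g by (simp add: c_def sum_distrib_left divide_inverse mult_ac)
qed

section \<open>Smoothness of the profile and of the map\<close>

lemma Ck_on_h: "Ck_on k I_dom h"
proof -
  have pos: "h s > 0" for s by (rule h_pos)
  have pm: "Ck_on k I_dom (\<lambda>s. s + pi/4)"
    by (intro Ck_on_add Ck_on_id Ck_on_const open_I_dom)
  have "Ck_on k I_dom (\<lambda>s. sqrt (a1\<^sup>2 * (cos s * cos s) + a2\<^sup>2 * (cos (s + pi/4) * cos (s + pi/4)) +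
      a3\<^sup>2 * (sin s * sin s) + a4\<^sup>2 * (sin (s + pi/4) * sin (s + pi/4))))"
  proof (rule Ck_on_sqrt[OF open_I_dom])
    show "0 < a1\<^sup>2 * (cos s * cos s) + a2\<^sup>2 * (cos (s + pi/4) * cos (s + pi/4)) +
      a3\<^sup>2 * (sin s * sin s) + a4\<^sup>2 * (sin (s + pi/4) * sin (s + pi/4))" for s
      using pos[of s] by (simp add: h_fun_def power2_eq_square)
  qed (intro Ck_on_add Ck_on_mult Ck_on_const open_I_dom
      Ck_on_sin_cos[THEN conjunct1] Ck_on_sin_cos[THEN conjunct2] Ck_on_id pm)
  then show ?thesis
    by (simp add: h_fun_def[abs_def] power2_eq_square)
qed

text \<open>Bootstrapping in the differential equation: if \<alpha> is of class k, so is the right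
  side, hence \<alpha> is of class k + 1.\<close>

lemma Ck_on_\<alpha>: "Ck_on k I_dom \<alpha>"
proof (induction k)
  case 0
  then show ?case by (auto intro: continuous_at_imp_continuous_on isCont_profile)
next
  case (Suc k)
  have "Ck_on k I_dom (\<lambda>s. 4 * (h s * (sin (\<alpha> s) * inverse (sin (4 * s)))))"
    by (intro Ck_on_mult Ck_on_inverse Ck_on_const Ck_on_h Ck_on_sin_cos[THEN conjunct1] Ck_on_id
        Suc.IH open_I_dom sin_4_neq_0)
  then have "Ck_on k I_dom \<alpha>'"
    by (simp add: \<alpha>'_def[abs_def] divide_inverse mult.assoc)
  then show ?case
    using \<alpha>_der by (intro Ck_on_real_SucI[OF open_I_dom]) (auto simp: has_real_derivative_iff_has_vector_derivative)
qed

text \<open>The map is split into real functions of the two linear forms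
  \<open>\<kappa> \<bullet> p\<close> and \<open>p $ 5\<close>, multiplied by constant vectors, so
  that composition with linear maps suffices.\<close>

lemma Ck_on_f: "Ck_on k \<Omega> f"
proof -
  have \<psi>: "Ck_on k \<Omega> (\<lambda>p. F (\<kappa> \<bullet> p))" if "Ck_on k UNIV F" for F :: "real \<Rightarrow> real"
    by (rule Ck_on_comp_linear[OF open_\<Omega> bounded_linear_inner_right _ that]) simp
  have s: "Ck_on k \<Omega> (\<lambda>p. F (p $ 5))" if "Ck_on k I_dom F" for F :: "real \<Rightarrow> real"
    by (rule Ck_on_comp_linear[OF open_\<Omega> bounded_linear_vec_nth _ that]) auto
  have sc: "Ck_on k UNIV (sin :: real \<Rightarrow> real)" "Ck_on k UNIV (cos :: real \<Rightarrow> real)"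
    using Ck_on_sin_cos[of UNIV k "\<lambda>x. x"] Ck_on_id[of "UNIV :: real set"] by auto
  have sk: "Ck_on k \<Omega> (\<lambda>p. sin (\<kappa> \<bullet> p))" and ck: "Ck_on k \<Omega> (\<lambda>p. cos (\<kappa> \<bullet> p))"
    by (rule \<psi>[OF sc(1)], rule \<psi>[OF sc(2)])
  have sa: "Ck_on k \<Omega> (\<lambda>p. sin (\<alpha> (p $ 5)))" and ca: "Ck_on k \<Omega> (\<lambda>p. cos (\<alpha> (p $ 5)))"
    using s[of "\<lambda>s. sin (\<alpha> s)"] s[of "\<lambda>s. cos (\<alpha> s)"] Ck_on_sin_cos[OF open_I_dom Ck_on_\<alpha>] by blast+
  have vec: "Ck_on k \<Omega> (\<lambda>p. F p *\<^sub>R v)" if "Ck_on k \<Omega> F" for F :: "real ^ 5 \<Rightarrow> real" and v :: "complex \<times> real"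
    by (rule Ck_on_linear_comp[OF open_\<Omega> bounded_linear_scaleR_left that])
  have "Ck_on k \<Omega> (\<lambda>p. (sin (\<alpha> (p $ 5)) * cos (\<kappa> \<bullet> p)) *\<^sub>R (1, 0 :: real) +
      ((sin (\<alpha> (p $ 5)) * sin (\<kappa> \<bullet> p)) *\<^sub>R (\<i>, 0) + cos (\<alpha> (p $ 5)) *\<^sub>R (0, 1)))"
    by (rule Ck_on_add[OF open_\<Omega> vec[OF Ck_on_mult[OF open_\<Omega> sa ck]]
          Ck_on_add[OF open_\<Omega> vec[OF Ck_on_mult[OF open_\<Omega> sa sk]] vec[OF ca]]])
  moreover have "(\<lambda>p. (sin (\<alpha> (p $ 5)) * cos (\<kappa> \<bullet> p)) *\<^sub>R (1, 0 :: real) +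
      ((sin (\<alpha> (p $ 5)) * sin (\<kappa> \<bullet> p)) *\<^sub>R (\<i>, 0) + cos (\<alpha> (p $ 5)) *\<^sub>R (0, 1))) = f"
    by (auto simp: f_def fun_eq_iff complex_eq_iff)
  ultimately show ?thesis by simp
qed

lemma smooth_map_\<phi>: "smooth_map M S2 \<phi>"
  unfolding smooth_map_def smooth_on_def
proof
  show "\<forall>k. Ck_on k (coords M) (\<phi> \<circ> chart_map M)"
    by (simp add: \<phi>_comp_chart coords_V5 Ck_on_f)
  show "\<phi> ` points M \<subseteq> S2"
    by (auto simp: points_def \<phi>_chart S2_def norm_f)
qed

end

section \<open>Slices at fixed time and collars inside a component\<close>

lemma slice_has_derivative:
  fixes H :: "real \<times> 'a::euclidean_space \<Rightarrow> 'b::euclidean_space"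
  assumes "Ck_on (Suc k) (J \<times> U) H" "t \<in> J" "p \<in> U"
  shows "((\<lambda>p. H (t, p)) has_derivative (\<lambda>v. frechet_derivative H (at (t, p)) (0, v))) (at p)"
proof -
  have "((\<lambda>p. (t, p)) has_derivative (\<lambda>v. (0, v))) (at p)"
    by (auto intro!: derivative_eq_intros)
  moreover have "(H has_derivative frechet_derivative H (at (t, p))) (at (t, p))"
    using assms(1) by (rule Ck_on_has_derivative) (use assms in auto)
  ultimately show ?thesis by (rule has_derivative_compose)
qed

lemma slice_derivative_continuous:
  fixes H :: "real \<times> 'a::euclidean_space \<Rightarrow> 'b::euclidean_space"
  assumes "Ck_on (Suc 0) (J \<times> U) H" "t \<in> J"
  shows "continuous_on U (\<lambda>p. frechet_derivative H (at (t, p)) (0, w))"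
proof -
  have "continuous_on (J \<times> U) (\<lambda>x. frechet_derivative H (at x) (0, w))"
    using assms(1) unfolding Ck_on.simps by blast
  then show ?thesis
    by (rule continuous_on_compose2) (use assms(2) in \<open>auto intro!: continuous_intros\<close>)
qed

text \<open>Supplies the interval of one box together with collars [l, l + \<delta>] and
  [r, r + \<delta>] that miss \<open>S\<close>; a variation supported over \<open>S\<close> is
  trivial on them.\<close>

lemma compact_subset_component:
  assumes "compact S" "S \<subseteq> I_dom" "j < 4"
  obtains l r \<delta> where "real j * pi/4 < l" "l < r" "\<delta> > 0" "r + \<delta> < real (Suc j) * pi/4"
    "\<And>s. s \<in> S \<Longrightarrow> s \<in> {real j * pi/4<..<real (Suc j) * pi/4} \<Longrightarrow> s \<in> {l + \<delta><..<r}"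
proof -
  let ?l = "real j * pi/4" and ?r = "real (Suc j) * pi/4"
  \<comment> \<open>Since \<open>S\<close> avoids the endpoints, intersecting with the closed
    segment keeps compactness and still lands in the open one.\<close>
  have ends: "?l \<notin> I_dom" "?r \<notin> I_dom"
    using sin_4_neq_0[of ?l] sin_4_neq_0[of ?r] by (auto simp del: of_nat_Suc)
  have "compact (S \<inter> {?l..?r})" using assms(1) by (simp add: compact_Int_closed)
  moreover have "S \<inter> {?l..?r} \<subseteq> {?l<..<?r}"
  proof
    fix x assume x: "x \<in> S \<inter> {?l..?r}"
    then have "x \<noteq> ?l" "x \<noteq> ?r" using ends assms(2) by blast+
    then show "x \<in> {?l<..<?r}"
      using x by (auto simp only: atLeastAtMost_iff greaterThanLessThan_iff less_le Int_iff)
  qed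
  moreover have "?l < ?r" by simp
  ultimately obtain l' r' where lr: "?l < l'" "l' < r'" "r' < ?r" "S \<inter> {?l..?r} \<subseteq> {l'..r'}"
    by (rule compact_subset_open_interval)
  \<comment> \<open>A third of the smaller gap leaves room for a collar and a further \<delta> of
    separation on each side, with strict inequality at the ends.\<close>
  define \<delta> where "\<delta> = min (l' - ?l) (?r - r') / 3"
  show thesis
  proof (rule that[of "l' - 2 * \<delta>" "r' + \<delta>" \<delta>])
    show "s \<in> {l' - 2 * \<delta> + \<delta><..<r' + \<delta>}" if "s \<in> S" "s \<in> {?l<..<?r}" for s
    proof -
      have "s \<in> {l'..r'}" using lr(4) that by auto
      moreover have "\<delta> > 0" using lr by (simp add: \<delta>_def)
      ultimately show ?thesis by simp
    qed
  qed (use lr in \<open>auto simp: \<delta>_def min_def field_simps\<close>)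
qed

context torus_profile
begin

lemma chart_periodic:
  assumes "i \<noteq> 5"
  shows "chart_map M (p + (2 * pi) *\<^sub>R axis i 1) = chart_map M p"
proof -
  have "cis ((p + (2 * pi) *\<^sub>R axis i 1) $ j) = cis (p $ j)" for j
    by (simp add: axis_def flip: cis_mult)
  moreover have "(p + (2 * pi) *\<^sub>R axis i 1) $ 5 = p $ 5"
    using assms by simp
  ultimately show ?thesis by (simp only: chart_map_V5)
qed

text \<open>The difference \<open>u\<close> of the map at time t and \<open>f\<close>, and its space
  derivatives, are O(t) by the Lipschitz bounds; \<open>energy_difference\<close> leaves only terms
  quadratic in them.\<close>

lemma box_estimate:
  fixes H :: "real \<times> (real ^ 5) \<Rightarrow> complex \<times> real"
  defines "H' t p i \<equiv> frechet_derivative H (at (t, p)) (0, axis i 1)"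
  assumes H: "smooth_on ({-\<epsilon><..<\<epsilon>} \<times> \<Omega>) H" and \<epsilon>: "\<epsilon> > 0"
    and H0: "\<And>p. p \<in> \<Omega> \<Longrightarrow> H (0, p) = f p"
    and per: "\<And>t p i. i \<noteq> 5 \<Longrightarrow> H (t, p + (2 * pi) *\<^sub>R axis i 1) = H (t, p)"
    and unit: "\<And>t p. t \<in> {-\<epsilon><..<\<epsilon>} \<Longrightarrow> p \<in> \<Omega> \<Longrightarrow> norm (H (t, p)) = 1"
    and lr: "l < r" and \<delta>: "\<delta> > 0" and sub: "{l..r + \<delta>} \<subseteq> I_dom"
    and zero: "\<And>t p. t \<in> {-\<epsilon><..<\<epsilon>} \<Longrightarrow> p $ 5 \<in> {l..l + \<delta>} \<union> {r..r + \<delta>} \<Longrightarrow> H (t, p) = f p"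
  obtains K where "\<And>t. \<bar>t\<bar> \<le> \<epsilon>/2 \<Longrightarrow>
    \<bar>integral (angle_box l r) (\<lambda>p. \<Sum>i\<in>UNIV. c i (p $ 5) * ((norm (H' t p i))\<^sup>2 - (norm (H' 0 p i))\<^sup>2))\<bar> \<le> K * t\<^sup>2"
proof -
  let ?D = "{-\<epsilon><..<\<epsilon>} \<times> \<Omega>"
  \<comment> \<open>Two orders: one for the space derivative, one more for its Lipschitz dependence
    on t.\<close>
  have C2: "Ck_on (Suc (Suc 0)) ?D H" using H by (simp only: smooth_on_def)
  have C1: "Ck_on (Suc 0) ?D (\<lambda>x. frechet_derivative H (at x) (0, axis i 1))" for i
    using C2 unfolding Ck_on.simps(2)[of "Suc 0"] by blast
  have box: "angle_box l r \<subseteq> \<Omega>" "compact (angle_box l r)"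
    using sub \<delta> by (auto simp: mem_angle_box) (simp add: angle_box_def)
  have "\<exists>L\<ge>0. \<forall>t p. \<bar>t\<bar> \<le> \<epsilon>/2 \<longrightarrow> p \<in> angle_box l r \<longrightarrow> norm (H (t, p) - H (0, p)) \<le> L * \<bar>t\<bar>"
    using Ck_on_lipschitz_in_time[OF Ck_on_SucD[OF C2] box(2,1) \<epsilon>] by metis
  then obtain L where L: "L \<ge> 0" "\<And>t p. \<bar>t\<bar> \<le> \<epsilon>/2 \<Longrightarrow> p \<in> angle_box l r \<Longrightarrow> norm (H (t, p) - H (0, p)) \<le> L * \<bar>t\<bar>"
    by blast
  have "\<exists>L\<ge>0. \<forall>t p. \<bar>t\<bar> \<le> \<epsilon>/2 \<longrightarrow> p \<in> angle_box l r \<longrightarrow> norm (H' t p i - H' 0 p i) \<le> L * \<bar>t\<bar>" for i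
    unfolding H'_def using Ck_on_lipschitz_in_time[OF C1[of i] box(2,1) \<epsilon>] by metis
  then obtain L' where L': "\<And>i. L' i \<ge> 0"
    "\<And>i t p. \<bar>t\<bar> \<le> \<epsilon>/2 \<Longrightarrow> p \<in> angle_box l r \<Longrightarrow> norm (H' t p i - H' 0 p i) \<le> L' i * \<bar>t\<bar>"
    by metis
  note slice = slice_has_derivative[OF C2]
  have zero_in: "0 \<in> {-\<epsilon><..<\<epsilon>}" using \<epsilon> by simp
  have H'0: "H' 0 p i = Df i p" if "p \<in> \<Omega>" for p i
  proof -
    have "(f has_derivative (\<lambda>v. frechet_derivative H (at (0, p)) (0, v))) (at p)"
      by (rule has_derivative_transform_within_open[OF slice[OF zero_in that] open_\<Omega> that]) (simp add: H0)
    from fun_cong[OF frechet_derivative_at[OF this], of "axis i 1"] frechet_f[of p i] that show ?thesis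
      by (simp add: H'_def)
  qed
  note basic = continuous_on_coefficients[THEN continuous_on_subset, OF box(1)]
  \<comment> \<open>Independent of t: the bound for the quadratic integrand divided by t^2. Its
    integral is the constant \<open>K\<close>.\<close>
  define m where "m p = (\<Sum>i\<in>UNIV. c i (p $ 5) * (L' i)\<^sup>2) + \<bar>\<mu> (p $ 5)\<bar> * L\<^sup>2" for p :: "real ^ 5"
  have cont_m: "continuous_on (angle_box l r) m"
    unfolding m_def by ((rule basic | rule continuous_intros)+)
  show thesis
  proof (rule that[of "integral (angle_box l r) m"])
    fix t assume t: "\<bar>t\<bar> \<le> \<epsilon>/2"
    then have tin: "t \<in> {-\<epsilon><..<\<epsilon>}" using \<epsilon> by auto
    define u where "u p = H (t, p) - f p" for p
    define u' where "u' p v = frechet_derivative H (at (t, p)) (0, v) -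
      ((sin (\<alpha> (p $ 5)) * (\<kappa> \<bullet> v)) *\<^sub>R T p + (\<alpha>' (p $ 5) * v $ 5) *\<^sub>R N p)" for p v
    have u'_axis: "u' p (axis i 1) = H' t p i - Df i p" for p i
      by (simp add: u'_def H'_def Df_def inner_axis)
    have cont_H': "continuous_on \<Omega> (\<lambda>p. H' t p i)" for i
      unfolding H'_def using C2[THEN Ck_on_SucD] tin by (rule slice_derivative_continuous)
    have cont_u': "continuous_on \<Omega> (\<lambda>p. u' p (axis i 1))" for i
      unfolding u'_axis by (intro continuous_on_diff cont_H' continuous_on_frame)
    have der_u: "(u has_derivative u' p) (at p)" if "p \<in> \<Omega>" for p
      unfolding u_def[abs_def] u'_def[abs_def]
      by (rule has_derivative_diff[OF slice[OF tin that] f_has_derivative]) (use that in simp)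
    have cont_u: "continuous_on \<Omega> u"
      using der_u by (meson continuous_at_imp_continuous_on has_derivative_continuous)
    have eq: "integral (angle_box l r) (\<lambda>p. \<Sum>i\<in>UNIV. c i (p $ 5) * ((norm (H' t p i))\<^sup>2 - (norm (H' 0 p i))\<^sup>2)) =
      integral (angle_box l r) (\<lambda>p. \<Sum>i\<in>UNIV. c i (p $ 5) * ((norm (Df i p + u' p (axis i 1)))\<^sup>2 - (norm (Df i p))\<^sup>2))"
      by (rule Henstock_Kurzweil_Integration.integral_cong) (use box H'0 in \<open>auto simp: u'_axis\<close>)
    also have "\<dots> = integral (angle_box l r)
      (\<lambda>p. (\<Sum>i\<in>UNIV. c i (p $ 5) * (norm (u' p (axis i 1)))\<^sup>2) - \<mu> (p $ 5) * (norm (u p))\<^sup>2)"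
    proof (rule energy_difference[OF lr \<delta> sub der_u cont_u'])
      show "u (p + (2 * pi) *\<^sub>R axis i 1) = u p" if "i \<noteq> 5" for p i
        using per[OF that] frame_periodic(4)[OF that] by (simp add: u_def)
      show "u p = 0" if "p $ 5 \<in> {l..l + \<delta>} \<union> {r..r + \<delta>}" for p
        using zero[OF tin that] by (simp add: u_def)
      show "norm (f p + u p) = 1" if "p \<in> \<Omega>" for p
        using unit[OF tin that] by (simp add: u_def)
    qed
    also have "norm \<dots> \<le> integral (angle_box l r) (\<lambda>p. m p * t\<^sup>2)"
    proof (rule integral_norm_bound_integral)
      have "continuous_on \<Omega> (\<lambda>p. (\<Sum>i\<in>UNIV. c i (p $ 5) * (norm (u' p (axis i 1)))\<^sup>2) - \<mu> (p $ 5) * (norm (u p))\<^sup>2)"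
        by ((rule continuous_on_coefficients cont_u cont_u' | rule continuous_intros)+)
      from continuous_on_subset[OF this box(1)]
      show "(\<lambda>p. (\<Sum>i\<in>UNIV. c i (p $ 5) * (norm (u' p (axis i 1)))\<^sup>2) - \<mu> (p $ 5) * (norm (u p))\<^sup>2) integrable_on angle_box l r"
        unfolding angle_box_def by (rule integrable_continuous)
      have "continuous_on (angle_box l r) (\<lambda>p. m p * t\<^sup>2)"
        by (intro continuous_intros cont_m)
      then show "(\<lambda>p. m p * t\<^sup>2) integrable_on angle_box l r"
        unfolding angle_box_def by (rule integrable_continuous)
    next
      fix p assume p: "p \<in> angle_box l r"
      then have p\<Omega>: "p \<in> \<Omega>" using box by blast
      have c0: "c i (p $ 5) \<ge> 0" for i
        using vol_pos[of "p $ 5"] g_pos[of "p $ 5" i] p\<Omega> by (simp add: c_def)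
      have "(norm (u' p (axis i 1)))\<^sup>2 \<le> (L' i * \<bar>t\<bar>)\<^sup>2" for i
        using L'(2)[OF t p, of i] H'0[OF p\<Omega>] by (intro power_mono) (simp_all add: u'_axis)
      then have "(\<Sum>i\<in>UNIV. c i (p $ 5) * (norm (u' p (axis i 1)))\<^sup>2) \<le> (\<Sum>i\<in>UNIV. c i (p $ 5) * (L' i * \<bar>t\<bar>)\<^sup>2)"
        using c0 by (intro sum_mono mult_left_mono) auto
      moreover have "(\<Sum>i\<in>UNIV. c i (p $ 5) * (norm (u' p (axis i 1)))\<^sup>2) \<ge> 0"
        using c0 by (intro sum_nonneg) auto
      moreover have "(norm (u p))\<^sup>2 \<le> (L * \<bar>t\<bar>)\<^sup>2"
        using L(2)[OF t p] H0[OF p\<Omega>] by (intro power_mono) (simp_all add: u_def)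
      then have "\<bar>\<mu> (p $ 5) * (norm (u p))\<^sup>2\<bar> \<le> \<bar>\<mu> (p $ 5)\<bar> * (L * \<bar>t\<bar>)\<^sup>2"
        unfolding abs_mult by (intro mult_left_mono) auto
      ultimately have "\<bar>(\<Sum>i\<in>UNIV. c i (p $ 5) * (norm (u' p (axis i 1)))\<^sup>2) - \<mu> (p $ 5) * (norm (u p))\<^sup>2\<bar> \<le>
          (\<Sum>i\<in>UNIV. c i (p $ 5) * (L' i * \<bar>t\<bar>)\<^sup>2) + \<bar>\<mu> (p $ 5)\<bar> * (L * \<bar>t\<bar>)\<^sup>2"
        by linarith
      also have "\<dots> = m p * t\<^sup>2"
        by (simp add: m_def power_mult_distrib distrib_left sum_distrib_left mult_ac)
      finally show "norm ((\<Sum>i\<in>UNIV. c i (p $ 5) * (norm (u' p (axis i 1)))\<^sup>2) - \<mu> (p $ 5) * (norm (u p))\<^sup>2) \<le> m p * t\<^sup>2"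
        by simp
    qed
    also have "\<dots> = integral (angle_box l r) m * t\<^sup>2"
      by simp
    finally show "\<bar>integral (angle_box l r) (\<lambda>p. \<Sum>i\<in>UNIV. c i (p $ 5) * ((norm (H' t p i))\<^sup>2 - (norm (H' 0 p i))\<^sup>2))\<bar>
        \<le> integral (angle_box l r) m * t\<^sup>2"
      by simp
  qed
qed

text \<open>The set \<open>S\<close> of the energy is merely Borel, so no integration by parts takes
  place on it; the energy difference is carried over to the boxes before the quadratic estimate is
  applied.\<close>

lemma harmonic_\<phi>: "harmonic_map M S2 \<phi>"
  unfolding harmonic_map_def
proof (intro conjI allI impI smooth_map_\<phi>)
  fix K \<epsilon> F assume var: "compact_variation M S2 \<phi> K \<epsilon> F"
  define H where "H = (\<lambda>(t, p). F t (chart_map M p))"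
  define H' where "H' t p i = frechet_derivative H (at (t, p)) (0, axis i 1)" for t p i
  define e where "e t p = (\<Sum>i\<in>UNIV. c i (p $ 5) * (norm (H' t p i))\<^sup>2)" for t p
  define S where "S = {p \<in> fund M. chart_map M p \<in> K}"
  have K: "compact K" "K \<subseteq> points M" and \<epsilon>: "\<epsilon> > 0"
    and smooth: "smooth_on ({-\<epsilon><..<\<epsilon>} \<times> \<Omega>) H"
    using var by (auto simp: compact_variation_def H_def coords_V5)
  have pt: "chart_map M p \<in> points M" if "p \<in> \<Omega>" for p
    using that by (auto simp: points_def coords_V5)
  have H0: "H (0, p) = f p" if "p \<in> \<Omega>" for p
    using var pt[OF that] by (auto simp: compact_variation_def H_def \<phi>_chart)
  have off: "H (t, p) = f p" if "t \<in> {-\<epsilon><..<\<epsilon>}" "p \<in> \<Omega>" "chart_map M p \<notin> K" for t p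
    using var pt[OF that(2)] that by (auto simp: compact_variation_def H_def \<phi>_chart)
  have unit: "norm (H (t, p)) = 1" if "t \<in> {-\<epsilon><..<\<epsilon>}" "p \<in> \<Omega>" for t p
    using var pt[OF that(2)] that by (auto simp: compact_variation_def H_def S2_def)
  have per: "H (t, p + (2 * pi) *\<^sub>R axis i 1) = H (t, p)" if "i \<noteq> 5" for t p i
    using chart_periodic[OF that] by (simp add: H_def)
  have C2: "Ck_on (Suc (Suc 0)) ({-\<epsilon><..<\<epsilon>} \<times> \<Omega>) H"
    using smooth by (simp only: smooth_on_def)
  have slice: "((\<lambda>p. H (t, p)) has_derivative (\<lambda>v. frechet_derivative H (at (t, p)) (0, v))) (at p)"
    if "t \<in> {-\<epsilon><..<\<epsilon>}" "p \<in> \<Omega>" for t p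
    by (rule slice_has_derivative[OF C2 that])
  have snd_K: "compact (snd ` K)" "snd ` K \<subseteq> I_dom"
    using K by (auto intro!: compact_continuous_image continuous_intros simp: points_def coords_V5 chart_map_V5)
  define P where "P j l r \<delta> \<longleftrightarrow> real j * pi/4 < l \<and> l < r \<and> \<delta> > 0 \<and> r + \<delta> < real (Suc j) * pi/4 \<and>
    (\<forall>s\<in>snd ` K. s \<in> {real j * pi/4<..<real (Suc j) * pi/4} \<longrightarrow> s \<in> {l + \<delta><..<r})" for j l r \<delta>
  have "\<exists>l r \<delta>. P j l r \<delta>" if "j < 4" for j
    unfolding P_def by (rule compact_subset_component[OF snd_K that]) blast
  then obtain l r \<delta> where P: "\<And>j. j < 4 \<Longrightarrow> P j (l j) (r j) (\<delta> j)"
    by metis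
  have lr: "\<And>j. j < 4 \<Longrightarrow> real j * pi/4 < l j" "\<And>j. j < 4 \<Longrightarrow> l j < r j"
    "\<And>j. j < 4 \<Longrightarrow> \<delta> j > 0" "\<And>j. j < 4 \<Longrightarrow> r j + \<delta> j < real (Suc j) * pi/4"
    and inK: "\<And>j s. j < 4 \<Longrightarrow> s \<in> snd ` K \<Longrightarrow> s \<in> {real j * pi/4<..<real (Suc j) * pi/4} \<Longrightarrow> s \<in> {l j + \<delta> j<..<r j}"
    using P unfolding P_def by blast+
  have comp: "{l j..r j + \<delta> j} \<subseteq> {real j * pi/4<..<real (Suc j) * pi/4}" if "j < 4" for j
    using lr[OF that] by auto
  then have comp_I: "{l j..r j + \<delta> j} \<subseteq> I_dom" if "j < 4" for j
    using that unfolding I_dom_eq by blast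
  define B where "B = (\<Union>j<4. angle_box (l j) (r j))"
  have box: "angle_box (l j) (r j) \<subseteq> \<Omega>" if "j < 4" for j
    using comp_I[OF that] lr(3)[OF that] by (auto simp: mem_angle_box)
  have B: "compact B" "B \<subseteq> \<Omega>"
    using box by (auto simp: B_def angle_box_def)
  have S\<Omega>: "S \<subseteq> \<Omega>"
    by (auto simp: S_def V5_def)
  have SB: "S \<subseteq> B"
  proof
    fix p assume p: "p \<in> S"
    then obtain j where j: "j < 4" "p $ 5 \<in> {real j * pi/4<..<real (Suc j) * pi/4}"
      using S\<Omega> unfolding I_dom_eq by blast
    have "snd (chart_map M p) \<in> snd ` K" using p by (auto simp: S_def)
    then have "p $ 5 \<in> {l j + \<delta> j<..<r j}"
      using inK[OF j(1) _ j(2)] by (simp add: chart_map_V5)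
    moreover have "0 \<le> p $ i \<and> p $ i \<le> 2 * pi" if "i \<noteq> 5" for i
      using p exhaust_5[of i] that by (auto simp: S_def V5_def less_imp_le)
    ultimately have "p \<in> angle_box (l j) (r j)"
      using lr(3)[OF j(1)] by (simp add: mem_angle_box)
    then show "p \<in> B" using j(1) by (auto simp: B_def)
  qed
  have closed_pre: "closed (chart_map M -` K)"
    using continuous_closed_vimage[OF compact_imp_closed[OF K(1)]] continuous_on_chart_map[of UNIV]
    by (metis continuous_on_eq_continuous_at open_UNIV UNIV_I)
  have S_borel: "S \<in> sets lborel"
  proof -
    have "S = fund M \<inter> chart_map M -` K" by (auto simp: S_def)
    then show ?thesis using fund_V5_borel borel_closed[OF closed_pre] by (simp add: sets.Int)
  qed
  have cont_e: "continuous_on \<Omega> (e t)" if "t \<in> {-\<epsilon><..<\<epsilon>}" for t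
  proof -
    have cont_H': "continuous_on \<Omega> (\<lambda>p. H' t p i)" for i
      unfolding H'_def using C2[THEN Ck_on_SucD] that by (rule slice_derivative_continuous)
    show ?thesis
      unfolding e_def by ((rule continuous_on_coefficients cont_H' | rule continuous_intros)+)
  qed
  have set_int: "set_integrable lborel S (e t)" if "t \<in> {-\<epsilon><..<\<epsilon>}" for t
  proof -
    have "set_integrable lborel B (e t)"
      unfolding set_integrable_def
      by (rule borel_integrable_compact[OF B(1) continuous_on_subset[OF cont_e[OF that] B(2)]])
    then show ?thesis using S_borel SB by (rule set_integrable_subset)
  qed
  have energy_eq: "energy M K (F t) = 1 / 2 * integral S (e t)" if t: "t \<in> {-\<epsilon><..<\<epsilon>}" for t
  proof -
    have "norm_diff_sq M (F t) p * sqrt (det (metric M p)) = e t p" if "p \<in> S" for p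
    proof -
      have p: "p \<in> \<Omega>" using that S\<Omega> by blast
      have "(\<lambda>p. H (t, p)) = F t \<circ> chart_map M" by (auto simp: H_def)
      then have "frechet_derivative (F t \<circ> chart_map M) (at p) = (\<lambda>v. frechet_derivative H (at (t, p)) (0, v))"
        using frechet_derivative_at[OF slice[OF t p]] by simp
      then show ?thesis
        unfolding norm_diff_sq_M[OF p] e_def H'_def by simp
    qed
    then have "(LINT p:S|lborel. norm_diff_sq M (F t) p * sqrt (det (metric M p))) = (LINT p:S|lborel. e t p)"
      using S_borel by (intro set_lebesgue_integral_cong) auto
    then show ?thesis
      unfolding energy_def S_def[symmetric] using set_borel_integral_eq_integral(2)[OF set_int[OF t]] by simp
  qed
  define d where "d t p = (\<Sum>i\<in>UNIV. c i (p $ 5) * ((norm (H' t p i))\<^sup>2 - (norm (H' 0 p i))\<^sup>2))" for t p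
  have d_eq: "d t p = e t p - e 0 p" for t p
    by (simp add: d_def e_def right_diff_distrib sum_subtractf)
  have zero_in: "0 \<in> {-\<epsilon><..<\<epsilon>}" using \<epsilon> by simp
  \<comment> \<open>\<open>K\<close> is closed, so near a point off \<open>K\<close> the maps at
    times t and 0 coincide, and with them their derivatives.\<close>
  have d_off: "d t p = 0" if t: "t \<in> {-\<epsilon><..<\<epsilon>}" and p: "p \<in> \<Omega>" "chart_map M p \<notin> K" for t p
  proof -
    have U: "open (\<Omega> - chart_map M -` K)"
      using open_\<Omega> closed_pre by (rule open_Diff)
    have "p \<in> \<Omega> - chart_map M -` K" using p by simp
    then have "((\<lambda>p. H (0, p)) has_derivative (\<lambda>v. frechet_derivative H (at (t, p)) (0, v))) (at p)"
    proof (rule has_derivative_transform_within_open[OF slice[OF t p(1)] U])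
      fix q assume "q \<in> \<Omega> - chart_map M -` K"
      then have q: "q \<in> \<Omega>" "chart_map M q \<notin> K" by auto
      show "H (t, q) = H (0, q)"
        unfolding off[OF t q] H0[OF q(1)] ..
    qed
    from fun_cong[OF has_derivative_unique[OF this slice[OF zero_in p(1)]]]
    have "H' t p i = H' 0 p i" for i
      unfolding H'_def .
    then show ?thesis by (simp add: d_def)
  qed
  have diff: "energy M K (F t) - energy M K (F 0) = 1 / 2 * (\<Sum>j<4. integral (angle_box (l j) (r j)) (d t))"
    if t: "t \<in> {-\<epsilon><..<\<epsilon>}" for t
  proof -
    note int = set_borel_integral_eq_integral(1)[OF set_int]
    have "energy M K (F t) - energy M K (F 0) = 1 / 2 * integral S (d t)"
      unfolding energy_eq[OF t] energy_eq[OF zero_in] d_eq[abs_def]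
      using integral_diff[OF int[OF t] int[OF zero_in]] by simp
    \<comment> \<open>A point of \<open>B\<close> outside \<open>S\<close> where \<open>d t\<close>
      is nonzero lies over \<open>K\<close>, so it misses the fundamental domain only by having some
      angle equal to 2 pi.\<close>
    also have "integral S (d t) = integral B (d t)"
    proof (rule integral_spike_set)
      show "negligible {p \<in> S - B. d t p \<noteq> 0}" using SB by (simp add: Diff_eq_empty_iff[THEN iffD2])
      have "{p \<in> B - S. d t p \<noteq> 0} \<subseteq> (\<Union>i\<in>UNIV. {p. p $ i = 2 * pi})"
      proof
        fix p assume p: "p \<in> {p \<in> B - S. d t p \<noteq> 0}"
        then have p\<Omega>: "p \<in> \<Omega>" using B by blast
        then have "chart_map M p \<in> K" using d_off[OF t] p by blast
        then have "p \<notin> fund M" using p by (simp add: S_def)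
        then obtain i where i: "i \<in> {1, 2, 3, 4}" "\<not> (0 \<le> p $ i \<and> p $ i < 2 * pi)"
          using p\<Omega> unfolding V5_def by auto
        moreover have "i \<noteq> 5" using i(1) by auto
        then have "0 \<le> p $ i \<and> p $ i \<le> 2 * pi"
          using p unfolding B_def by (auto simp: mem_angle_box)
        ultimately have "p $ i = 2 * pi" by linarith
        then show "p \<in> (\<Union>i\<in>UNIV. {p. p $ i = 2 * pi})" by blast
      qed
      moreover have "negligible {p :: real ^ 5. p $ i = 2 * pi}" for i
        using negligible_standard_hyperplane[of "axis i 1 :: real ^ 5" "2 * pi"]
        by (simp add: axis_in_Basis_iff inner_axis)
      then have "negligible (\<Union>i\<in>UNIV. {p :: real ^ 5. p $ i = 2 * pi})"
        by (intro negligible_Union) auto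
      ultimately show "negligible {p \<in> B - S. d t p \<noteq> 0}"
        by (rule negligible_subset[rotated])
    qed
    also have "(d t has_integral (\<Sum>j<4. integral (angle_box (l j) (r j)) (d t))) B"
      unfolding B_def
    proof (rule has_integral_UN)
      have "continuous_on \<Omega> (d t)"
        unfolding d_eq[abs_def] by (intro continuous_on_diff cont_e t zero_in)
      then show "(d t has_integral integral (angle_box (l j) (r j)) (d t)) (angle_box (l j) (r j))" if "j \<in> {..<4}" for j
        using box[of j] that unfolding angle_box_def
        by (intro integrable_integral integrable_continuous) (auto intro: continuous_on_subset)
      show "pairwise (\<lambda>i j. negligible (angle_box (l i) (r i) \<inter> angle_box (l j) (r j))) {..<4}"
      proof (rule pairwiseI)
        fix i j :: nat assume ij: "i \<in> {..<4}" "j \<in> {..<4}" "i \<noteq> j"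
        have "angle_box (l i) (r i) \<inter> angle_box (l j) (r j) = {}" if "i < j" "j < 4" for i j :: nat
        proof -
          have "real (Suc i) * pi \<le> real j * pi" using that by (intro mult_right_mono) auto
          then have "r i < l j" using lr(1)[of j] lr(3,4)[of i] that by (simp add: field_simps)
          then show ?thesis by (auto simp: mem_angle_box)
        qed
        from this[of i j] this[of j i] ij
        have "angle_box (l i) (r i) \<inter> angle_box (l j) (r j) = {}" by (cases "i < j") auto
        then show "negligible (angle_box (l i) (r i) \<inter> angle_box (l j) (r j))" by simp
      qed
    qed simp
    then have "integral B (d t) = (\<Sum>j<4. integral (angle_box (l j) (r j)) (d t))"
      by (rule integral_unique)
    finally show ?thesis .
  qed
  have "\<exists>C. \<forall>t. \<bar>t\<bar> \<le> \<epsilon>/2 \<longrightarrow> \<bar>integral (angle_box (l j) (r j)) (d t)\<bar> \<le> C * t\<^sup>2" if j: "j < 4" for j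
  proof -
    have "H (t, p) = f p" if t: "t \<in> {-\<epsilon><..<\<epsilon>}" and p: "p $ 5 \<in> {l j..l j + \<delta> j} \<union> {r j..r j + \<delta> j}" for t p
    proof -
      have s: "p $ 5 \<in> {l j..r j + \<delta> j}" using p lr(2,3)[OF j] by auto
      \<comment> \<open>Inside this component the s-values of \<open>K\<close> lie strictly between
        the two collars.\<close>
      have "p $ 5 \<notin> snd ` K"
        using inK[OF j, of "p $ 5"] comp[OF j] s p by fastforce
      then have "chart_map M p \<notin> K" by (metis chart_map_V5 image_eqI snd_conv)
      then show ?thesis using off[OF t] comp_I[OF j] s by auto
    qed
    from box_estimate[OF smooth \<epsilon> H0 per unit lr(2,3)[OF j] comp_I[OF j] this]
    obtain C where "\<bar>integral (angle_box (l j) (r j)) (d t)\<bar> \<le> C * t\<^sup>2" if "\<bar>t\<bar> \<le> \<epsilon>/2" for t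
      unfolding d_def[abs_def] H'_def by blast
    then show ?thesis by blast
  qed
  then obtain C where C: "\<And>j t. j < 4 \<Longrightarrow> \<bar>t\<bar> \<le> \<epsilon>/2 \<Longrightarrow> \<bar>integral (angle_box (l j) (r j)) (d t)\<bar> \<le> C j * t\<^sup>2"
    by metis
  show "((\<lambda>t. energy M K (F t)) has_real_derivative 0) (at 0)"
  proof (rule has_real_derivative_zero_quadratic)
    show "\<epsilon>/2 > 0" using \<epsilon> by simp
    fix t assume t: "\<bar>t\<bar> \<le> \<epsilon>/2"
    then have "t \<in> {-\<epsilon><..<\<epsilon>}" using \<epsilon> by auto
    from diff[OF this] have "\<bar>energy M K (F t) - energy M K (F 0)\<bar> =
        1 / 2 * \<bar>\<Sum>j<4. integral (angle_box (l j) (r j)) (d t)\<bar>"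
      by linarith
    also have "\<dots> \<le> 1 / 2 * (\<Sum>j<4. C j * t\<^sup>2)"
      using C t by (intro mult_left_mono order_trans[OF sum_abs] sum_mono) auto
    finally show "\<bar>energy M K (F t) - energy M K (F 0)\<bar> \<le> 1 / 2 * (\<Sum>j<4. C j) * t\<^sup>2"
      by (simp add: sum_distrib_right)
  qed
qed

end

section \<open>Horizontal conformality\<close>

text \<open>Differentiating |\<gamma>|^2 = 1 gives one inclusion; for the other, a great circle
  traversed with speed |v| has velocity v.\<close>

lemma tangent_space_sphere:
  fixes y :: "'b::euclidean_space"
  assumes y: "norm y = 1"
  shows "tangent_space (sphere 0 1) y = {v. y \<bullet> v = 0}"
proof (intro equalityI subsetI)
  fix v assume "v \<in> tangent_space (sphere 0 1) y"
  then obtain \<epsilon> \<gamma> where \<epsilon>: "\<epsilon> > 0" and im: "\<gamma> ` {-\<epsilon><..<\<epsilon>} \<subseteq> sphere 0 1" and "\<gamma> 0 = y"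
    and d: "(\<gamma> has_vector_derivative v) (at 0)"
    unfolding tangent_space_def by blast
  have "((\<lambda>t. \<gamma> t \<bullet> \<gamma> t) has_real_derivative 2 * (y \<bullet> v)) (at 0)"
    using bounded_bilinear.has_vector_derivative[OF bounded_bilinear_inner d d] \<open>\<gamma> 0 = y\<close>
    by (simp add: has_real_derivative_iff_has_vector_derivative inner_commute)
  moreover have "((\<lambda>t. \<gamma> t \<bullet> \<gamma> t) has_real_derivative 0) (at 0)"
  proof (rule has_field_derivative_transform_within_open[of "\<lambda>t. 1" _ _ "{-\<epsilon><..<\<epsilon>}"])
    fix t assume "t \<in> {-\<epsilon><..<\<epsilon>}"
    then have "\<gamma> t \<in> sphere 0 1" using im by blast
    then have "norm (\<gamma> t) = 1" by simp
    then show "1 = \<gamma> t \<bullet> \<gamma> t" by (simp add: norm_eq_1)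
  qed (use \<epsilon> in auto)
  ultimately have "2 * (y \<bullet> v) = 0" by (rule DERIV_unique)
  then show "v \<in> {v. y \<bullet> v = 0}" by simp
next
  fix v assume v: "v \<in> {v. y \<bullet> v = 0}"
  define c where "c = norm v"
  \<comment> \<open>For v = 0 this is 0 by the convention for division, and the curve below is
    constant.\<close>
  define w where "w = v /\<^sub>R c"
  define \<gamma> where "\<gamma> t = cos (c * t) *\<^sub>R y + sin (c * t) *\<^sub>R w" for t
  have yw: "y \<bullet> w = 0" "w \<bullet> y = 0" using v by (simp_all add: w_def inner_commute)
  have ww: "c = 0 \<or> w \<bullet> w = 1"
    by (auto simp: w_def c_def dot_square_norm power2_eq_square divide_simps)
  have "smooth_on {-1<..<1} \<gamma>"
    unfolding smooth_on_def
  proof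
    fix k
    have "Ck_on k {-1<..<1} (\<lambda>t. c * t)"
      by (intro Ck_on_mult Ck_on_const Ck_on_id) auto
    then have "Ck_on k {-1<..<1} (\<lambda>t. sin (c * t))" "Ck_on k {-1<..<1} (\<lambda>t. cos (c * t))"
      using Ck_on_sin_cos[of "{-1<..<1}" k "\<lambda>t. c * t"] by auto
    then show "Ck_on k {-1<..<1} \<gamma>"
      unfolding \<gamma>_def
      by (intro Ck_on_add Ck_on_linear_comp[OF _ bounded_linear_scaleR_left]) auto
  qed
  moreover have "norm (\<gamma> t) = 1" for t
  proof -
    have "\<gamma> t \<bullet> \<gamma> t = (cos (c * t))\<^sup>2 + (sin (c * t))\<^sup>2 * (w \<bullet> w)"
      using y by (simp add: \<gamma>_def inner_add_left inner_add_right yw norm_eq_1 power2_eq_square)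
    also have "\<dots> = 1" using ww by auto
    finally show ?thesis by (simp add: norm_eq_1)
  qed
  then have "\<gamma> ` {-1<..<1} \<subseteq> sphere 0 1" by auto
  moreover have "\<gamma> 0 = y" by (simp add: \<gamma>_def)
  moreover have "(\<gamma> has_vector_derivative v) (at 0)"
  proof -
    have "((\<lambda>t. cos (c * t)) has_real_derivative 0) (at 0)" "((\<lambda>t. sin (c * t)) has_real_derivative c) (at 0)"
      by (auto intro!: derivative_eq_intros)
    then have "(\<gamma> has_vector_derivative 0 *\<^sub>R y + c *\<^sub>R w) (at 0)"
      unfolding \<gamma>_def[abs_def]
      by (intro has_vector_derivative_add)
        (auto dest!: has_vector_derivative_scaleR[OF _ has_vector_derivative_const])
    moreover have "0 *\<^sub>R y + c *\<^sub>R w = v"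
      by (cases "v = 0") (simp_all add: w_def c_def)
    ultimately show ?thesis by metis
  qed
  ultimately show "v \<in> tangent_space (sphere 0 1) y"
    unfolding tangent_space_def by (auto intro!: exI[of _ 1] exI[of _ \<gamma>])
qed

context torus_profile
begin

lemma frame_expansion: "v = (v \<bullet> T p) *\<^sub>R T p + (v \<bullet> N p) *\<^sub>R N p + (v \<bullet> f p) *\<^sub>R f p"
proof -
  let ?c = "cos (\<kappa> \<bullet> p)" and ?s = "sin (\<kappa> \<bullet> p)" and ?a = "cos (\<alpha> (p $ 5))" and ?b = "sin (\<alpha> (p $ 5))"
  have 1: "?c * ?c + ?s * ?s = 1" "?a * ?a + ?b * ?b = 1"
    by (simp_all flip: power2_eq_square)
  obtain x y r where v: "v = (Complex x y, r)"
    by (metis complex_surj surj_pair)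
  have "x = (y * ?c - x * ?s) * - ?s + (x * (?a * ?c) + y * (?a * ?s) - r * ?b) * (?a * ?c) +
      (x * (?b * ?c) + y * (?b * ?s) + r * ?a) * (?b * ?c)"
    "y = (y * ?c - x * ?s) * ?c + (x * (?a * ?c) + y * (?a * ?s) - r * ?b) * (?a * ?s) +
      (x * (?b * ?c) + y * (?b * ?s) + r * ?a) * (?b * ?s)"
    "r = (x * (?a * ?c) + y * (?a * ?s) - r * ?b) * - ?b + (x * (?b * ?c) + y * (?b * ?s) + r * ?a) * ?a"
    using 1 by algebra+
  then show ?thesis
    unfolding v T_def N_def f_def
    by (simp add: prod_eq_iff complex_eq_iff inner_prod_def inner_complex_def)
qed

lemma metric_form_M: "metric_form M p X Y = (\<Sum>i\<in>UNIV. g (p $ 5) $ i * X $ i * Y $ i)"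
proof -
  have "(\<Sum>j\<in>UNIV. (if i = j then g (p $ 5) $ i else 0) * Y $ j) = g (p $ 5) $ i * Y $ i" for i
  proof -
    have "(\<Sum>j\<in>UNIV. (if i = j then g (p $ 5) $ i else 0) * Y $ j) = (\<Sum>j\<in>UNIV. if j = i then g (p $ 5) $ i * Y $ i else 0)"
      by (rule sum.cong) auto
    then show ?thesis by simp
  qed
  then show ?thesis
    by (simp add: metric_form_def metric_M matrix_vector_mult_def inner_vec_def mult_ac)
qed

lemma diff_at_\<phi>:
  assumes "p \<in> \<Omega>"
  shows "diff_at M \<phi> p = (\<lambda>v. (sin (\<alpha> (p $ 5)) * (\<kappa> \<bullet> v)) *\<^sub>R T p + (\<alpha>' (p $ 5) * v $ 5) *\<^sub>R N p)"
  unfolding diff_at_def \<phi>_comp_chart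
  using frechet_derivative_at[OF f_has_derivative] assms by simp

text \<open>As sin \<alpha> and \<alpha>' do not vanish, the kernel of the differential consists of
  the Y with \<open>\<kappa> \<bullet> Y = 0\<close> and \<open>Y $ 5 = 0\<close>. Orthogonality to
  it leaves the s-component of X free and makes the angular covector of X proportional to
  \<kappa>.\<close>

lemma horizontal_\<phi>:
  assumes p: "p \<in> \<Omega>"
  shows "X \<in> horizontal_space M \<phi> p \<longleftrightarrow> (\<exists>m. \<forall>i. i \<noteq> 5 \<longrightarrow> g (p $ 5) $ i * X $ i = m * \<kappa> $ i)"
    (is "_ \<longleftrightarrow> ?R")
proof
  assume X: "X \<in> horizontal_space M \<phi> p"
  have "g (p $ 5) $ i * X $ i = (g (p $ 5) $ 1 * X $ 1 / \<kappa> $ 1) * \<kappa> $ i" if i: "i \<noteq> 5" for i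
  proof -
    \<comment> \<open>For varying i these vectors span the kernel of the differential.\<close>
    define Y where "Y = \<kappa> $ 1 *\<^sub>R axis i (1::real) - \<kappa> $ i *\<^sub>R axis 1 1"
    have "diff_at M \<phi> p Y = 0"
      using i by (simp add: diff_at_\<phi>[OF p] Y_def inner_diff_right inner_axis)
    then have "metric_form M p X Y = 0"
      using X by (simp add: horizontal_space_def)
    moreover have "metric_form M p X Y = (\<chi> j. g (p $ 5) $ j * X $ j) \<bullet> Y"
      by (simp add: metric_form_M inner_vec_def)
    ultimately have "\<kappa> $ 1 * (g (p $ 5) $ i * X $ i) = \<kappa> $ i * (g (p $ 5) $ 1 * X $ 1)"
      by (simp add: Y_def inner_diff_right inner_axis)
    then show ?thesis using \<kappa>_neq_0[of 1] by (simp add: field_simps)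
  qed
  then show ?R by blast
next
  assume ?R
  then obtain m where m: "\<And>i. i \<noteq> 5 \<Longrightarrow> g (p $ 5) $ i * X $ i = m * \<kappa> $ i" by blast
  show "X \<in> horizontal_space M \<phi> p"
    unfolding horizontal_space_def
  proof (intro CollectI allI impI)
    fix Y assume "diff_at M \<phi> p Y = 0"
    then have 0: "(sin (\<alpha> (p $ 5)) * (\<kappa> \<bullet> Y)) *\<^sub>R T p + (\<alpha>' (p $ 5) * Y $ 5) *\<^sub>R N p = 0"
      by (simp add: diff_at_\<phi>[OF p])
    from arg_cong[OF 0, of "\<lambda>v. v \<bullet> T p"] arg_cong[OF 0, of "\<lambda>v. v \<bullet> N p"]
    have "\<kappa> \<bullet> Y = 0" "Y $ 5 = 0"
      using sin_\<alpha> \<alpha>'_neq_0 p by (simp_all add: inner_add_left)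
    then have "metric_form M p X Y = (\<Sum>i\<in>UNIV. m * (\<kappa> $ i * Y $ i))"
      unfolding metric_form_M using m by (intro sum.cong refl) (metis mult.assoc mult_zero_right)
    then show "metric_form M p X Y = 0"
      using \<open>\<kappa> \<bullet> Y = 0\<close> by (simp add: inner_vec_def flip: sum_distrib_left)
  qed
qed

text \<open>The factor m of the horizontal vector X is \<open>(\<kappa> \<bullet> X) / Q\<close>, by
  summing the proportionality relation against \<kappa>.\<close>

lemma horizontal_metric:
  assumes p: "p \<in> \<Omega>" and X: "X \<in> horizontal_space M \<phi> p"
  shows "metric_form M p X Y = (\<kappa> \<bullet> X) * (\<kappa> \<bullet> Y) / Q (p $ 5) + (h (p $ 5))\<^sup>2 * X $ 5 * Y $ 5"
proof -
  obtain m where m: "\<And>i. i \<noteq> 5 \<Longrightarrow> g (p $ 5) $ i * X $ i = m * \<kappa> $ i"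
    using X unfolding horizontal_\<phi>[OF p] by blast
  have gp: "g (p $ 5) $ i > 0" for i using g_pos p by simp
  have Xi: "\<kappa> $ i * X $ i = m * ((\<kappa> $ i)\<^sup>2 / g (p $ 5) $ i)" for i
    using m[of i] gp[of i] by (cases "i = 5") (auto simp: field_simps power2_eq_square)
  have kX: "\<kappa> \<bullet> X = m * Q (p $ 5)"
    using sum_\<kappa>_sq[of "p $ 5"] p
    unfolding inner_vec_def inner_real_def Xi sum_distrib_left[symmetric] by simp
  have Q: "Q (p $ 5) \<noteq> 0" using sin_4_neq_0 p by (simp add: Q_def)
  have "metric_form M p X Y = (\<Sum>i\<in>UNIV. m * (\<kappa> $ i * Y $ i) + (if i = 5 then (h (p $ 5))\<^sup>2 * X $ 5 * Y $ 5 else 0))"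
    unfolding metric_form_M
  proof (intro sum.cong refl)
    fix i show "g (p $ 5) $ i * X $ i * Y $ i = m * (\<kappa> $ i * Y $ i) + (if i = 5 then (h (p $ 5))\<^sup>2 * X $ 5 * Y $ 5 else 0)"
      using m[of i] by (cases "i = 5") (auto simp: g_def mult.assoc)
  qed
  also have "\<dots> = m * (\<kappa> \<bullet> Y) + (h (p $ 5))\<^sup>2 * X $ 5 * Y $ 5"
    by (simp add: sum.distrib inner_vec_def flip: sum_distrib_left)
  finally show ?thesis
    using Q by (simp add: kX)
qed

text \<open>The squared stretching is (sin \<alpha>)^2 Q along the phase and (\<alpha>' / h)^2 along
  s, and these agree by \<open>\<alpha>'_sq\<close>. The differential has rank two everywhere, so
  the second alternative always holds.\<close>

lemma horizontally_weakly_conformal_\<phi>: "horizontally_weakly_conformal M S2 \<phi>"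
  unfolding horizontally_weakly_conformal_def
proof (intro ballI disjI2 conjI)
  fix p assume "p \<in> coords M"
  then have p: "p \<in> \<Omega>" by (simp add: coords_V5)
  let ?s = "p $ 5"
  have nz: "sin (\<alpha> ?s) \<noteq> 0" "\<alpha>' ?s \<noteq> 0" "Q ?s > 0"
    using sin_\<alpha> \<alpha>'_neq_0 sin_4_neq_0 p by (simp_all add: Q_def)
  have gp: "g ?s $ i \<noteq> 0" for i using g_pos[of ?s i] p by simp
  have "diff_at M \<phi> p ` horizontal_space M \<phi> p = {v. f p \<bullet> v = 0}"
  proof (intro equalityI subsetI)
    fix v assume "v \<in> diff_at M \<phi> p ` horizontal_space M \<phi> p"
    then show "v \<in> {v. f p \<bullet> v = 0}"
      by (auto simp: diff_at_\<phi>[OF p] inner_add_right)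
  next
    fix v assume v: "v \<in> {v. f p \<bullet> v = 0}"
    \<comment> \<open>Solves sin \<alpha> \<open>(\<kappa> \<bullet> X)\<close> =
      \<open>v \<bullet> T p\<close>, given that the vector X below has
      \<open>\<kappa> \<bullet> X\<close> = m Q.\<close>
    define m where "m = (v \<bullet> T p) / (sin (\<alpha> ?s) * Q ?s)"
    define X :: "real ^ 5" where "X = (\<chi> i. if i = 5 then (v \<bullet> N p) / \<alpha>' ?s else m * \<kappa> $ i / g ?s $ i)"
    have "X \<in> horizontal_space M \<phi> p"
      unfolding horizontal_\<phi>[OF p] by (rule exI[of _ m]) (simp add: X_def gp)
    moreover have "\<kappa> \<bullet> X = (\<Sum>i\<in>UNIV. m * ((\<kappa> $ i)\<^sup>2 / g ?s $ i))"
      unfolding inner_vec_def by (intro sum.cong refl) (auto simp: X_def power2_eq_square)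
    then have "\<kappa> \<bullet> X = m * Q ?s"
      using sum_\<kappa>_sq[of ?s] p unfolding sum_distrib_left[symmetric] by simp
    then have "diff_at M \<phi> p X = (v \<bullet> T p) *\<^sub>R T p + (v \<bullet> N p) *\<^sub>R N p"
      using nz by (simp add: diff_at_\<phi>[OF p] m_def X_def)
    then have "diff_at M \<phi> p X = v"
      using frame_expansion[of v p] v by (simp add: inner_commute)
    ultimately show "v \<in> diff_at M \<phi> p ` horizontal_space M \<phi> p" by blast
  qed
  then show "diff_at M \<phi> p ` horizontal_space M \<phi> p = tangent_space S2 (\<phi> (chart_map M p))"
    unfolding S2_def \<phi>_chart tangent_space_sphere[OF norm_f] .
  show "\<exists>\<Lambda>>0. \<forall>X\<in>horizontal_space M \<phi> p. \<forall>Y\<in>horizontal_space M \<phi> p.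
      \<Lambda> * metric_form M p X Y = diff_at M \<phi> p X \<bullet> diff_at M \<phi> p Y"
  proof (intro exI[of _ "(sin (\<alpha> ?s))\<^sup>2 * Q ?s"] conjI ballI)
    show "0 < (sin (\<alpha> ?s))\<^sup>2 * Q ?s" using nz by simp
    fix X Y assume X: "X \<in> horizontal_space M \<phi> p"
    have "diff_at M \<phi> p X \<bullet> diff_at M \<phi> p Y = (sin (\<alpha> ?s))\<^sup>2 * (\<kappa> \<bullet> X) * (\<kappa> \<bullet> Y) + (\<alpha>' ?s)\<^sup>2 * X $ 5 * Y $ 5"
      by (simp add: diff_at_\<phi>[OF p] inner_add_left inner_add_right power2_eq_square)
    also have "\<dots> = (sin (\<alpha> ?s))\<^sup>2 * Q ?s * metric_form M p X Y"
      using nz p by (simp add: horizontal_metric[OF p X] \<alpha>'_sq field_simps)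
    finally show "(sin (\<alpha> ?s))\<^sup>2 * Q ?s * metric_form M p X Y = diff_at M \<phi> p X \<bullet> diff_at M \<phi> p Y" ..
  qed
qed

end

section \<open>The continuous extension\<close>

definition embed_coords :: "real \<Rightarrow> real \<Rightarrow> real \<Rightarrow> real \<Rightarrow> real ^ 5 \<Rightarrow> complex ^ 4" where
  "embed_coords a1 a2 a3 a4 p = V5_embed a1 a2 a3 a4 (chart_map (V5 a1 a2 a3 a4) p)"

lemma embed_coords_nth:
  "embed_coords a1 a2 a3 a4 p $ 1 = of_real (a1 * sin (p $ 5)) * cis (p $ 1)"
  "embed_coords a1 a2 a3 a4 p $ 2 = of_real (a2 * sin (p $ 5 + pi/4)) * cis (p $ 2)"
  "embed_coords a1 a2 a3 a4 p $ 3 = of_real (a3 * cos (p $ 5)) * cis (p $ 3)"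
  "embed_coords a1 a2 a3 a4 p $ 4 = of_real (a4 * cos (p $ 5 + pi/4)) * cis (p $ 4)"
  by (simp_all add: embed_coords_def V5_embed_def chart_map_V5)

lemma continuous_on_embed_coords: "continuous_on A (embed_coords a1 a2 a3 a4)"
proof -
  have "continuous_on A (\<lambda>p. embed_coords a1 a2 a3 a4 p $ i)" for i
    using exhaust_4[of i]
    by (elim disjE; simp only: embed_coords_nth; intro continuous_intros)
  then have "continuous_on A (\<lambda>p. \<chi> i. embed_coords a1 a2 a3 a4 p $ i)"
    by (rule continuous_on_vec_lambda)
  then show ?thesis by simp
qed

text \<open>The radius x is a sine or cosine of s and may be negative; its sign is absorbed into the
  angle, which is arbitrary when x = 0.\<close>

lemma polar_with_signed_radius:
  fixes z :: complex
  assumes "a > 0" "(cmod z)\<^sup>2 / a\<^sup>2 = x\<^sup>2"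
  obtains \<theta> where "0 \<le> \<theta>" "\<theta> \<le> 2 * pi" "z = of_real (a * x) * cis \<theta>"
proof (cases "x = 0")
  case True
  then have "z = 0" using assms by simp
  then show ?thesis using that[of 0] True by simp
next
  case False
  have "(cmod z)\<^sup>2 = (a * x)\<^sup>2" using assms by (simp add: field_simps power_mult_distrib)
  from arg_cong[OF this, of sqrt] have "cmod (z / of_real (a * x)) = 1"
    using False assms by (simp add: norm_divide norm_mult abs_mult)
  then have "(Re (z / of_real (a * x)))\<^sup>2 + (Im (z / of_real (a * x)))\<^sup>2 = 1"
    by (simp only: cmod_power2[symmetric]) simp
  from sincos_total_2pi[OF this] obtain \<theta> where \<theta>: "0 \<le> \<theta>" "\<theta> < 2 * pi"
    "Re (z / of_real (a * x)) = cos \<theta>" "Im (z / of_real (a * x)) = sin \<theta>"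
    by blast
  have "z / of_real (a * x) = cis \<theta>"
    using \<theta>(3,4) by (simp only: complex_eq_iff cis.sel)
  then have "z = of_real (a * x) * cis \<theta>"
    using False assms by (simp add: field_simps)
  then show ?thesis using that \<theta> by simp
qed

text \<open>In terms of the differences X and Y the third equation is a unit circle, and its angle t
  is 2s; the first two equations then recover each modulus by the half-angle formulas.\<close>

lemma Vstar_covered:
  assumes a: "a1 > 0" "a2 > 0" "a3 > 0" "a4 > 0" and z: "z \<in> Vstar a1 a2 a3 a4"
  shows "z \<in> embed_coords a1 a2 a3 a4 ` angle_box 0 pi"
proof -
  define X where "X = (cmod (z $ 3))\<^sup>2 / a3\<^sup>2 - (cmod (z $ 1))\<^sup>2 / a1\<^sup>2"
  define Y where "Y = (cmod (z $ 4))\<^sup>2 / a4\<^sup>2 - (cmod (z $ 2))\<^sup>2 / a2\<^sup>2"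
  have eqs: "(cmod (z $ 1))\<^sup>2 / a1\<^sup>2 + (cmod (z $ 3))\<^sup>2 / a3\<^sup>2 = 1"
    "(cmod (z $ 2))\<^sup>2 / a2\<^sup>2 + (cmod (z $ 4))\<^sup>2 / a4\<^sup>2 = 1" "X\<^sup>2 + (- Y)\<^sup>2 = 1"
    using z unfolding power2_minus by (simp_all add: Vstar_def X_def Y_def)
  \<comment> \<open>The sign of Y comes from cos (2 (s + pi/4)) = - sin 2s.\<close>
  obtain t where t: "0 \<le> t" "t < 2 * pi" "X = cos t" "- Y = sin t"
    using sincos_total_2pi[OF eqs(3)] by blast
  define s where "s = t / 2"
  have "X = 1 - 2 * (sin s)\<^sup>2" "X = 2 * (cos s)\<^sup>2 - 1"
    using t(3) cos_double_sin[of s] cos_double_cos[of s] by (simp_all add: s_def)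
  moreover have "Y = cos (2 * (s + pi/4))"
    using t(4) by (simp add: s_def distrib_left cos_add)
  then have "Y = 1 - 2 * (sin (s + pi/4))\<^sup>2" "Y = 2 * (cos (s + pi/4))\<^sup>2 - 1"
    using cos_double_sin[of "s + pi/4"] cos_double_cos[of "s + pi/4"] by simp_all
  ultimately have sq: "(cmod (z $ 1))\<^sup>2 / a1\<^sup>2 = (sin s)\<^sup>2" "(cmod (z $ 2))\<^sup>2 / a2\<^sup>2 = (sin (s + pi/4))\<^sup>2"
    "(cmod (z $ 3))\<^sup>2 / a3\<^sup>2 = (cos s)\<^sup>2" "(cmod (z $ 4))\<^sup>2 / a4\<^sup>2 = (cos (s + pi/4))\<^sup>2"
    using eqs(1,2) unfolding X_def Y_def by linarith+
  obtain \<theta>1 where 1: "0 \<le> \<theta>1" "\<theta>1 \<le> 2 * pi" "z $ 1 = of_real (a1 * sin s) * cis \<theta>1"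
    using polar_with_signed_radius[OF a(1) sq(1)] by blast
  obtain \<theta>2 where 2: "0 \<le> \<theta>2" "\<theta>2 \<le> 2 * pi" "z $ 2 = of_real (a2 * sin (s + pi/4)) * cis \<theta>2"
    using polar_with_signed_radius[OF a(2) sq(2)] by blast
  obtain \<theta>3 where 3: "0 \<le> \<theta>3" "\<theta>3 \<le> 2 * pi" "z $ 3 = of_real (a3 * cos s) * cis \<theta>3"
    using polar_with_signed_radius[OF a(3) sq(3)] by blast
  obtain \<theta>4 where 4: "0 \<le> \<theta>4" "\<theta>4 \<le> 2 * pi" "z $ 4 = of_real (a4 * cos (s + pi/4)) * cis \<theta>4"
    using polar_with_signed_radius[OF a(4) sq(4)] by blast
  let ?p = "vector [\<theta>1, \<theta>2, \<theta>3, \<theta>4, s] :: real ^ 5"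
  have "z = embed_coords a1 a2 a3 a4 ?p"
    unfolding vec_eq_iff forall_4 embed_coords_nth vector_5_nth using 1 2 3 4 by blast
  moreover have "?p \<in> angle_box 0 pi"
    using 1 2 3 4 t by (simp add: mem_angle_box forall_5 s_def)
  ultimately show ?thesis by blast
qed

context torus_profile
begin

text \<open>On \<open>{0..pi}\<close> the embedding determines \<open>s\<close> except that the ends are glued, and it determines
  the angles except where \<open>sin (\<alpha> s) = 0\<close>.\<close>

lemma f_constant_on_fibres:
  assumes ends: "\<And>j. j \<le> 4 \<Longrightarrow> \<alpha> (real j * pi/4) = real j * pi"
    and p: "p \<in> angle_box 0 pi" and q: "q \<in> angle_box 0 pi"
    and eq: "embed_coords a1 a2 a3 a4 p = embed_coords a1 a2 a3 a4 q"
  shows "f p = f q"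
proof -
  have sq: "(sin (p $ 5))\<^sup>2 = (sin (q $ 5))\<^sup>2" "(sin (p $ 5 + pi/4))\<^sup>2 = (sin (q $ 5 + pi/4))\<^sup>2"
  proof -
    have "cmod (embed_coords a1 a2 a3 a4 p $ i) = cmod (embed_coords a1 a2 a3 a4 q $ i)" for i
      using eq by simp
    from this[of 1] this[of 2]
    show "(sin (p $ 5))\<^sup>2 = (sin (q $ 5))\<^sup>2" "(sin (p $ 5 + pi/4))\<^sup>2 = (sin (q $ 5 + pi/4))\<^sup>2"
      unfolding embed_coords_nth using a_pos by (simp_all add: norm_mult abs_eq_iff power2_eq_iff)
  qed
  \<comment> \<open>The squared sines determine cos 2s and, through the shift by pi/4, sin 2s; so s
    is determined modulo pi.\<close>
  have "cos (2 * (p $ 5 + pi/4)) = cos (2 * (q $ 5 + pi/4))" "cos (2 * p $ 5) = cos (2 * q $ 5)"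
    unfolding cos_double_sin sq by (rule refl)+
  moreover have "cos (2 * (x + pi/4)) = - sin (2 * x)" for x :: real
    by (simp add: distrib_left cos_add)
  ultimately have cs: "cos (2 * p $ 5) = cos (2 * q $ 5)" "sin (2 * p $ 5) = sin (2 * q $ 5)"
    by simp_all
  have bounds: "0 \<le> p $ 5" "p $ 5 \<le> pi" "0 \<le> q $ 5" "q $ 5 \<le> pi"
    using p q by (auto simp: mem_angle_box)
  have s: "p $ 5 = q $ 5 \<or> {p $ 5, q $ 5} = {0, pi}"
  proof -
    obtain n :: int where n: "2 * p $ 5 = 2 * q $ 5 + 2 * pi * n"
      using cs sin_cos_eq_iff[of "2 * p $ 5" "2 * q $ 5"] by blast
    then have n': "p $ 5 = q $ 5 + pi * n" by simp
    have "pi * real_of_int n \<le> pi * 1" "pi * (-1) \<le> pi * real_of_int n"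
      using n' bounds by linarith+
    then have "real_of_int n \<le> 1" "-1 \<le> real_of_int n"
      using mult_le_cancel_left_pos[OF pi_gt_zero] by blast+
    then have "n = -1 \<or> n = 0 \<or> n = 1" by linarith
    then show ?thesis
      using n' bounds by auto
  qed
  \<comment> \<open>At the multiples of pi/4 the value is a pole of the sphere, whatever the angles
    are.\<close>
  have special: "f x = (0, cos (real j * pi))" if "x $ 5 = real j * pi/4" "j \<le> 4" for x j
    unfolding f_def that(1) ends[OF that(2)] by simp
  show ?thesis
  proof (cases "p $ 5 \<in> I_dom")
    case True
    have "0 \<notin> I_dom" "pi \<notin> I_dom" by (auto simp: I_dom_def)
    then have s: "p $ 5 = q $ 5" using s True by (auto simp: doubleton_eq_iff)
    have nz: "of_real (a1 * sin (q $ 5)) \<noteq> (0::complex)" "of_real (a2 * sin (q $ 5 + pi/4)) \<noteq> (0::complex)"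
      "of_real (a3 * cos (q $ 5)) \<noteq> (0::complex)" "of_real (a4 * cos (q $ 5 + pi/4)) \<noteq> (0::complex)"
      using trig_neq_0[OF True] a_pos by (simp_all add: s)
    have "embed_coords a1 a2 a3 a4 p $ i = embed_coords a1 a2 a3 a4 q $ i" for i
      using eq by simp
    from this[of 1] this[of 2] this[of 3] this[of 4]
    have "cis (p $ 1) = cis (q $ 1)" "cis (p $ 2) = cis (q $ 2)" "cis (p $ 3) = cis (q $ 3)" "cis (p $ 4) = cis (q $ 4)"
      unfolding embed_coords_nth s using nz by (simp_all only: mult_cancel_left simp_thms)
    then have "chart_map M p = chart_map M q"
      by (simp add: chart_map_V5 s)
    then show ?thesis using \<phi>_chart by metis
  next
    case False
    have "\<exists>j\<in>{0, 1, 2, 3, 4 :: nat}. p $ 5 = real j * pi/4"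
      using False bounds by (auto simp: I_dom_def)
    then obtain j where j: "j \<le> 4" "p $ 5 = real j * pi/4" by force
    show ?thesis
    proof (cases "p $ 5 = q $ 5")
      case True
      then show ?thesis using special[OF j(2,1)] special[of q j] j by simp
    next
      case False
      then have "(p $ 5 = 0 \<and> q $ 5 = pi) \<or> (p $ 5 = pi \<and> q $ 5 = 0)"
        using s by (auto simp: doubleton_eq_iff)
      then show ?thesis
        using special[of p 0] special[of p 4] special[of q 0] special[of q 4] by auto
    qed
  qed
qed

text \<open>The extension picks any preimage in the coordinate box; constancy on fibres makes the
  value independent of the choice, and compactness of the box gives continuity.\<close>

lemma continuous_extension:
  assumes ends: "\<And>j. j \<le> 4 \<Longrightarrow> \<alpha> (real j * pi/4) = real j * pi" and cont: "continuous_on UNIV \<alpha>"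
  shows "\<exists>\<Phi>. continuous_on (Vstar a1 a2 a3 a4) \<Phi> \<and> \<Phi> ` Vstar a1 a2 a3 a4 \<subseteq> S2 \<and>
    (\<forall>x\<in>points M. \<Phi> (V5_embed a1 a2 a3 a4 x) = \<phi> x)"
proof -
  let ?q = "embed_coords a1 a2 a3 a4" and ?K = "angle_box 0 pi"
  define \<Phi> where "\<Phi> z = f (SOME p. p \<in> ?K \<and> ?q p = z)" for z
  have \<Phi>: "\<Phi> (?q p) = f p" if "p \<in> ?K" for p
  proof -
    have "(SOME p'. p' \<in> ?K \<and> ?q p' = ?q p) \<in> ?K \<and> ?q (SOME p'. p' \<in> ?K \<and> ?q p' = ?q p) = ?q p"
      by (rule someI[of _ p]) (use that in simp)
    then show ?thesis
      unfolding \<Phi>_def using f_constant_on_fibres[OF ends _ that] by blast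
  qed
  have "continuous_on ?K f"
    unfolding f_def[abs_def]
    by (rule continuous_intros continuous_on_compose2[OF cont] subset_UNIV)+
  moreover have "compact ?K" by (simp add: angle_box_def)
  ultimately have "continuous_on (?q ` ?K) \<Phi>"
    using continuous_on_embed_coords \<Phi> by (intro continuous_on_compact_image_factor)
  then have "continuous_on (Vstar a1 a2 a3 a4) \<Phi>"
    using Vstar_covered[OF a_pos] by (meson continuous_on_subset subsetI)
  moreover have "\<Phi> ` Vstar a1 a2 a3 a4 \<subseteq> S2"
    by (auto simp: \<Phi>_def S2_def norm_f)
  moreover have "\<Phi> (V5_embed a1 a2 a3 a4 x) = \<phi> x" if x: "x \<in> points M" for x
  proof -
    obtain p where p: "p \<in> \<Omega>" "x = chart_map M p"
      using x unfolding points_def coords_V5 by blast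
    have "\<exists>p\<in>\<Omega>. p \<in> ?K \<and> chart_map M p = x"
    proof -
      \<comment> \<open>Coordinates of a point of the manifold may lie outside the box; each angle
        is replaced by one in [0, 2 pi] with the same \<open>cis\<close>.\<close>
      have red: "\<exists>t. 0 \<le> t \<and> t \<le> 2 * pi \<and> cis t = cis y" for y
      proof -
        obtain t where "0 \<le> t" "t < 2 * pi" "cos y = cos t" "sin y = sin t"
          using sincos_total_2pi[of "cos y" "sin y"] by auto
        then show ?thesis by (intro exI[of _ t]) (simp add: complex_eq_iff)
      qed
      then obtain t where t: "\<And>y. 0 \<le> t y" "\<And>y. t y \<le> 2 * pi" "\<And>y. cis (t y) = cis y"
        by metis
      let ?p = "vector [t (p $ 1), t (p $ 2), t (p $ 3), t (p $ 4), p $ 5] :: real ^ 5"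
      have "?p \<in> ?K" "?p \<in> \<Omega>"
        using t p(1) by (auto simp: mem_angle_box forall_5 I_dom_def)
      moreover have "chart_map M ?p = x"
        by (simp add: p(2) chart_map_V5 t)
      ultimately show ?thesis by blast
    qed
    then obtain p' where "p' \<in> ?K" "chart_map M p' = x" by blast
    then show ?thesis
      using \<Phi>[of p'] \<phi>_chart[of p'] by (simp add: embed_coords_def)
  qed
  ultimately show ?thesis by blast
qed

end

theorem corollary2p4:
  fixes k1 k2 k3 k4 :: int and a1 a2 a3 a4 :: real
  assumes "a1 > 0" "a2 > 0" "a3 > 0" "a4 > 0"
    and "a1 = \<bar>of_int k1\<bar>" "a2 = \<bar>of_int k2\<bar>" "a3 = \<bar>of_int k3\<bar>" "a4 = \<bar>of_int k4\<bar>"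
  shows "\<exists>\<alpha> :: real \<Rightarrow> real. smooth_on I_dom \<alpha> \<and> \<alpha> ` I_dom \<subseteq> {0<..<4*pi} \<and>
    (\<alpha> \<longlongrightarrow> 0) (at_right 0) \<and>
    (\<alpha> \<longlongrightarrow> pi) (at_left (pi/4)) \<and> (\<alpha> \<longlongrightarrow> pi) (at_right (pi/4)) \<and>
    (\<alpha> \<longlongrightarrow> 2*pi) (at_left (pi/2)) \<and> (\<alpha> \<longlongrightarrow> 2*pi) (at_right (pi/2)) \<and>
    (\<alpha> \<longlongrightarrow> 3*pi) (at_left (3*pi/4)) \<and> (\<alpha> \<longlongrightarrow> 3*pi) (at_right (3*pi/4)) \<and>
    (\<alpha> \<longlongrightarrow> 4*pi) (at_left pi) \<and>
    (\<exists>\<phi> :: (complex ^ 4) \<times> real \<Rightarrow> complex \<times> real.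
       (\<forall>\<theta>1 \<theta>2 \<theta>3 \<theta>4. \<forall>s\<in>I_dom.
          \<phi> (vector [cis \<theta>1, cis \<theta>2, cis \<theta>3, cis \<theta>4], s) =
            (of_real (sin (\<alpha> s)) * cis (of_int k1 * \<theta>1 + of_int k2 * \<theta>2 + of_int k3 * \<theta>3 + of_int k4 * \<theta>4),
             cos (\<alpha> s))) \<and>
       harmonic_morphism (V5 a1 a2 a3 a4) S2 \<phi> \<and>
       (\<exists>\<Phi> :: complex ^ 4 \<Rightarrow> complex \<times> real.
          continuous_on (Vstar a1 a2 a3 a4) \<Phi> \<and> \<Phi> ` Vstar a1 a2 a3 a4 \<subseteq> S2 \<and>
          (\<forall>x\<in>points (V5 a1 a2 a3 a4). \<Phi> (V5_embed a1 a2 a3 a4 x) = \<phi> x)))"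
proof -
  have k: "\<bar>k1\<bar> \<ge> 1" "\<bar>k3\<bar> \<ge> 1" using assms by auto
  have h: "1 \<le> h_fun a1 a2 a3 a4 s" for s
    using k assms by (intro h_fun_ge_1) auto
  have "continuous_on UNIV (h_fun a1 a2 a3 a4)"
    by (simp add: continuous_on_eq_continuous_at isCont_h_fun)
  \<comment> \<open>Four segments of length pi/4 fill [0, pi], and 1 is the lower bound for
    h.\<close>
  from profile_exists[OF this zero_less_one h, of 4] obtain \<alpha> where cont: "continuous_on UNIV \<alpha>"
    and ends: "\<And>j. j \<le> 4 \<Longrightarrow> \<alpha> (real j * pi/4) = real j * pi"
    and seg: "\<And>j s. j < 4 \<Longrightarrow> s \<in> {real j * pi/4<..<real (Suc j) * pi/4} \<Longrightarrow>
       \<alpha> s \<in> {real j * pi<..<real (Suc j) * pi} \<and>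
       (\<alpha> has_real_derivative 4 * h_fun a1 a2 a3 a4 s * sin (\<alpha> s) / sin (4 * s)) (at s)"
    by blast
  have sin_neq_0: "sin x \<noteq> 0" if "x \<in> {real j * pi<..<real (Suc j) * pi}" for x j
  proof -
    have "sin (x - real j * pi) > 0"
      using that by (intro sin_gt_zero) (auto simp: algebra_simps)
    moreover have "sin x = sin ((x - real j * pi) + real j * pi)" by simp
    then have "sin x = (-1) ^ j * sin (x - real j * pi)" by (simp only: sin_add sin_npi cos_npi) simp
    ultimately show ?thesis by (metis less_irrefl mult_eq_0_iff power_eq_0_iff zero_neq_neg_one)
  qed
  interpret torus_profile k1 k2 k3 k4 a1 a2 a3 a4 \<alpha>
  proof
    fix s assume "s \<in> I_dom"
    then obtain j where "j < 4" "s \<in> {real j * pi/4<..<real (Suc j) * pi/4}"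
      unfolding I_dom_eq by blast
    from seg[OF this] sin_neq_0[of "\<alpha> s" j]
    show "(\<alpha> has_real_derivative 4 * h_fun a1 a2 a3 a4 s * sin (\<alpha> s) / sin (4 * s)) (at s)"
      "sin (\<alpha> s) \<noteq> 0" by blast+
  qed (use assms in auto)
  have "\<alpha> ` I_dom \<subseteq> {0<..<4*pi}"
  proof
    fix y assume "y \<in> \<alpha> ` I_dom"
    then obtain j s where j: "j < 4" "s \<in> {real j * pi/4<..<real (Suc j) * pi/4}" "y = \<alpha> s"
      unfolding I_dom_eq by blast
    then have "real j * pi < y" "y < real (Suc j) * pi" using seg by auto
    moreover have "real (Suc j) * pi \<le> 4 * pi" "0 \<le> real j * pi"
      using j(1) by (auto intro!: mult_right_mono)
    ultimately show "y \<in> {0<..<4*pi}"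
      unfolding greaterThanLessThan_iff by linarith
  qed
  \<comment> \<open>The profile is continuous on the whole line, so every one-sided limit at a
    multiple of pi/4 is its value there.\<close>
  moreover have lim: "(\<alpha> \<longlongrightarrow> \<alpha> x) (at x within A)" for x A
    using cont by (meson UNIV_I continuous_on_def continuous_within continuous_on_eq_continuous_within
        continuous_within_subset subset_UNIV)
  have \<alpha>_values: "\<alpha> 0 = 0" "\<alpha> (pi/4) = pi" "\<alpha> (pi/2) = 2*pi" "\<alpha> (3*pi/4) = 3*pi" "\<alpha> pi = 4*pi"
    using ends[of 0] ends[of 1] ends[of 2] ends[of 3] ends[of 4] by simp_all
  moreover have "\<phi> (vector [cis \<theta>1, cis \<theta>2, cis \<theta>3, cis \<theta>4], s) =
      (of_real (sin (\<alpha> s)) * cis (of_int k1 * \<theta>1 + of_int k2 * \<theta>2 + of_int k3 * \<theta>3 + of_int k4 * \<theta>4),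
       cos (\<alpha> s))" for \<theta>1 \<theta>2 \<theta>3 \<theta>4 s
    by (simp add: \<phi>_def cis_power_int cis_mult scaleR_conv_of_real)
  moreover have "harmonic_morphism M S2 \<phi>"
    unfolding harmonic_morphism_def using harmonic_\<phi> horizontally_weakly_conformal_\<phi> ..
  moreover have "smooth_on I_dom \<alpha>"
    unfolding smooth_on_def using Ck_on_\<alpha> by blast
  ultimately show ?thesis
    using continuous_extension[OF ends cont] lim[of 0] lim[of "pi/4"] lim[of "pi/2"] lim[of "3*pi/4"] lim[of pi]
    unfolding \<alpha>_values by (intro exI[of _ \<alpha>] conjI exI[of _ \<phi>] allI ballI) auto
qed

end
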